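(* Let $m\in\mathbb N$, let $\mathcal G=\{[a_i,b_i),h_i,\Gamma_i;\ i\le m\}$ be a differential grid of dimension $m$, and let $f=(f_1,\dots,f_m)$ be an $\mathbb R^m$-valued random vector on $(\Omega,\mathcal F,P)$. Suppose that every component of $f$ is differentiable with respect to $\mathcal G$, either in the a.s. sense or in the $L_p$ sense for some $p\ge 1$. Put $\Sigma^{f,\mathcal G}=(D_i^{\mathcal G}f_j)_{i,j=1}^m$ and $$\mathcal N(f,\mathcal G)=\{\omega:\ \text{the matrix }\Sigma^{f,\mathcal G}(\omega)\text{ is non-degenerate}\}.$$ Then $$P\big|_{\mathcal N(f,\mathcal G)}\circ f^{-1}\ll\lambda^m .$$
   Context: Probability space. $\mathbb R^+=[0,\infty)$; $\mathbb U$ is a locally compact metric space and $\Pi$ is a $\sigma$-finite measure on its Borel $\sigma$-algebra $\mathcal B(\mathbb U)$ which is finite on bounded Borel sets. $\Omega$ is the space of configurations (locally finite subsets) of $\mathbb R^+\times\mathbb U$ with the vague topology (the weakest topology making $\varpi\mapsto\sum_{(t,u)\in\varpi}f(t,u)$ continuous for every continuous $f$ with bounded support), $\mathcal F$ is its Borel $\sigma$-algebra, and $P$ is the law of the Poisson point measure $\nu$ on $\mathbb R^+\times\mathbb U$ with intensity measure $dt\,\Pi(du)$; $\nu(\omega)=\omega$. Time stretching transformations. $H_0=L_\infty(\mathbb R^+)\cap L_2(\mathbb R^+)$, $Jh(t)=\int_0^t h(s)\,ds$. For $h\in H_0$, $T_hx$ is the value at $s=1$ of the solution of $z'(s)=Jh(z(s))$,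 $z(0)=x$ ($x\in\mathbb R^+$). $\mathbb U_{fin}$ is the family of bounded Borel subsets of $\mathbb U$. For $h\in H_0$, $\Gamma\in\mathbb U_{fin}$, the bijection $T_h^\Gamma:\Omega\to\Omega$ replaces each point $(\tau,u)$ of the configuration with $u\in\Gamma$ by $(T_{-h}\tau,u)$ and leaves the points with $u\notin\Gamma$ unchanged. It acts on random variables by $T_h^\Gamma f(\omega)=f(T_h^\Gamma\omega)$. Derivatives. $f\in L_0(\Omega,\mathcal F,P)$ is a.s. differentiable in direction $(h,\Gamma)$ with derivative $D_h^\Gamma f$ if $\varepsilon^{-1}(T_{\varepsilon h}^\Gamma f-f)\to D_h^\Gamma f$ a.s. as $\varepsilon\to0$; for $p\in[1,\infty)$, $f\in L_p(\Omega,\mathcal F,P)$ is $L_p$-differentiable if this convergence holds in $L_p$. Grid. A differential grid of dimension $m$ is a family $\mathcal G=\{[a_i,b_i)\subset\mathbb R^+,\ h_i\in H_0,\ \Gamma_i\in\mathbb U_{fin};\ i\le m\}$ such that (i) the sets $[a_i,b_i)\times\Gamma_i$ are pairwise disjoint; (ii) for every $i\le m$, $Jh_i>0$ on $(a_i,b_i)$ and $Jh_i=0$ outside $(a_i,b_i)$. A functional is differentiable w.r.t. $\mathcal G$ (a.s. or in $L_p$) if it is differentiable (in that sense) in every direction $(h_i,\Gamma_i)$, $i=1,\dots,m$; $D_i^{\mathcal G}f=D_{h_i}^{\Gamma_i}f$. Notation. $\lambda^m$ is Lebesgue measure on $\mathbb R^m$; $P|_A\circ f^{-1}(B)=P(A\cap\{f\in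 B\})$. *)

theory Defs
  imports "HOL-Analysis.Analysis" "HOL-Probability.Probability"
begin

section \<open>Configurations on the half-line times a mark space\<close>

text \<open>
  A configuration is a set of pairs (time, mark). Local finiteness means finitely many points in
  every bounded set; this is what makes the sums over configurations in the vague topology finite
  when bounded sets need not be relatively compact.
\<close>

definition configurations :: "(real \<times> 'u::metric_space) set set" where
  "configurations =
     {\<omega>. \<omega> \<subseteq> {0..} \<times> UNIV \<and> (\<forall>B. bounded B \<longrightarrow> finite (\<omega> \<inter> B))}"

definition test_function :: "(real \<times> 'u::metric_space \<Rightarrow> real) \<Rightarrow> bool" where
  "test_function \<phi> \<longleftrightarrow>
     continuous_on ({0..} \<times> UNIV) \<phi> \<and> bounded {x \<in> {0..} \<times> UNIV. \<phi> x \<noteq> 0}"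

definition config_sum :: "(real \<times> 'u \<Rightarrow> real) \<Rightarrow> (real \<times> 'u) set \<Rightarrow> real" where
  "config_sum \<phi> \<omega> = (\<Sum>x\<in>{x \<in> \<omega>. \<phi> x \<noteq> 0}. \<phi> x)"

definition vague_topology :: "(real \<times> 'u::metric_space) set topology" where
  "vague_topology = topology_generated_by
     {{\<omega> \<in> configurations. config_sum \<phi> \<omega> \<in> V} | \<phi> V. test_function \<phi> \<and> open V}"

definition vague_borel :: "(real \<times> 'u::metric_space) set measure" where
  "vague_borel = sigma configurations {A. openin vague_topology A}"

definition count_algebra :: "(real \<times> 'u::metric_space) set measure" where
  "count_algebra = sigma configurations
     {{\<omega> \<in> configurations. card (\<omega> \<inter> A) = k} | A k.
        A \<in> sets (borel \<Otimes>\<^sub>M borel) \<and> bounded A}"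

section \<open>The Poisson law\<close>

definition half_line :: "real measure" where
  "half_line = restrict_space lborel {0..}"

definition intensity :: "'u::metric_space measure \<Rightarrow> (real \<times> 'u) measure" where
  "intensity \<mu> = half_line \<Otimes>\<^sub>M \<mu>"

definition finite_intensity_sets :: "'u::metric_space measure \<Rightarrow> (real \<times> 'u) set set" where
  "finite_intensity_sets \<mu> =
     {A \<in> sets (intensity \<mu>). emeasure (intensity \<mu>) A < \<infinity>}"

text \<open>
  The Poisson property prescribes the finite-dimensional distributions of the counts, hence a
  measure on the sigma-algebra generated by the counts. The last conjunct says that the law on the
  vague Borel sigma-algebra is the one they determine. If the mark space is separable, the two
  sigma-algebras coincide and the conjunct is redundant. Otherwise the vague Borel sigma-algebra
  may be larger, and the counts alone need not determine a law on it: if the continuum is a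
  real-valued measurable cardinal, there are extensions under which an arrival time is almost
  surely a function of the marks.

  The point probabilities are written out because the library's Poisson distribution requires a
  positive rate.
\<close>

definition poisson_law ::
    "'u::metric_space measure \<Rightarrow> (real \<times> 'u) set measure \<Rightarrow> bool" where
  "poisson_law \<mu> P \<longleftrightarrow>
     prob_space P \<and> sets P = sets vague_borel \<and>
     (\<forall>A \<in> finite_intensity_sets \<mu>. \<forall>k.
        measure P {\<omega> \<in> space P. finite (\<omega> \<inter> A) \<and> card (\<omega> \<inter> A) = k} =
          exp (- measure (intensity \<mu>) A) * measure (intensity \<mu>) A ^ k / fact k) \<and>
     (\<forall>\<A>. finite \<A> \<and> \<A> \<subseteq> finite_intensity_sets \<mu> \<and> disjoint \<A> \<longrightarrow>
        prob_space.indep_vars P (\<lambda>_. count_space UNIV) (\<lambda>A \<omega>. card (\<omega> \<inter> A)) \<A>) \<and>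
     sets P \<subseteq> sets (completion (restr_to_subalg P count_algebra))"

section \<open>Time stretching transformations\<close>

definition H0 :: "(real \<Rightarrow> real) set" where
  "H0 = {h. h \<in> borel_measurable half_line \<and>
            (\<exists>C. AE t in half_line. \<bar>h t\<bar> \<le> C) \<and>
            integrable half_line (\<lambda>t. (h t)\<^sup>2)}"

definition J :: "(real \<Rightarrow> real) \<Rightarrow> real \<Rightarrow> real" where
  "J h t = (LINT s:{0..t}|lborel. h s)"

text \<open>For h in H0, J h is Lipschitz on the half-line and vanishes at 0, so the solution below
  exists and is unique.\<close>

definition time_stretch :: "(real \<Rightarrow> real) \<Rightarrow> real \<Rightarrow> real" where
  "time_stretch h x =
     (THE y. \<exists>z. z 0 = x \<and> z 1 = y \<and>
        (\<forall>s\<in>{0..1}. 0 \<le> z s \<and> (z has_real_derivative J h (z s)) (at s within {0..1})))"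

definition bounded_borel :: "'u::metric_space set set" where
  "bounded_borel = {\<Gamma> \<in> sets borel. bounded \<Gamma>}"

definition config_stretch ::
    "(real \<Rightarrow> real) \<Rightarrow> 'u set \<Rightarrow> (real \<times> 'u) set \<Rightarrow> (real \<times> 'u) set" where
  "config_stretch h \<Gamma> \<omega> =
     (\<lambda>(\<tau>, u). (if u \<in> \<Gamma> then time_stretch (\<lambda>t. - h t) \<tau> else \<tau>, u)) ` \<omega>"

section \<open>Derivatives\<close>

definition diff_quotient :: "(real \<Rightarrow> real) \<Rightarrow> 'u set \<Rightarrow> ((real \<times> 'u) set \<Rightarrow> real) \<Rightarrow>
    real \<Rightarrow> (real \<times> 'u) set \<Rightarrow> real" where
  "diff_quotient h \<Gamma> f \<epsilon> \<omega> = (f (config_stretch (\<lambda>t. \<epsilon> * h t) \<Gamma> \<omega>) - f \<omega>) / \<epsilon>"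

definition has_as_derivative :: "(real \<times> 'u) set measure \<Rightarrow> (real \<Rightarrow> real) \<Rightarrow> 'u set \<Rightarrow>
    ((real \<times> 'u) set \<Rightarrow> real) \<Rightarrow> ((real \<times> 'u) set \<Rightarrow> real) \<Rightarrow> bool" where
  "has_as_derivative P h \<Gamma> f D \<longleftrightarrow>
     f \<in> borel_measurable P \<and> D \<in> borel_measurable P \<and>
     (AE \<omega> in P. ((\<lambda>\<epsilon>. diff_quotient h \<Gamma> f \<epsilon> \<omega>) \<longlongrightarrow> D \<omega>) (at 0))"

definition in_Lp :: "real \<Rightarrow> 'a measure \<Rightarrow> ('a \<Rightarrow> real) \<Rightarrow> bool" where
  "in_Lp p M f \<longleftrightarrow> f \<in> borel_measurable M \<and> integrable M (\<lambda>x. \<bar>f x\<bar> powr p)"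

definition has_Lp_derivative :: "real \<Rightarrow> (real \<times> 'u) set measure \<Rightarrow> (real \<Rightarrow> real) \<Rightarrow> 'u set \<Rightarrow>
    ((real \<times> 'u) set \<Rightarrow> real) \<Rightarrow> ((real \<times> 'u) set \<Rightarrow> real) \<Rightarrow> bool" where
  "has_Lp_derivative p P h \<Gamma> f D \<longleftrightarrow>
     in_Lp p P f \<and> in_Lp p P D \<and>
     ((\<lambda>\<epsilon>. \<integral>\<^sup>+ \<omega>. ennreal (\<bar>diff_quotient h \<Gamma> f \<epsilon> \<omega> - D \<omega>\<bar> powr p) \<partial>P)
        \<longlongrightarrow> 0) (at 0)"

section \<open>Differential grids\<close>

definition differential_grid :: "('m::finite \<Rightarrow> real) \<Rightarrow> ('m \<Rightarrow> real) \<Rightarrow>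
    ('m \<Rightarrow> real \<Rightarrow> real) \<Rightarrow> ('m \<Rightarrow> 'u::metric_space set) \<Rightarrow> bool" where
  "differential_grid a b h \<Gamma> \<longleftrightarrow>
     (\<forall>i. {a i..<b i} \<subseteq> {0..} \<and> h i \<in> H0 \<and> \<Gamma> i \<in> bounded_borel) \<and>
     disjoint_family (\<lambda>i. {a i..<b i} \<times> \<Gamma> i) \<and>
     (\<forall>i. (\<forall>t\<in>{a i<..<b i}. J (h i) t > 0) \<and>
          (\<forall>t\<in>{0..} - {a i<..<b i}. J (h i) t = 0))"

text \<open>For one functional f, the family D collects its derivatives in the directions of the grid.\<close>

definition has_grid_derivatives :: "(real \<times> 'u) set measure \<Rightarrow> ('m::finite \<Rightarrow> real \<Rightarrow> real) \<Rightarrow>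
    ('m \<Rightarrow> 'u set) \<Rightarrow> ((real \<times> 'u) set \<Rightarrow> real) \<Rightarrow> ('m \<Rightarrow> (real \<times> 'u) set \<Rightarrow> real) \<Rightarrow> bool" where
  "has_grid_derivatives P h \<Gamma> f D \<longleftrightarrow>
     (\<forall>i. has_as_derivative P (h i) (\<Gamma> i) f (D i)) \<or>
     (\<exists>p\<ge>1. \<forall>i. has_Lp_derivative p P (h i) (\<Gamma> i) f (D i))"

end

theory Submission
  imports Defs
begin

text \<open>
  The stretchings of the grid commute and form an action \<open>T\<^sub>t\<close>, \<open>t \<in> \<real>\<^sup>m\<close>, on configurations, which
  in suitable coordinates translates the times of the points lying in the cells of the grid. On the
  invariant event that exactly \<open>n\<close> points lie in the cells, the Poisson law transported by \<open>T\<^sub>t\<close> is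
  bounded by a constant multiple of itself, so a property that holds almost surely holds for almost
  every configuration along almost all of its orbit, and conversely.

  Along almost every orbit, \<open>g(t) = f(T\<^sub>t \<omega>)\<close> has partial derivatives at almost every \<open>t\<close>, in a sense
  that ignores null sets of increments: this is immediate for almost sure derivatives; for derivatives
  in the mean, \<open>g\<close> agrees almost everywhere on almost every line with an indefinite integral. By
  Lebesgue density, \<open>g\<close> is then approximately differentiable almost everywhere. Up to a null set, the
  points with an invertible derivative are covered by countably many pieces on which \<open>g\<close> is
  expanding, so the preimage of a null set in such a piece is the Lipschitz image of a null set.
\<close>

section \<open>Lebesgue points and essential derivatives\<close>

text \<open>Each component is differentiable only in the \<open>m\<close> grid directions separately
  and only at almost every configuration; nothing is continuous. Hence no inverse function theorem
  applies, and linear approximation holds only up to sets of small relative measure. No single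
  constant bounds the transported law: inside the cells the intensity changes by a factor at most
  \<open>c\<close>, each point there contributes one such factor, and the number \<open>n\<close> of
  these points is unbounded. This is the origin of the constant \<open>c ^ n\<close> and of the
  countable cover by the events \<open>Om n\<close>. The transported law is compared on the
  sigma-algebra generated by the counts, where Poisson independence and the measurability of the
  stretchings can be tested on generators. The last conjunct of \<open>poisson_law\<close> carries
  null sets, and with them versions of random variables, between this sigma-algebra and the vague
  Borel one.\<close>

lemma AE_negligible:
  assumes "negligible (N :: 'a::euclidean_space set)"
  shows "AE x in lborel. x \<notin> N"
proof -
  have "AE x in lebesgue. x \<notin> N"
    using assms by (simp add: negligible_iff_null_sets AE_not_in)
  then show ?thesis
    by (simp add: AE_completion_iff)
qed

text \<open>By outer regularity the zero set of \<open>u\<close> has neighbourhoods of small \<open>u\<close>-mass, and a Vitali cover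
  bounds the bad set by a multiple of that mass.\<close>

lemma average_tendsto_zero:
  fixes u :: "real \<Rightarrow> ennreal"
  assumes [measurable]: "u \<in> borel_measurable borel"
    and fin: "(\<integral>\<^sup>+y. u y \<partial>lborel) < \<infinity>"
  shows "AE x in lborel. u x = 0 \<longrightarrow>
    (\<forall>c>0. \<exists>\<delta>>0. \<forall>r. 0 < r \<and> r \<le> \<delta> \<longrightarrow> (\<integral>\<^sup>+y. u y * indicator {x - r..x + r} y \<partial>lborel) \<le> ennreal (c * r))"
proof -
  define \<nu> where "\<nu> = density lborel u"
  have [measurable_cong, simp]: "sets \<nu> = sets borel" by (simp add: \<nu>_def)
  have emb: "emeasure \<nu> A = (\<integral>\<^sup>+y. u y * indicator A y \<partial>lborel)" if "A \<in> sets borel" for A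
    using that by (simp add: \<nu>_def emeasure_density)
  \<comment> \<open>Points whose balls have mass above \<open>c * r\<close> at arbitrarily small
    radii. Measurability of \<open>S c\<close> is not at issue: \<open>negligible_outer_le\<close>
    asks only for measurable supersets of small measure.\<close>
  define S where "S c = {x. u x = 0 \<and> (\<forall>\<delta>>0. \<exists>r. 0 < r \<and> r \<le> \<delta> \<and> ennreal (c * r) < emeasure \<nu> (cball x r))}" for c
  define Z where "Z = {x. u x = 0}"
  have Zm[measurable]: "Z \<in> sets borel" unfolding Z_def by measurable
  have Z0: "emeasure \<nu> Z = 0"
    by (subst emb[OF Zm], subst nn_integral_0_iff_AE) (auto simp: Z_def indicator_def)
  have fin\<nu>: "emeasure \<nu> (space \<nu>) \<noteq> \<infinity>"
    using fin emb[of UNIV] by (simp add: \<nu>_def)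
  have neg: "negligible (S c)" if "c > 0" for c
    unfolding negligible_outer_le
  proof (intro allI impI)
    fix e :: real assume "e > 0"
    have "(INF U\<in>{U. Z \<subseteq> U \<and> open U}. emeasure \<nu> U) = 0"
      using outer_regular[of \<nu> Z] fin\<nu> Z0 by simp
    \<comment> \<open>The bound \<open>c * e / 2\<close> anticipates the comparison below: a ball of
      the cover has length \<open>2 * r\<close> and mass above \<open>c * r\<close>, so its length
      is at most \<open>2 / c\<close> times its mass.\<close>
    then have "(INF U\<in>{U. Z \<subseteq> U \<and> open U}. emeasure \<nu> U) < ennreal (c * e / 2)"
      using \<open>c > 0\<close> \<open>e > 0\<close> by simp
    then obtain U where U: "Z \<subseteq> U" "open U" "emeasure \<nu> U < ennreal (c * e / 2)"
      unfolding INF_less_iff by auto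
    define K where "K = {(x, r). x \<in> S c \<and> 0 < r \<and> cball x r \<subseteq> U \<and> ennreal (c * r) < emeasure \<nu> (cball x r)}"
    have ex: "\<exists>i. i \<in> K \<and> x \<in> cball (fst i) (snd i) \<and> snd i < d" if x: "x \<in> S c" and d: "0 < d" for x d
    proof -
      have "x \<in> U" using x U by (auto simp: S_def Z_def)
      then obtain d' where d': "d' > 0" "cball x d' \<subseteq> U"
        using \<open>open U\<close> open_contains_cball by blast
      define \<delta> where "\<delta> = min d' (d/2)"
      have "\<delta> > 0" using d d' by (auto simp: \<delta>_def)
      then obtain r where r: "0 < r" "r \<le> \<delta>" "ennreal (c * r) < emeasure \<nu> (cball x r)"
        using x by (auto simp: S_def)
      have "cball x r \<subseteq> cball x d'" using r by (auto simp: \<delta>_def)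
      then have "(x, r) \<in> K" using r d' x unfolding K_def by auto
      then show ?thesis using r d by (intro exI[of _ "(x, r)"]) (auto simp: \<delta>_def)
    qed
    have rK: "0 < snd i" if "i \<in> K" for i using that by (auto simp: K_def)
    obtain C where C: "countable C" "C \<subseteq> K"
        "pairwise (\<lambda>i j. disjnt (cball (fst i) (snd i)) (cball (fst j) (snd j))) C"
        "negligible (S c - (\<Union>i \<in> C. cball (fst i) (snd i)))"
      by (rule Vitali_covering_theorem_cballs[of K snd "S c" fst], erule rK, erule (1) ex, rule that)
    let ?B = "\<lambda>i::real\<times>real. cball (fst i) (snd i)"
    have disj: "disjoint_family_on ?B C"
      using C(3) by (auto simp: disjoint_family_on_def pairwise_def disjnt_def)
    let ?V = "\<Union>i\<in>C. ?B i"
    have Vm: "?V \<in> sets borel"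
      using C(1) by (auto intro!: sets.countable_UN')
    have "emeasure lborel ?V = (\<integral>\<^sup>+i. emeasure lborel (?B i) \<partial>count_space C)"
      by (rule emeasure_UN_countable) (use C disj in auto)
    also have "\<dots> \<le> (\<integral>\<^sup>+i. ennreal (2 / c) * emeasure \<nu> (?B i) \<partial>count_space C)"
    proof (rule nn_integral_mono)
      fix i assume "i \<in> space (count_space C)"
      then have i: "i \<in> K" using C by auto
      then have r: "0 < snd i" "ennreal (c * snd i) \<le> emeasure \<nu> (?B i)" by (auto simp: K_def)
      have "emeasure lborel (?B i) = ennreal (2 * snd i)"
        using r by (simp add: cball_eq_atLeastAtMost)
      also have "\<dots> = ennreal (2 / c) * ennreal (c * snd i)"
        using \<open>c > 0\<close> r by (subst ennreal_mult[symmetric]) auto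
      also have "\<dots> \<le> ennreal (2 / c) * emeasure \<nu> (?B i)"
        using r by (intro mult_left_mono) auto
      finally show "emeasure lborel (?B i) \<le> ennreal (2 / c) * emeasure \<nu> (?B i)" .
    qed
    also have "\<dots> = ennreal (2 / c) * (\<integral>\<^sup>+i. emeasure \<nu> (?B i) \<partial>count_space C)"
      by (rule nn_integral_cmult) simp
    also have "(\<integral>\<^sup>+i. emeasure \<nu> (?B i) \<partial>count_space C) = emeasure \<nu> ?V"
      by (rule emeasure_UN_countable[symmetric]) (use C disj in auto)
    also have "emeasure \<nu> ?V \<le> emeasure \<nu> U"
    proof (rule emeasure_mono)
      have "?B i \<subseteq> U" if "i \<in> K" for i using that by (cases i) (simp add: K_def)
      then show "?V \<subseteq> U" using C(2) by blast
      show "U \<in> sets \<nu>" using U by simp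
    qed
    also have "emeasure \<nu> U \<le> ennreal (c * e / 2)" using U by simp
    also have "ennreal (2 / c) * ennreal (c * e / 2) = ennreal e"
      using \<open>c > 0\<close> \<open>e > 0\<close> by (subst ennreal_mult[symmetric]) auto
    finally have le: "emeasure lborel ?V \<le> ennreal e"
      by (simp add: mult_left_mono)
    have VL: "?V \<in> lmeasurable"
      using Vm order.strict_trans1[OF le ennreal_less_top] by (intro fmeasurableI) auto
    let ?N = "S c - ?V"
    have N: "?N \<in> null_sets lebesgue" using C(4) by (simp add: negligible_iff_null_sets)
    show "\<exists>T. S c \<subseteq> T \<and> T \<in> lmeasurable \<and> measure lebesgue T \<le> e"
    proof (intro exI[of _ "?V \<union> ?N"] conjI)
      show "?V \<union> ?N \<in> lmeasurable"
        using VL C(4) by (intro fmeasurable.Un) (auto simp: negligible_imp_measurable)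
      have "measure lebesgue (?V \<union> ?N) = measure lebesgue ?V"
        using N VL by (intro measure_Un_null_set) auto
      also have "\<dots> \<le> e"
        using le \<open>e > 0\<close> Vm by (simp add: measure_def enn2real_leI)
      finally show "measure lebesgue (?V \<union> ?N) \<le> e" .
    qed auto
  qed
  \<comment> \<open>\<open>S c\<close> shrinks as \<open>c\<close> grows, so the countably many
    values \<open>1 / Suc n\<close> account for all \<open>c > 0\<close>.\<close>
  have "AE x in lborel. \<forall>n. x \<notin> S (1 / Suc n)"
    unfolding AE_all_countable by (auto intro!: AE_negligible neg)
  then show ?thesis
  proof (rule AE_mp, intro AE_I2 impI allI)
    fix x c :: real
    assume *: "\<forall>n. x \<notin> S (1 / Suc n)" and "u x = 0" "c > 0"
    obtain n where n: "1 / Suc n < c" using nat_approx_posE[OF \<open>c > 0\<close>] by auto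
    from \<open>u x = 0\<close> obtain \<delta> where \<delta>: "\<delta> > 0"
      "\<forall>r. 0 < r \<and> r \<le> \<delta> \<longrightarrow> emeasure \<nu> (cball x r) \<le> ennreal (1 / Suc n * r)"
      using *[rule_format, of n] unfolding S_def by (simp add: not_less) (meson not_less)
    show "\<exists>\<delta>>0. \<forall>r. 0 < r \<and> r \<le> \<delta> \<longrightarrow> (\<integral>\<^sup>+y. u y * indicator {x - r..x + r} y \<partial>lborel) \<le> ennreal (c * r)"
    proof (intro exI[of _ \<delta>] conjI allI impI \<open>\<delta> > 0\<close>)
      fix r assume r: "0 < r \<and> r \<le> \<delta>"
      have "(\<integral>\<^sup>+y. u y * indicator {x - r..x + r} y \<partial>lborel) = emeasure \<nu> (cball x r)"
        by (subst emb) (auto simp: cball_eq_atLeastAtMost)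
      also have "\<dots> \<le> ennreal (1 / Suc n * r)" using \<delta>(2) r by blast
      also have "\<dots> \<le> ennreal (c * r)" using n r by (intro ennreal_leI mult_right_mono) auto
      finally show "(\<integral>\<^sup>+y. u y * indicator {x - r..x + r} y \<partial>lborel) \<le> ennreal (c * r)" .
    qed
  qed
qed

section \<open>Lebesgue points of locally integrable functions\<close>

definition lebesgue_point :: "(real \<Rightarrow> real) \<Rightarrow> real \<Rightarrow> bool" where
  "lebesgue_point \<psi> x \<longleftrightarrow> (\<forall>c>0. \<exists>\<delta>>0. \<forall>r. 0 < r \<and> r \<le> \<delta> \<longrightarrow>
     (\<integral>\<^sup>+y. ennreal \<bar>\<psi> y - \<psi> x\<bar> * indicator {x - r..x + r} y \<partial>lborel) \<le> ennreal (c * r))"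

definition loc_integrable :: "(real \<Rightarrow> real) \<Rightarrow> bool" where
  "loc_integrable \<psi> \<longleftrightarrow> \<psi> \<in> borel_measurable borel \<and>
     (\<forall>n::nat. (\<integral>\<^sup>+y. ennreal \<bar>\<psi> y\<bar> * indicator {- real n..real n} y \<partial>lborel) < \<infinity>)"

text \<open>The preceding lemma speaks only of zeros of a nonnegative function. For rational
  \<open>p\<close> and \<open>q\<close> with \<open>p < \<psi> x\<close> and
  \<open>\<psi> x < q\<close>, the function \<open>\<bar>\<psi> - p\<bar>\<close>, set to
  \<open>0\<close> where \<open>\<psi>\<close> lies strictly between \<open>p\<close> and
  \<open>q\<close>, vanishes at \<open>x\<close>, so its averages there are small; where it was set
  to \<open>0\<close>, \<open>\<psi>\<close> differs from \<open>\<psi> x\<close> by less than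
  \<open>q - p\<close>. Countably many pairs suffice.\<close>

lemma AE_lebesgue_point:
  assumes "loc_integrable \<psi>"
  shows "AE x in lborel. lebesgue_point \<psi> x"
proof -
  have [measurable]: "\<psi> \<in> borel_measurable borel"
    and fin: "\<And>n. (\<integral>\<^sup>+y. ennreal \<bar>\<psi> y\<bar> * indicator {- real n..real n} y \<partial>lborel) < \<infinity>"
    using assms by (auto simp: loc_integrable_def)
  define u :: "nat \<Rightarrow> real \<Rightarrow> real \<Rightarrow> real \<Rightarrow> ennreal" where
    "u n p q y = ennreal \<bar>\<psi> y - p\<bar> * indicator {y. \<not> (p < \<psi> y \<and> \<psi> y < q)} y * indicator {- real n..real n} y" for n p q y
  have [measurable]: "u n p q \<in> borel_measurable borel" for n p q
    unfolding u_def by measurable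
  have ufin: "(\<integral>\<^sup>+y. u n p q y \<partial>lborel) < \<infinity>" for n p q
  proof -
    have "(\<integral>\<^sup>+y. u n p q y \<partial>lborel) \<le> (\<integral>\<^sup>+y. ennreal \<bar>\<psi> y\<bar> * indicator {- real n..real n} y + ennreal \<bar>p\<bar> * indicator {- real n..real n} y \<partial>lborel)"
      by (rule nn_integral_mono) (auto simp: u_def indicator_def ennreal_plus[symmetric] simp del: ennreal_plus intro!: ennreal_leI)
    also have "\<dots> = (\<integral>\<^sup>+y. ennreal \<bar>\<psi> y\<bar> * indicator {- real n..real n} y \<partial>lborel) + ennreal \<bar>p\<bar> * ennreal (2 * real n)"
      by (subst nn_integral_add) (auto simp: nn_integral_cmult_indicator)
    also have "\<dots> < \<infinity>" using fin[of n] by (simp add: ennreal_mult_less_top)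
    finally show ?thesis .
  qed
  have "AE x in lborel. \<forall>n. \<forall>p\<in>\<rat>. \<forall>q\<in>\<rat>. u n p q x = 0 \<longrightarrow>
    (\<forall>c>0. \<exists>\<delta>>0. \<forall>r. 0 < r \<and> r \<le> \<delta> \<longrightarrow> (\<integral>\<^sup>+y. u n p q y * indicator {x - r..x + r} y \<partial>lborel) \<le> ennreal (c * r))"
    unfolding AE_all_countable
    by (intro allI AE_ball_countable' countable_rat average_tendsto_zero ufin) simp_all
  then show ?thesis
  proof (rule AE_mp, intro AE_I2 impI)
    fix x
    assume H: "\<forall>n. \<forall>p\<in>\<rat>. \<forall>q\<in>\<rat>. u n p q x = 0 \<longrightarrow>
    (\<forall>c>0. \<exists>\<delta>>0. \<forall>r. 0 < r \<and> r \<le> \<delta> \<longrightarrow> (\<integral>\<^sup>+y. u n p q y * indicator {x - r..x + r} y \<partial>lborel) \<le> ennreal (c * r))"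
    show "lebesgue_point \<psi> x"
      unfolding lebesgue_point_def
    proof (intro allI impI)
      fix c :: real assume "c > 0"
      \<comment> \<open>The strip between \<open>p\<close> and \<open>q\<close> has width below
        \<open>c / 4\<close>. Off it, \<open>\<bar>\<psi> y - \<psi> x\<bar>\<close> exceeds
        \<open>\<bar>\<psi> y - p\<bar>\<close> by at most \<open>c / 8\<close>. The bound
        \<open>3 * c / 8\<close> serves both cases; over length \<open>2 * r\<close> it leaves room
        for \<open>c / 4 * r\<close>.\<close>
      obtain p where p: "p \<in> \<rat>" "\<psi> x - c/8 < p" "p < \<psi> x"
        using Rats_dense_in_real[of "\<psi> x - c/8" "\<psi> x"] \<open>c > 0\<close> by auto
      obtain q where q: "q \<in> \<rat>" "q < \<psi> x + c/8" "\<psi> x < q"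
        using Rats_dense_in_real[of "\<psi> x" "\<psi> x + c/8"] \<open>c > 0\<close> by auto
      \<comment> \<open>With radii at most \<open>1\<close>, the intervals around \<open>x\<close>
        stay inside the window \<open>{- real n..real n}\<close> that makes \<open>u\<close>
        integrable.\<close>
      obtain n where n: "real n > \<bar>x\<bar> + 1" using reals_Archimedean2 by blast
      have "u n p q x = 0" using p q by (simp add: u_def)
      then obtain \<delta> where \<delta>: "\<delta> > 0" and "\<And>r. 0 < r \<Longrightarrow> r \<le> \<delta> \<Longrightarrow> (\<integral>\<^sup>+y. u n p q y * indicator {x - r..x + r} y \<partial>lborel) \<le> ennreal (c/4 * r)"
        using H[rule_format, OF p(1) q(1), of n "c/4"] \<open>c > 0\<close> by auto
      note D = this(2)
      show "\<exists>\<delta>>0. \<forall>r. 0 < r \<and> r \<le> \<delta> \<longrightarrow>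
           (\<integral>\<^sup>+y. ennreal \<bar>\<psi> y - \<psi> x\<bar> * indicator {x - r..x + r} y \<partial>lborel) \<le> ennreal (c * r)"
      proof (intro exI[of _ "min \<delta> 1"] conjI allI impI)
        fix r assume r: "0 < r \<and> r \<le> min \<delta> 1"
        have "(\<integral>\<^sup>+y. ennreal \<bar>\<psi> y - \<psi> x\<bar> * indicator {x - r..x + r} y \<partial>lborel)
           \<le> (\<integral>\<^sup>+y. u n p q y * indicator {x - r..x + r} y + ennreal (3*c/8) * indicator {x - r..x + r} y \<partial>lborel)"
        proof (rule nn_integral_mono)
          fix y
          show "ennreal \<bar>\<psi> y - \<psi> x\<bar> * indicator {x - r..x + r} y \<le> u n p q y * indicator {x - r..x + r} y + ennreal (3*c/8) * indicator {x - r..x + r} y"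
          proof (cases "y \<in> {x-r..x+r}")
            case True
            then have y: "y \<in> {- real n..real n}" using n r by auto
            have "\<bar>\<psi> y - \<psi> x\<bar> \<le> 3*c/8" if "p < \<psi> y" "\<psi> y < q"
              using that p q by linarith
            moreover have "\<bar>\<psi> y - \<psi> x\<bar> \<le> \<bar>\<psi> y - p\<bar> + 3*c/8"
              using p q by linarith
            ultimately show ?thesis
              using True y \<open>c > 0\<close> by (auto simp: u_def ennreal_plus[symmetric] indicator_def simp del: ennreal_plus intro!: ennreal_leI)
          qed auto
        qed
        also have "\<dots> = (\<integral>\<^sup>+y. u n p q y * indicator {x - r..x + r} y \<partial>lborel) + ennreal (3*c/8) * ennreal (2 * r)"
          using r by (subst nn_integral_add) (auto simp: nn_integral_cmult_indicator)
        also have "\<dots> \<le> ennreal (c/4 * r) + ennreal (3*c/8) * ennreal (2 * r)"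
          using D[of r] r by (intro add_right_mono) auto
        also have "\<dots> = ennreal (c * r)"
          using r \<open>c > 0\<close> by (subst ennreal_mult[symmetric], simp, simp, subst ennreal_plus[symmetric]) (auto simp: field_simps)
        finally show "(\<integral>\<^sup>+y. ennreal \<bar>\<psi> y - \<psi> x\<bar> * indicator {x - r..x + r} y \<partial>lborel) \<le> ennreal (c * r)" .
      qed (use \<delta> in auto)
    qed
  qed
qed

section \<open>Integrals over short intervals, and functions recovered from the mean limit of their
  difference quotients\<close>

lemma loc_integrable_bounded_interval:
  assumes "loc_integrable \<psi>"
  shows "set_integrable lborel {a..b} \<psi>" "integrable lborel (\<lambda>x. indicator {a..b} x * \<psi> x)"
proof -
  have [measurable]: "\<psi> \<in> borel_measurable borel"
    and fin: "\<And>n. (\<integral>\<^sup>+y. ennreal \<bar>\<psi> y\<bar> * indicator {- real n..real n} y \<partial>lborel) < \<infinity>"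
    using assms by (auto simp: loc_integrable_def)
  obtain n where n: "real n > max \<bar>a\<bar> \<bar>b\<bar>" using reals_Archimedean2 by blast
  have "(\<integral>\<^sup>+x. ennreal (norm (indicator {a..b} x * \<psi> x)) \<partial>lborel) \<le> (\<integral>\<^sup>+y. ennreal \<bar>\<psi> y\<bar> * indicator {- real n..real n} y \<partial>lborel)"
    using n by (intro nn_integral_mono) (auto simp: indicator_def)
  also note fin[of n]
  finally show "integrable lborel (\<lambda>x. indicator {a..b} x * \<psi> x)"
    by (intro integrableI_bounded) auto
  then show "set_integrable lborel {a..b} \<psi>"
    by (simp add: set_integrable_def)
qed

text \<open>The integral of \<open>\<bar>\<psi> - \<psi> x\<bar>\<close> over \<open>{a..b}\<close>
  is at most that over the whole ball \<open>{x - r..x + r}\<close>, so the interval need not be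
  centred. The uses are one-sided, with \<open>x\<close> as an endpoint.\<close>

lemma lebesgue_point_integral:
  assumes li: "loc_integrable \<psi>" and lp: "lebesgue_point \<psi> x" and c: "c > 0"
  shows "\<exists>\<delta>>0. \<forall>r a b. 0 < r \<and> r \<le> \<delta> \<and> x - r \<le> a \<and> a \<le> b \<and> b \<le> x + r \<longrightarrow>
     \<bar>integral {a..b} \<psi> - (b - a) * \<psi> x\<bar> \<le> c * r"
proof -
  obtain \<delta> where \<delta>: "\<delta> > 0" "\<And>r. 0 < r \<Longrightarrow> r \<le> \<delta> \<Longrightarrow>
     (\<integral>\<^sup>+y. ennreal \<bar>\<psi> y - \<psi> x\<bar> * indicator {x - r..x + r} y \<partial>lborel) \<le> ennreal (c * r)"
    using lp[unfolded lebesgue_point_def, rule_format, OF c] by auto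
  have [measurable]: "\<psi> \<in> borel_measurable borel"
    using li by (auto simp: loc_integrable_def)
  show ?thesis
  proof (intro exI[of _ \<delta>] conjI allI impI \<open>\<delta> > 0\<close>)
    fix r a b assume A: "0 < r \<and> r \<le> \<delta> \<and> x - r \<le> a \<and> a \<le> b \<and> b \<le> x + r"
    have si: "set_integrable lborel {a..b} \<psi>" by (rule loc_integrable_bounded_interval[OF li])
    have sc: "set_integrable lborel {a..b} (\<lambda>_. \<psi> x)"
      by (rule borel_integrable_atLeastAtMost') (rule continuous_on_const)
    have sd: "set_integrable lborel {a..b} (\<lambda>y. \<psi> y - \<psi> x)"
      using si sc by (rule set_integral_diff)
    have "integral {a..b} \<psi> - (b - a) * \<psi> x = (LINT y:{a..b}|lborel. \<psi> y) - (LINT y:{a..b}|lborel. \<psi> x)"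
      using A si sc by (simp add: set_borel_integral_eq_integral)
    also have "\<dots> = (LINT y:{a..b}|lborel. \<psi> y - \<psi> x)"
      using si sc by (simp add: set_integral_diff)
    finally have eq: "integral {a..b} \<psi> - (b - a) * \<psi> x = (LINT y:{a..b}|lborel. \<psi> y - \<psi> x)" .
    have "ennreal (norm (LINT y:{a..b}|lborel. \<psi> y - \<psi> x)) \<le> (\<integral>\<^sup>+y. ennreal (norm (indicator {a..b} y *\<^sub>R (\<psi> y - \<psi> x))) \<partial>lborel)"
      using sd unfolding set_lebesgue_integral_def set_integrable_def
      by (rule integral_norm_bound_ennreal)
    also have "\<dots> \<le> (\<integral>\<^sup>+y. ennreal \<bar>\<psi> y - \<psi> x\<bar> * indicator {x - r..x + r} y \<partial>lborel)"
      using A by (intro nn_integral_mono) (auto simp: indicator_def)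
    also have "\<dots> \<le> ennreal (c * r)" using \<delta> A by blast
    finally show "\<bar>integral {a..b} \<psi> - (b - a) * \<psi> x\<bar> \<le> c * r"
      using A c unfolding eq by (subst (asm) ennreal_le_iff) auto
  qed
qed

lemma lebesgue_point_average:
  assumes li: "loc_integrable \<psi>" and lp: "lebesgue_point \<psi> x"
    and \<epsilon>: "\<epsilon> \<longlonglongrightarrow> 0" "\<And>k. \<epsilon> k > 0"
  shows "(\<lambda>k::nat. integral {x..x + \<epsilon> k} \<psi> / \<epsilon> k) \<longlonglongrightarrow> \<psi> x"
proof (rule LIMSEQ_I)
  fix c :: real assume "c > 0"
  then obtain \<delta> where \<delta>: "\<delta> > 0" "\<And>r a b. 0 < r \<and> r \<le> \<delta> \<and> x - r \<le> a \<and> a \<le> b \<and> b \<le> x + r \<Longrightarrow>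
     \<bar>integral {a..b} \<psi> - (b - a) * \<psi> x\<bar> \<le> c / 2 * r"
    using lebesgue_point_integral[OF li lp, of "c/2"] by auto
  obtain K where K: "\<And>k. k \<ge> K \<Longrightarrow> \<bar>\<epsilon> k\<bar> < \<delta>"
    using LIMSEQ_D[OF \<epsilon>(1) \<delta>(1)] by auto
  show "\<exists>no. \<forall>n\<ge>no. norm (integral {x..x + \<epsilon> n} \<psi> / \<epsilon> n - \<psi> x) < c"
  proof (intro exI[of _ K] allI impI)
    fix n assume "n \<ge> K"
    have e: "\<epsilon> n > 0" "\<epsilon> n < \<delta>" using \<epsilon>(2) K[OF \<open>n \<ge> K\<close>] by (auto simp: abs_if split: if_splits)
    have "\<bar>integral {x..x + \<epsilon> n} \<psi> - \<epsilon> n * \<psi> x\<bar> \<le> c / 2 * \<epsilon> n"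
      using \<delta>(2)[of "\<epsilon> n" x "x + \<epsilon> n"] e by simp
    moreover have "integral {x..x + \<epsilon> n} \<psi> / \<epsilon> n - \<psi> x = (integral {x..x + \<epsilon> n} \<psi> - \<epsilon> n * \<psi> x) / \<epsilon> n"
      using e by (simp add: diff_divide_distrib)
    ultimately have "norm (integral {x..x + \<epsilon> n} \<psi> / \<epsilon> n - \<psi> x) \<le> c / 2"
      using e by (simp add: abs_divide divide_simps mult.commute)
    then show "norm (integral {x..x + \<epsilon> n} \<psi> / \<epsilon> n - \<psi> x) < c" using \<open>c > 0\<close> by simp
  qed
qed

text \<open>The integral of the difference quotient over \<open>{x..y}\<close> telescopes to the
  difference of the averages of \<open>\<phi>\<close> over \<open>{y..y + \<epsilon> k}\<close> and
  \<open>{x..x + \<epsilon> k}\<close>. At Lebesgue points these averages tend to the values of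
  \<open>\<phi>\<close>, while mean convergence of the quotients yields the integral of
  \<open>\<psi>\<close>.\<close>

lemma integral_limit_quotient:
  assumes \<phi>: "loc_integrable \<phi>" and \<psi>: "loc_integrable \<psi>"
    and \<epsilon>: "\<epsilon> \<longlonglongrightarrow> 0" "\<And>k. \<epsilon> k > 0"
    and lim: "\<And>R::nat. (\<lambda>k. \<integral>\<^sup>+r. ennreal \<bar>(\<phi> (r + \<epsilon> k) - \<phi> r) / \<epsilon> k - \<psi> r\<bar> * indicator {- real R..real R} r \<partial>lborel) \<longlonglongrightarrow> 0"
    and x: "lebesgue_point \<phi> x" and y: "lebesgue_point \<phi> y" and "x \<le> y"
  shows "\<phi> y - \<phi> x = integral {x..y} \<psi>"
proof -
  have [measurable]: "\<phi> \<in> borel_measurable borel" "\<psi> \<in> borel_measurable borel"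
    using \<phi> \<psi> by (auto simp: loc_integrable_def)
  have int: "\<phi> integrable_on {a..b}" "\<psi> integrable_on {a..b}" for a b
    using loc_integrable_bounded_interval(1)[OF \<phi>] loc_integrable_bounded_interval(1)[OF \<psi>]
    by (auto intro: set_borel_integral_eq_integral)
  have shift_int: "set_integrable lborel {x..y} (\<lambda>r. \<phi> (r + e))" for e
  proof -
    have "integrable lborel (\<lambda>r. indicator {x + e..y + e} (e + 1 * r) * \<phi> (e + 1 * r))"
      by (rule lborel_integrable_real_affine) (use loc_integrable_bounded_interval(2)[OF \<phi>] in auto)
    moreover have "(\<lambda>r. indicator {x + e..y + e} (e + 1 * r) * \<phi> (e + 1 * r)) = (\<lambda>r. indicator {x..y} r *\<^sub>R \<phi> (r + e))"
      by (auto simp: indicator_def fun_eq_iff add.commute)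
    ultimately show ?thesis by (simp add: set_integrable_def)
  qed
  have shift: "integral {x..y} (\<lambda>r. \<phi> (r + e)) = integral {x + e..y + e} \<phi>" for e
  proof -
    have "integral {x + e..y + e} \<phi> = (LINT r|lborel. indicator {x + e..y + e} r * \<phi> r)"
      using loc_integrable_bounded_interval(1)[OF \<phi>] by (subst set_borel_integral_eq_integral(2)[symmetric]) (auto simp: set_lebesgue_integral_def)
    also have "\<dots> = (LINT r|lborel. indicator {x + e..y + e} (e + 1 * r) * \<phi> (e + 1 * r))"
      by (subst lborel_integral_real_affine[of 1 _ e]) auto
    also have "\<dots> = (LINT r:{x..y}|lborel. \<phi> (r + e))"
      unfolding set_lebesgue_integral_def by (intro Bochner_Integration.integral_cong) (auto simp: indicator_def add.commute)
    also have "\<dots> = integral {x..y} (\<lambda>r. \<phi> (r + e))"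
      using shift_int by (rule set_borel_integral_eq_integral(2))
    finally show ?thesis by simp
  qed
  define q where "q k r = (\<phi> (r + \<epsilon> k) - \<phi> r) / \<epsilon> k" for k r
  have qint: "set_integrable lborel {x..y} (q k)" for k
    unfolding q_def using shift_int loc_integrable_bounded_interval(1)[OF \<phi>]
    by (intro set_integrable_divide set_integral_diff) auto
  have q: "integral {x..y} (q k) = integral {y..y + \<epsilon> k} \<phi> / \<epsilon> k - integral {x..x + \<epsilon> k} \<phi> / \<epsilon> k" for k
  proof -
    have e: "\<epsilon> k > 0" by (rule \<epsilon>(2))
    have "integral {x..y} (q k) = (integral {x..y} (\<lambda>r. \<phi> (r + \<epsilon> k)) - integral {x..y} \<phi>) / \<epsilon> k"
      unfolding q_def using int shift_int
      by (subst integral_divide, subst integral_diff) (auto intro: set_borel_integral_eq_integral)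
    also have "integral {x..y} (\<lambda>r. \<phi> (r + \<epsilon> k)) = integral {x + \<epsilon> k..y + \<epsilon> k} \<phi>" by (rule shift)
    also have "\<dots> - integral {x..y} \<phi> = integral {y..y + \<epsilon> k} \<phi> - integral {x..x + \<epsilon> k} \<phi>"
    proof -
      have "integral {x..y} \<phi> + integral {y..y + \<epsilon> k} \<phi> = integral {x..y + \<epsilon> k} \<phi>"
        using e \<open>x \<le> y\<close> by (intro Henstock_Kurzweil_Integration.integral_combine int) auto
      moreover have "integral {x..x + \<epsilon> k} \<phi> + integral {x + \<epsilon> k..y + \<epsilon> k} \<phi> = integral {x..y + \<epsilon> k} \<phi>"
        using e \<open>x \<le> y\<close> by (intro Henstock_Kurzweil_Integration.integral_combine int) auto
      ultimately show ?thesis by simp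
    qed
    finally show ?thesis by (simp add: diff_divide_distrib)
  qed
  have L1: "(\<lambda>k. integral {x..y} (q k)) \<longlonglongrightarrow> \<phi> y - \<phi> x"
    unfolding q by (intro tendsto_diff lebesgue_point_average \<phi> x y \<epsilon>)
  obtain R :: nat where R: "real R > max \<bar>x\<bar> \<bar>y\<bar>" using reals_Archimedean2 by blast
  have bnd: "ennreal \<bar>integral {x..y} (q k) - integral {x..y} \<psi>\<bar> \<le> (\<integral>\<^sup>+r. ennreal \<bar>(\<phi> (r + \<epsilon> k) - \<phi> r) / \<epsilon> k - \<psi> r\<bar> * indicator {- real R..real R} r \<partial>lborel)" for k
  proof -
    have si: "set_integrable lborel {x..y} (\<lambda>r. q k r - \<psi> r)"
      using qint loc_integrable_bounded_interval(1)[OF \<psi>] by (intro set_integral_diff) auto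
    have "integral {x..y} (q k) - integral {x..y} \<psi> = (LINT r:{x..y}|lborel. q k r - \<psi> r)"
      using qint loc_integrable_bounded_interval(1)[OF \<psi>]
      by (simp add: set_integral_diff set_borel_integral_eq_integral)
    moreover have "ennreal (norm (LINT r:{x..y}|lborel. q k r - \<psi> r)) \<le> (\<integral>\<^sup>+r. ennreal (norm (indicator {x..y} r *\<^sub>R (q k r - \<psi> r))) \<partial>lborel)"
      using si unfolding set_lebesgue_integral_def set_integrable_def
      by (rule integral_norm_bound_ennreal)
    moreover have "\<dots> \<le> (\<integral>\<^sup>+r. ennreal \<bar>(\<phi> (r + \<epsilon> k) - \<phi> r) / \<epsilon> k - \<psi> r\<bar> * indicator {- real R..real R} r \<partial>lborel)"
      using R by (intro nn_integral_mono) (auto simp: indicator_def q_def)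
    ultimately show ?thesis by simp
  qed
  have "(\<lambda>k. ennreal \<bar>integral {x..y} (q k) - integral {x..y} \<psi>\<bar>) \<longlonglongrightarrow> 0"
    by (rule tendsto_sandwich[OF _ _ tendsto_const lim[of R]]) (use bnd in auto)
  then have "(\<lambda>k. \<bar>integral {x..y} (q k) - integral {x..y} \<psi>\<bar>) \<longlonglongrightarrow> 0"
    by (subst (asm) ennreal_0[symmetric], subst (asm) tendsto_ennreal_iff) auto
  then have "(\<lambda>k. integral {x..y} (q k)) \<longlonglongrightarrow> integral {x..y} \<psi>"
    by (simp add: tendsto_rabs_zero_iff LIM_zero_iff)
  then show ?thesis using L1 LIMSEQ_unique by blast
qed

text \<open>The difference quotients are only required to be close to the derivative for almost every
  increment, so that the notion does not change when the function is modified on a null set.\<close>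

definition ess_deriv :: "(real \<Rightarrow> real) \<Rightarrow> real \<Rightarrow> bool" where
  "ess_deriv \<phi> d \<longleftrightarrow> (\<forall>n. \<exists>k. AE \<epsilon> in lborel. \<bar>\<epsilon>\<bar> < 1 / Suc k \<longrightarrow>
     \<bar>\<phi> \<epsilon> - \<phi> 0 - \<epsilon> * d\<bar> \<le> \<bar>\<epsilon>\<bar> / Suc n)"

text \<open>The natural-number quantifiers in \<open>ess_deriv\<close> keep it a countable
  combination of conditions, hence measurable in parameters; this criterion returns to real
  tolerances.\<close>

lemma ess_derivI:
  assumes "\<And>c. c > 0 \<Longrightarrow> \<exists>\<delta>>0. AE \<epsilon> in lborel. \<bar>\<epsilon>\<bar> < \<delta> \<longrightarrow> \<bar>\<phi> \<epsilon> - \<phi> 0 - \<epsilon> * d\<bar> \<le> c * \<bar>\<epsilon>\<bar>"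
  shows "ess_deriv \<phi> d"
  unfolding ess_deriv_def
proof
  fix n :: nat
  obtain \<delta> where \<delta>: "\<delta> > 0" "AE \<epsilon> in lborel. \<bar>\<epsilon>\<bar> < \<delta> \<longrightarrow> \<bar>\<phi> \<epsilon> - \<phi> 0 - \<epsilon> * d\<bar> \<le> 1 / Suc n * \<bar>\<epsilon>\<bar>"
    using assms[of "1 / Suc n"] by auto
  obtain k where k: "1 / Suc k < \<delta>" using nat_approx_posE[OF \<delta>(1)] by auto
  have "AE \<epsilon> in lborel. \<bar>\<epsilon>\<bar> < 1 / Suc k \<longrightarrow> \<bar>\<phi> \<epsilon> - \<phi> 0 - \<epsilon> * d\<bar> \<le> \<bar>\<epsilon>\<bar> / Suc n"
    using \<delta>(2) by (rule AE_mp) (use k in auto)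
  then show "\<exists>k. AE \<epsilon> in lborel. \<bar>\<epsilon>\<bar> < 1 / Suc k \<longrightarrow> \<bar>\<phi> \<epsilon> - \<phi> 0 - \<epsilon> * d\<bar> \<le> \<bar>\<epsilon>\<bar> / Suc n" by blast
qed

lemma AE_lborel_shift:
  fixes x :: "'a::euclidean_space"
  assumes "AE y in lborel. Q y"
  shows "AE y in lborel. Q (x + y)"
proof -
  have "AE y in distr lborel borel ((+) x). Q y" unfolding lborel_distr_plus by (rule assms)
  then show ?thesis by (rule AE_distrD[rotated]) simp
qed

text \<open>At a common Lebesgue point \<open>x\<close> of both functions, almost every
  \<open>x + e\<close> is again a Lebesgue point of \<open>\<phi>\<close>, so the increment of
  \<open>\<phi>\<close> is an integral of \<open>\<psi>\<close> over an interval ending at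
  \<open>x\<close>. The exceptional \<open>e\<close> form a null set, which \<open>ess_deriv\<close>
  ignores.\<close>

lemma AE_ess_deriv_of_L1_limit:
  assumes \<phi>: "loc_integrable \<phi>" and \<psi>: "loc_integrable \<psi>"
    and \<epsilon>: "\<epsilon> \<longlonglongrightarrow> 0" "\<And>k. \<epsilon> k > 0"
    and lim: "\<And>R::nat. (\<lambda>k. \<integral>\<^sup>+r. ennreal \<bar>(\<phi> (r + \<epsilon> k) - \<phi> r) / \<epsilon> k - \<psi> r\<bar> * indicator {- real R..real R} r \<partial>lborel) \<longlonglongrightarrow> 0"
  shows "AE x in lborel. ess_deriv (\<lambda>e. \<phi> (x + e)) (\<psi> x)"
  using AE_lebesgue_point[OF \<phi>] AE_lebesgue_point[OF \<psi>]
proof eventually_elim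
  fix x assume x: "lebesgue_point \<phi> x" "lebesgue_point \<psi> x"
  show "ess_deriv (\<lambda>e. \<phi> (x + e)) (\<psi> x)"
  proof (rule ess_derivI)
    fix c :: real assume "c > 0"
    then obtain \<delta> where \<delta>: "\<delta> > 0" "\<And>r a b. 0 < r \<and> r \<le> \<delta> \<and> x - r \<le> a \<and> a \<le> b \<and> b \<le> x + r \<Longrightarrow>
       \<bar>integral {a..b} \<psi> - (b - a) * \<psi> x\<bar> \<le> c * r"
      using lebesgue_point_integral[OF \<psi> x(2)] by blast
    have "AE e in lborel. lebesgue_point \<phi> (x + e)"
      by (rule AE_lborel_shift) (rule AE_lebesgue_point[OF \<phi>])
    then have "AE e in lborel. \<bar>e\<bar> < \<delta> \<longrightarrow> \<bar>\<phi> (x + e) - \<phi> (x + 0) - e * \<psi> x\<bar> \<le> c * \<bar>e\<bar>"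
    proof eventually_elim
      fix e assume e: "lebesgue_point \<phi> (x + e)"
      show "\<bar>e\<bar> < \<delta> \<longrightarrow> \<bar>\<phi> (x + e) - \<phi> (x + 0) - e * \<psi> x\<bar> \<le> c * \<bar>e\<bar>"
      proof
        assume ed: "\<bar>e\<bar> < \<delta>"
        consider "e = 0" | "e > 0" | "e < 0" by linarith
        then show "\<bar>\<phi> (x + e) - \<phi> (x + 0) - e * \<psi> x\<bar> \<le> c * \<bar>e\<bar>"
        proof cases
          case 2
          then have "\<phi> (x + e) - \<phi> x = integral {x..x + e} \<psi>"
            by (intro integral_limit_quotient[OF \<phi> \<psi> \<epsilon> lim x(1) e]) auto
          then show ?thesis using \<delta>(2)[of e x "x + e"] 2 ed by simp
        next
          case 3
          then have "\<phi> x - \<phi> (x + e) = integral {x + e..x} \<psi>"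
            by (intro integral_limit_quotient[OF \<phi> \<psi> \<epsilon> lim e x(1)]) auto
          then have "\<bar>\<phi> x - \<phi> (x + e) + e * \<psi> x\<bar> \<le> c * - e" using \<delta>(2)[of "- e" "x + e" x] 3 ed by simp
          moreover have "\<bar>\<phi> (x + e) - \<phi> (x + 0) - e * \<psi> x\<bar> = \<bar>\<phi> x - \<phi> (x + e) + e * \<psi> x\<bar>" by simp
          ultimately show ?thesis using 3 by simp
        qed simp
      qed
    qed
    then show "\<exists>\<delta>>0. AE e in lborel. \<bar>e\<bar> < \<delta> \<longrightarrow> \<bar>\<phi> (x + e) - \<phi> (x + 0) - e * \<psi> x\<bar> \<le> c * \<bar>e\<bar>"
      using \<delta>(1) by blast
  qed
qed

section \<open>Approximate differentiability in several variables\<close>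

lemma measurable_emeasure_lborel_section:
  assumes "Measurable.pred (M \<Otimes>\<^sub>M lborel) (\<lambda>(x, y). P x y)"
  shows "(\<lambda>x. emeasure lborel {y::'a::euclidean_space. P x y}) \<in> borel_measurable M"
proof -
  let ?Q = "{p \<in> space (M \<Otimes>\<^sub>M lborel). case p of (x, y) \<Rightarrow> P x y}"
  have "?Q \<in> sets (M \<Otimes>\<^sub>M lborel)" using assms by measurable
  then have "(\<lambda>x. emeasure lborel (Pair x -` ?Q)) \<in> borel_measurable M"
    by (rule lborel.measurable_emeasure_Pair)
  moreover have "Pair x -` ?Q = {y. P x y}" if "x \<in> space M" for x
    using that by (auto simp: space_pair_measure)
  ultimately show ?thesis
    by (subst measurable_cong[where g = "\<lambda>x. emeasure lborel (Pair x -` ?Q)"]) auto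
qed

lemma pred_AE_lborel_section:
  assumes "Measurable.pred (M \<Otimes>\<^sub>M lborel) (\<lambda>(x, y). P x y)"
  shows "Measurable.pred M (\<lambda>x. AE y::'a::euclidean_space in lborel. P x y)"
proof -
  have "Measurable.pred (M \<Otimes>\<^sub>M lborel) (\<lambda>(x, y). \<not> P x y)"
    using assms by (simp add: case_prod_unfold)
  from measurable_emeasure_lborel_section[OF this]
  have m: "(\<lambda>x. emeasure lborel {y. \<not> P x y}) \<in> borel_measurable M" .
  have "(AE y in lborel. P x y) \<longleftrightarrow> emeasure lborel {y. \<not> P x y} = 0" if "x \<in> space M" for x
  proof -
    have "{y. \<not> P x y} \<in> sets lborel"
    proof -
      have "Measurable.pred lborel (\<lambda>y. P x y)"
        using measurable_compose[OF measurable_Pair1'[OF that] assms] by simp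
      then show ?thesis by measurable
    qed
    then show ?thesis by (subst AE_iff_measurable[OF _ refl]) (auto simp: space_lborel)
  qed
  then have "Measurable.pred M (\<lambda>x. AE y in lborel. P x y) \<longleftrightarrow> Measurable.pred M (\<lambda>x. emeasure lborel {y. \<not> P x y} = 0)"
    by (intro measurable_cong) auto
  also have "\<dots>" using m by measurable
  finally show ?thesis .
qed

lemma measurable_axis[measurable (raw)]:
  assumes [measurable]: "f \<in> borel_measurable M"
  shows "(\<lambda>x. axis i (f x) :: real ^ 'm) \<in> borel_measurable M"
proof -
  have eq: "(\<lambda>x. axis i (f x) :: real ^ 'm) = (\<lambda>x. f x *\<^sub>R axis i 1)"
    by (auto simp: axis_def vec_eq_iff fun_eq_iff)
  show ?thesis unfolding eq by measurable
qed

lemma measurable_vec_nth_raw[measurable (raw)]: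
  assumes [measurable]: "f \<in> borel_measurable M"
  shows "(\<lambda>x. (f x :: real ^ 'm) $ i) \<in> borel_measurable M"
  using measurable_compose[OF assms borel_measurable_nth] .

text \<open>Fubini is applied to translations rather than to coordinates: exchanging the quantifiers
  gives one \<open>y\<close> such that \<open>Q\<close> holds at \<open>t + axis i y\<close> for
  almost every \<open>t\<close>, and translating back removes \<open>y\<close>. Each line provides
  only the values \<open>\<bar>y\<bar> < 1\<close>, a set of positive length, which is enough for
  such a \<open>y\<close> to exist.\<close>

lemma AE_of_AE_lines:
  fixes i :: "'m::finite"
  assumes Q: "Measurable.pred borel Q"
    and lines: "\<And>t::real^'m. AE y in lborel. \<bar>y\<bar> < 1 \<longrightarrow> Q (t + axis i y)"
  shows "AE t in lborel. Q t"
proof -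
  note [measurable] = Q
  have *: "AE y in lborel. AE t in lborel. \<bar>y::real\<bar> < 1 \<longrightarrow> Q (t + axis i y)"
  proof (subst lborel_pair.AE_commute[symmetric])
    show "{p \<in> space (lborel \<Otimes>\<^sub>M lborel). \<bar>snd p::real\<bar> < 1 \<longrightarrow> Q (fst p + axis i (snd p))} \<in> sets (lborel \<Otimes>\<^sub>M lborel)"
      by measurable
  qed (use lines in auto)
  have **: "\<not> (AE y in lborel. \<not> \<bar>y::real\<bar> < 1)"
  proof
    assume "AE y in lborel. \<not> \<bar>y::real\<bar> < 1"
    then have "emeasure lborel {y::real. \<bar>y\<bar> < 1} = 0"
      by (subst (asm) AE_iff_measurable[OF _ refl]) auto
    moreover have "{y::real. \<bar>y\<bar> < 1} = {-1<..<1}" by auto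
    ultimately show False by simp
  qed
  have "\<exists>y::real. \<bar>y\<bar> < 1 \<and> (AE t in lborel. \<bar>y\<bar> < 1 \<longrightarrow> Q (t + axis i y))"
  proof (rule ccontr)
    assume no: "\<not> ?thesis"
    have "AE y in lborel. \<not> \<bar>y::real\<bar> < 1"
      using * by (rule eventually_mono) (use no in blast)
    then show False using ** by contradiction
  qed
  then obtain y :: real where "\<bar>y\<bar> < 1" "AE t in lborel. \<bar>y\<bar> < 1 \<longrightarrow> Q (t + axis i y)"
    by blast
  then have "AE t in lborel. Q (t + axis i y)" by auto
  from AE_lborel_shift[OF this, of "- axis i y"] show ?thesis by simp
qed

text \<open>On each line, \<open>average_tendsto_zero\<close> applies to the indicator of the
  complement of \<open>B\<close>. The dyadic radii make the conclusion a countable condition on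
  \<open>t\<close>, measurable as \<open>AE_of_AE_lines\<close> requires.\<close>

lemma AE_line_density:
  fixes B :: "(real^'m::finite) set"
  assumes [measurable]: "B \<in> sets borel"
  shows "AE t in lborel. t \<in> B \<longrightarrow> (\<forall>n. \<exists>K. \<forall>k\<ge>K.
    emeasure lborel {y. \<bar>y\<bar> \<le> (1/2)^k \<and> t + axis i y \<notin> B} \<le> ennreal ((1/2)^k / Suc n))"
proof (rule AE_of_AE_lines[where i=i])
  have [measurable]: "(\<lambda>t. emeasure lborel {y. \<bar>y\<bar> \<le> (1/2)^k \<and> t + axis i y \<notin> B}) \<in> borel_measurable borel" for k :: nat
    by (rule measurable_emeasure_lborel_section) measurable
  show "Measurable.pred borel (\<lambda>t. t \<in> B \<longrightarrow> (\<forall>n. \<exists>K. \<forall>k\<ge>K.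
    emeasure lborel {y. \<bar>y\<bar> \<le> (1/2)^k \<and> t + axis i y \<notin> B} \<le> ennreal ((1/2)^k / Suc n)))"
    by measurable
  fix t :: "real^'m"
  \<comment> \<open>The window \<open>{-2..2}\<close> makes \<open>u\<close> integrable and contains
    \<open>x + y\<close> whenever \<open>\<bar>x\<bar> < 1\<close> and
    \<open>\<bar>y\<bar> \<le> 1\<close>.\<close>
  define u :: "real \<Rightarrow> ennreal" where "u y = indicator {y. t + axis i y \<notin> B} y * indicator {-2..2} y" for y
  have um[measurable]: "u \<in> borel_measurable borel" unfolding u_def by measurable
  have "(\<integral>\<^sup>+y. u y \<partial>lborel) \<le> (\<integral>\<^sup>+y. indicator {-2..2::real} y \<partial>lborel)"
    by (rule nn_integral_mono) (auto simp: u_def indicator_def)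
  also have "\<dots> < \<infinity>" by simp
  finally have "AE x in lborel. u x = 0 \<longrightarrow>
    (\<forall>c>0. \<exists>\<delta>>0. \<forall>r. 0 < r \<and> r \<le> \<delta> \<longrightarrow> (\<integral>\<^sup>+y. u y * indicator {x - r..x + r} y \<partial>lborel) \<le> ennreal (c * r))"
    by (rule average_tendsto_zero[OF um])
  then show "AE x in lborel. \<bar>x\<bar> < 1 \<longrightarrow> t + axis i x \<in> B \<longrightarrow> (\<forall>n. \<exists>K. \<forall>k\<ge>K.
    emeasure lborel {y. \<bar>y\<bar> \<le> (1/2)^k \<and> t + axis i x + axis i y \<notin> B} \<le> ennreal ((1/2)^k / Suc n))"
  proof (rule AE_mp, intro AE_I2 impI allI)
    fix x :: real and n :: nat
    assume H: "u x = 0 \<longrightarrow>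
    (\<forall>c>0. \<exists>\<delta>>0. \<forall>r. 0 < r \<and> r \<le> \<delta> \<longrightarrow> (\<integral>\<^sup>+y. u y * indicator {x - r..x + r} y \<partial>lborel) \<le> ennreal (c * r))"
      and x: "\<bar>x\<bar> < 1" "t + axis i x \<in> B"
    have "u x = 0" using x by (simp add: u_def)
    then obtain \<delta> where \<delta>: "\<delta> > 0" "\<forall>r. 0 < r \<and> r \<le> \<delta> \<longrightarrow> (\<integral>\<^sup>+y. u y * indicator {x - r..x + r} y \<partial>lborel) \<le> ennreal (1 / Suc n * r)"
      using H[rule_format, of "1 / Suc n"] by auto
    obtain K where K: "(1/2)^K < \<delta>" using real_arch_pow_inv[OF \<delta>(1), of "1/2"] by auto
    show "\<exists>K. \<forall>k\<ge>K. emeasure lborel {y. \<bar>y\<bar> \<le> (1/2)^k \<and> t + axis i x + axis i y \<notin> B} \<le> ennreal ((1/2)^k / Suc n)"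
    proof (intro exI[of _ K] allI impI)
      fix k assume "k \<ge> K"
      define r :: real where "r = (1/2)^k"
      have rK: "r \<le> (1/2)^K" unfolding r_def using \<open>k \<ge> K\<close> by (intro power_decreasing) auto
      have r: "0 < r" "r \<le> 1" by (auto simp: r_def power_le_one)
      have r\<delta>: "r \<le> \<delta>" using rK K by linarith
      have ax: "t + axis i x + axis i y = t + axis i (x + y)" for y :: real
        by (auto simp: axis_def vec_eq_iff)
      have "emeasure lborel {y. \<bar>y\<bar> \<le> r \<and> t + axis i x + axis i y \<notin> B}
        = (\<integral>\<^sup>+y. indicator {y. \<bar>y\<bar> \<le> r \<and> t + axis i (x + y) \<notin> B} y \<partial>lborel)"
        unfolding ax by (rule nn_integral_indicator[symmetric]) measurable
      also have "\<dots> = (\<integral>\<^sup>+y. u (x + 1 * y) * indicator {x - r..x + r} (x + 1 * y) \<partial>lborel)"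
        using x r by (intro nn_integral_cong) (auto simp: u_def indicator_def)
      also have "\<dots> = (\<integral>\<^sup>+y. u y * indicator {x - r..x + r} y \<partial>lborel)"
        by (subst nn_integral_real_affine[of _ 1 x]) auto
      also have "\<dots> \<le> ennreal (1 / Suc n * r)" using \<delta>(2) r r\<delta> by blast
      finally show "emeasure lborel {y. \<bar>y\<bar> \<le> (1/2)^k \<and> t + axis i x + axis i y \<notin> B} \<le> ennreal ((1/2)^k / Suc n)"
        by (simp add: r_def)
    qed
  qed
qed

section \<open>Cubes and the product structure of Lebesgue measure\<close>

definition cube :: "real \<Rightarrow> (real^'m) set" where
  "cube r = {x. \<forall>i. \<bar>x $ i\<bar> \<le> r}"

lemma cube_eq_cbox: "cube r = cbox (\<chi> i. - r) (\<chi> i. r)"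
  unfolding cube_def by (intro set_eqI) (simp add: mem_box_cart abs_le_iff minus_le_iff conj_commute)

lemma emeasure_lborel_cbox_cart:
  fixes a b :: "real^'m"
  assumes "\<And>i. a $ i \<le> b $ i"
  shows "emeasure lborel (cbox a b) = ennreal (\<Prod>i\<in>UNIV. b $ i - a $ i)"
proof -
  have ne: "cbox a b \<noteq> {}" using assms by (auto simp: interval_ne_empty_cart)
  have "emeasure lborel (cbox a b) = ennreal (measure lborel (cbox a b))"
    by (rule emeasure_eq_ennreal_measure) (use emeasure_lborel_cbox_finite[of a b] in auto)
  also have "measure lborel (cbox a b) = (\<Prod>i\<in>UNIV. b $ i - a $ i)"
    using content_cbox_cart[OF ne] .
  finally show ?thesis .
qed

lemma emeasure_cube:
  assumes "r \<ge> 0"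
  shows "emeasure lborel (cube r :: (real^'m::finite) set) = ennreal ((2 * r) ^ CARD('m))"
proof -
  let ?a = "(\<chi> i. - r) :: real^'m" and ?b = "(\<chi> i. r) :: real^'m"
  have "emeasure lborel (cbox ?a ?b) = ennreal (\<Prod>i\<in>UNIV. ?b $ i - ?a $ i)"
    by (rule emeasure_lborel_cbox_cart) (use assms in simp)
  also have "(\<Prod>i\<in>UNIV. ?b $ i - ?a $ i) = (\<Prod>i\<in>(UNIV::'m set). 2 * r)"
    by (rule prod.cong) auto
  finally show ?thesis by (simp add: cube_eq_cbox)
qed

lemma measurable_vec_lambda:
  assumes "\<And>i. f i \<in> borel_measurable M"
  shows "(\<lambda>x. \<chi> i. f i x :: real^'m::finite) \<in> borel_measurable M"
proof (rule borel_measurable_euclidean_space[THEN iffD2], rule ballI)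
  fix b :: "real^'m" assume "b \<in> Basis"
  then obtain j where b: "b = axis j 1" by (auto simp: Basis_vec_def)
  show "(\<lambda>x. (\<chi> i. f i x) \<bullet> b) \<in> borel_measurable M" using assms[of j] by (simp add: b inner_axis)
qed

lemma measurable_vec_lambda_PiM:
  "(\<lambda>f. \<chi> i. f i :: real^'m::finite) \<in> Pi\<^sub>M UNIV (\<lambda>_. lborel) \<rightarrow>\<^sub>M borel"
proof (rule measurable_vec_lambda)
  fix i :: 'm
  show "(\<lambda>f. f i) \<in> borel_measurable (Pi\<^sub>M UNIV (\<lambda>_. lborel))"
    using measurable_component_singleton[of i UNIV "\<lambda>_. lborel :: real measure"] by simp
qed

text \<open>Presents Lebesgue measure as a product over the index type, so that a single coordinate
  can be split off with \<open>product_nn_integral_insert\<close>. Agreement on boxes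
  suffices.\<close>

lemma lborel_vec_eq:
  "(lborel :: (real^'m::finite) measure) = distr (Pi\<^sub>M UNIV (\<lambda>_. lborel)) borel (\<lambda>f. \<chi> i. f i)"
proof (rule lborel_eqI)
  interpret product_sigma_finite "\<lambda>_::'m. lborel :: real measure" ..
  note [measurable] = measurable_vec_lambda_PiM[where 'm = 'm]
  show "sets (distr (Pi\<^sub>M UNIV (\<lambda>_. lborel)) borel (\<lambda>f. \<chi> i. f i :: real^'m)) = sets borel" by simp
  fix l u :: "real^'m" assume lu: "\<And>b. b \<in> Basis \<Longrightarrow> l \<bullet> b \<le> u \<bullet> b"
  have le: "l $ i \<le> u $ i" for i
    using lu[of "axis i 1"] by (auto simp: Basis_vec_def inner_axis)
  have "(\<lambda>f. \<chi> i. f i) -` box l u \<inter> space (Pi\<^sub>M UNIV (\<lambda>_. lborel)) = (\<Pi>\<^sub>E i\<in>UNIV. {l $ i <..< u $ i})"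
    by (auto simp: mem_box_cart space_PiM PiE_def Pi_def)
  then have "emeasure (distr (Pi\<^sub>M UNIV (\<lambda>_. lborel)) borel (\<lambda>f. \<chi> i. f i :: real^'m)) (box l u)
     = emeasure (Pi\<^sub>M UNIV (\<lambda>_::'m. lborel)) (\<Pi>\<^sub>E i\<in>UNIV. {l $ i <..< u $ i})"
    by (subst emeasure_distr) auto
  also have "\<dots> = (\<Prod>i\<in>UNIV. emeasure lborel {l $ i <..< u $ i})"
    by (rule emeasure_PiM) auto
  also have "\<dots> = ennreal (\<Prod>i\<in>UNIV. u $ i - l $ i)"
    using le by (simp add: prod_ennreal)
  also have "(\<Prod>i\<in>UNIV. u $ i - l $ i) = (\<Prod>b\<in>Basis. (u - l) \<bullet> b)"
  proof -
    have "(\<Prod>b\<in>Basis. (u - l) \<bullet> b) = (\<Prod>b\<in>range (\<lambda>i. axis i 1). (u - l) \<bullet> b)"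
      by (rule prod.cong) (auto simp: Basis_vec_def)
    also have "\<dots> = (\<Prod>i\<in>UNIV. (u - l) \<bullet> axis i 1)"
      by (subst prod.reindex) (auto simp: inj_on_def axis_eq_axis)
    finally show ?thesis by (simp add: inner_axis)
  qed
  finally show "emeasure (distr (Pi\<^sub>M UNIV (\<lambda>_. lborel)) borel (\<lambda>f. \<chi> i. f i)) (box l u) = (\<Prod>b\<in>Basis. (u - l) \<bullet> b)" .
qed

text \<open>For \<open>x\<close> uniform in the cube, \<open>x $ i\<close> is independent of the
  other coordinates, and \<open>P y\<close> looks only at those; so \<open>x $ i\<close> may be
  replaced by a separate variable \<open>y\<close> uniform in \<open>{- r..r}\<close>. The factor
  \<open>2 * r\<close> is the length of the coordinate \<open>i\<close> that \<open>x\<close> still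
  carries on the right.\<close>

lemma cube_resample:
  fixes P :: "real \<Rightarrow> real^'m::finite \<Rightarrow> bool" and i :: 'm
  assumes P: "Measurable.pred (borel \<Otimes>\<^sub>M borel) (\<lambda>(y, x). P y x)"
    and indep: "\<And>y x x'. (\<And>j. j \<noteq> i \<Longrightarrow> x $ j = x' $ j) \<Longrightarrow> P y x = P y x'"
    and r: "r \<ge> 0"
  shows "ennreal (2 * r) * emeasure lborel {x \<in> cube r. P (x $ i) x} =
    (\<integral>\<^sup>+y. indicator {- r..r} y * emeasure lborel {x \<in> cube r. P y x} \<partial>lborel)"
proof -
  interpret product_sigma_finite "\<lambda>_::'m. lborel :: real measure" ..
  let ?J = "UNIV - {i}"
  let ?M = "Pi\<^sub>M ?J (\<lambda>_. lborel :: real measure)"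
  interpret J: sigma_finite_measure ?M by (rule sigma_finite) simp
  note [measurable] = P measurable_vec_lambda_PiM[where 'm='m]
  have [measurable]: "(cube r :: (real^'m) set) \<in> sets borel" by (simp add: cube_eq_cbox)
  have I: "insert i ?J = UNIV" by auto
  have split: "(\<integral>\<^sup>+x. F x \<partial>lborel) = (\<integral>\<^sup>+x. (\<integral>\<^sup>+y. F (\<chi> j. (x(i := y)) j) \<partial>lborel) \<partial>?M)"
    if [measurable]: "F \<in> borel_measurable borel" for F :: "real^'m \<Rightarrow> ennreal"
  proof -
    have "(\<integral>\<^sup>+x. F x \<partial>lborel) = (\<integral>\<^sup>+x. F (\<chi> j. x j) \<partial>Pi\<^sub>M UNIV (\<lambda>_. lborel))"
      unfolding lborel_vec_eq by (rule nn_integral_distr) measurable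
    also have "\<dots> = (\<integral>\<^sup>+x. F (\<chi> j. x j) \<partial>Pi\<^sub>M (insert i ?J) (\<lambda>_. lborel))"
      unfolding I ..
    also have "\<dots> = (\<integral>\<^sup>+x. (\<integral>\<^sup>+y. F (\<chi> j. (x(i := y)) j) \<partial>lborel) \<partial>?M)"
      by (rule product_nn_integral_insert) (simp_all add: I)
    finally show ?thesis .
  qed
  have I2: "(\<lambda>x. x(i := 0)) \<in> ?M \<rightarrow>\<^sub>M Pi\<^sub>M UNIV (\<lambda>_. lborel :: real measure)"
    using measurable_add_dim[of i ?J "\<lambda>_. lborel :: real measure"]
    by (intro measurable_fun_upd[where J = ?J]) auto
  have I3[measurable]: "(\<lambda>x. \<chi> j. (x(i := 0)) j) \<in> ?M \<rightarrow>\<^sub>M (borel :: (real^'m) measure)"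
    using measurable_compose[OF I2 measurable_vec_lambda_PiM] .
  \<comment> \<open>Coordinate \<open>i\<close> is reset to \<open>0\<close>, an admissible value
    since \<open>r \<ge> 0\<close>; this leaves a condition on the remaining coordinates
    alone.\<close>
  define w :: "real \<Rightarrow> ('m \<Rightarrow> real) \<Rightarrow> ennreal" where
    "w y x = (if (\<chi> j. (x(i := 0)) j) \<in> cube r \<and> P y (\<chi> j. (x(i := 0)) j) then 1 else 0)" for y x
  have [measurable]: "Measurable.pred (borel \<Otimes>\<^sub>M ?M) (\<lambda>(y, x). P y (\<chi> j. (x(i := 0)) j))"
  proof -
    have "(\<lambda>(y, x). (y, \<chi> j. (x(i := 0)) j)) \<in> borel \<Otimes>\<^sub>M ?M \<rightarrow>\<^sub>M borel \<Otimes>\<^sub>M (borel :: (real^'m) measure)"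
      by measurable
    from measurable_compose[OF this P] show ?thesis by (simp add: case_prod_unfold)
  qed
  have wm[measurable]: "case_prod w \<in> borel_measurable (borel \<Otimes>\<^sub>M ?M)"
    unfolding w_def case_prod_unfold by measurable
  have decomp: "indicator {x \<in> cube r. P z x} (\<chi> j. (x(i := y)) j) = indicator {- r..r} y * w z x" for x y z
  proof -
    have "P z (\<chi> j. (x(i := y)) j) = P z (\<chi> j. (x(i := 0)) j)" by (rule indep) simp
    moreover have "(\<chi> j. (x(i := y)) j) \<in> cube r \<longleftrightarrow> y \<in> {- r..r} \<and> (\<chi> j. (x(i := 0)) j) \<in> cube r"
      using r by (auto simp: cube_def abs_le_iff minus_le_iff split: if_splits)
    ultimately show ?thesis by (auto simp: w_def indicator_def)
  qed
  have "emeasure lborel {x \<in> cube r. P (x $ i) x} = (\<integral>\<^sup>+x. indicator {x \<in> cube r. P (x $ i) x} x \<partial>lborel)"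
    by (rule nn_integral_indicator[symmetric]) measurable
  also have "\<dots> = (\<integral>\<^sup>+x. (\<integral>\<^sup>+y. indicator {x \<in> cube r. P (x $ i) x} (\<chi> j. (x(i := y)) j) \<partial>lborel) \<partial>?M)"
    by (rule split) measurable
  also have "\<dots> = (\<integral>\<^sup>+x. (\<integral>\<^sup>+y. indicator {- r..r} y * w y x \<partial>lborel) \<partial>?M)"
  proof (intro nn_integral_cong)
    fix x y
    have "indicator {x \<in> cube r. P (x $ i) x} (\<chi> j. (x(i := y)) j) = (indicator {x \<in> cube r. P y x} (\<chi> j. (x(i := y)) j) :: ennreal)"
      by (simp add: indicator_def)
    then show "indicator {x \<in> cube r. P (x $ i) x} (\<chi> j. (x(i := y)) j) = indicator {- r..r} y * w y x"
      unfolding decomp .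
  qed
  also have "\<dots> = (\<integral>\<^sup>+y. (\<integral>\<^sup>+x. indicator {- r..r} y * w y x \<partial>?M) \<partial>lborel)"
  proof -
    interpret pair_sigma_finite "lborel :: real measure" ?M ..
    show ?thesis by (rule Fubini') measurable
  qed
  also have "\<dots> = (\<integral>\<^sup>+y. indicator {- r..r} y * (\<integral>\<^sup>+x. w y x \<partial>?M) \<partial>lborel)"
    by (intro nn_integral_cong nn_integral_cmult) measurable
  finally have 1: "emeasure lborel {x \<in> cube r. P (x $ i) x} = (\<integral>\<^sup>+y. indicator {- r..r} y * (\<integral>\<^sup>+x. w y x \<partial>?M) \<partial>lborel)" .
  have 2: "emeasure lborel {x \<in> cube r. P z x} = ennreal (2 * r) * (\<integral>\<^sup>+x. w z x \<partial>?M)" for z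
  proof -
    have "emeasure lborel {x \<in> cube r. P z x} = (\<integral>\<^sup>+x. indicator {x \<in> cube r. P z x} x \<partial>lborel)"
      by (rule nn_integral_indicator[symmetric]) measurable
    also have "\<dots> = (\<integral>\<^sup>+x. (\<integral>\<^sup>+y. indicator {x \<in> cube r. P z x} (\<chi> j. (x(i := y)) j) \<partial>lborel) \<partial>?M)"
      by (rule split) measurable
    also have "\<dots> = (\<integral>\<^sup>+x. ennreal (2 * r) * w z x \<partial>?M)"
      unfolding decomp using r by (intro nn_integral_cong) (simp add: nn_integral_multc)
    also have "\<dots> = ennreal (2 * r) * (\<integral>\<^sup>+x. w z x \<partial>?M)"
      by (rule nn_integral_cmult) measurable
    finally show ?thesis .
  qed
  show ?thesis
    unfolding 1 2 by (subst nn_integral_cmult[symmetric]) (auto simp: mult_ac)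
qed

section \<open>Linear approximation outside sets of small relative measure\<close>

definition proj :: "'m set \<Rightarrow> real^'m \<Rightarrow> real^'m" where
  "proj I x = (\<Sum>j\<in>I. axis j (x $ j))"

text \<open>The increment is restricted to the coordinates in \<open>I\<close> so that the
  approximation can be proved by adding one coordinate at a time.\<close>

definition lin_error :: "(real^'m \<Rightarrow> real) \<Rightarrow> ('m \<Rightarrow> real^'m \<Rightarrow> real) \<Rightarrow> 'm set \<Rightarrow> real^'m \<Rightarrow> real^'m \<Rightarrow> real" where
  "lin_error g G I t x = \<bar>g (t + proj I x) - g t - (\<Sum>j\<in>I. x $ j * G j t)\<bar>"

text \<open>Only dyadic radii occur below, so that these sets are Borel.\<close>

definition approx_set :: "(real^'m \<Rightarrow> real) \<Rightarrow> ('m \<Rightarrow> real^'m \<Rightarrow> real) \<Rightarrow> 'm set \<Rightarrow> nat \<Rightarrow> nat \<Rightarrow> (real^'m) set" where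
  "approx_set g G I n K = {t. \<forall>k\<ge>K. emeasure lborel {x \<in> cube ((1/2)^k). lin_error g G I t x > (1/2)^k / Suc n}
      \<le> ennreal (((1/2)^k)^CARD('m) / Suc n)}"

text \<open>Rounds the gradient to multiples of \<open>1 / Suc n\<close>. The cells are countable in
  number and cover the space, and on each of them every partial derivative oscillates by at most
  \<open>1 / Suc n\<close>; this replaces the missing continuity of \<open>G\<close>.\<close>

definition grad_cell :: "('m \<Rightarrow> real^'m \<Rightarrow> real) \<Rightarrow> nat \<Rightarrow> ('m \<Rightarrow> int) \<Rightarrow> (real^'m) set" where
  "grad_cell G n z = {t. \<forall>j. \<lfloor>real (Suc n) * G j t\<rfloor> = z j}"

lemma proj_UNIV: "proj UNIV x = x"
proof (rule vec_eq_iff[THEN iffD2], rule allI)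
  fix i
  have "proj UNIV x $ i = (\<Sum>j\<in>UNIV. if i = j then x $ j else 0)"
    unfolding proj_def sum_component by (rule sum.cong) (auto simp: axis_def)
  also have "\<dots> = x $ i" by (subst sum.delta') auto
  finally show "proj UNIV x $ i = x $ i" .
qed

lemma grad_cell_diff:
  assumes "t \<in> grad_cell G n z" "s \<in> grad_cell G n z"
  shows "\<bar>G j t - G j s\<bar> \<le> 1 / Suc n"
proof -
  have "\<lfloor>real (Suc n) * G j t\<rfloor> = \<lfloor>real (Suc n) * G j s\<rfloor>" using assms by (simp add: grad_cell_def)
  then have "\<bar>real (Suc n) * G j t - real (Suc n) * G j s\<bar> \<le> 1" by linarith
  also have "real (Suc n) * G j t - real (Suc n) * G j s = real (Suc n) * (G j t - G j s)" by (simp add: right_diff_distrib)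
  finally show ?thesis by (simp add: abs_mult pos_le_divide_eq mult.commute del: of_nat_Suc)
qed

lemma grad_cell_value:
  assumes "t \<in> grad_cell G n z"
  shows "\<bar>G j t - real_of_int (z j) / Suc n\<bar> \<le> 1 / Suc n"
proof -
  have "\<lfloor>real (Suc n) * G j t\<rfloor> = z j" using assms by (simp add: grad_cell_def)
  then have "\<bar>real (Suc n) * G j t - z j\<bar> \<le> 1" by linarith
  moreover have "G j t - real_of_int (z j) / Suc n = (real (Suc n) * G j t - z j) / Suc n" by (simp add: field_simps)
  ultimately show ?thesis by (simp add: abs_divide divide_right_mono del: of_nat_Suc)
qed

context
  fixes g :: "real^'m::finite \<Rightarrow> real" and G :: "'m \<Rightarrow> real^'m \<Rightarrow> real"
  assumes g[measurable]: "g \<in> borel_measurable borel"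
    and G[measurable]: "\<And>j. G j \<in> borel_measurable borel"
begin

lemma measurable_proj[measurable]: "proj I \<in> borel_measurable (borel :: (real^'m) measure)"
  unfolding proj_def by measurable

lemma measurable_lin_error[measurable]:
  "(\<lambda>(t, x). lin_error g G I t x) \<in> borel_measurable (borel \<Otimes>\<^sub>M borel)"
  unfolding lin_error_def case_prod_unfold by measurable

lemma measurable_lin_error'[measurable (raw)]:
  assumes "u \<in> borel_measurable M" "v \<in> borel_measurable M"
  shows "(\<lambda>w. lin_error g G I (u w) (v w)) \<in> borel_measurable M"
  using measurable_compose[OF measurable_Pair[OF assms] measurable_lin_error] by simp

lemma sets_cube[measurable]: "(cube r :: (real^'m) set) \<in> sets borel"
  by (simp add: cube_eq_cbox)

lemma sets_approx_set[measurable]: "approx_set g G I n K \<in> sets borel"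
proof -
  have [measurable]: "(\<lambda>t. emeasure lborel {x \<in> cube ((1/2)^k). lin_error g G I t x > (1/2)^k / Suc n}) \<in> borel_measurable borel" for k :: nat
    by (rule measurable_emeasure_lborel_section) measurable
  have "Measurable.pred borel (\<lambda>t. t \<in> approx_set g G I n K)"
    unfolding approx_set_def mem_Collect_eq by measurable
  then show ?thesis by (simp add: pred_def)
qed

lemma sets_grad_cell[measurable]: "grad_cell G n z \<in> sets borel"
proof -
  have "Measurable.pred borel (\<lambda>t. t \<in> grad_cell G n z)"
    unfolding grad_cell_def mem_Collect_eq by measurable
  then show ?thesis by (simp add: pred_def)
qed

text \<open>The increment passes through the intermediate point \<open>t + axis i (x $ i)\<close>.
  The step to it and the step from it each contribute at most \<open>r / Suc N\<close>; exchanging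
  the gradient there for the one at \<open>t\<close> contributes at most \<open>CARD('m)\<close>
  times as much, because both points lie in one cell.\<close>

lemma lin_error_insert:
  fixes r :: real
  assumes i: "i \<notin> I" and x: "x \<in> cube r" and r: "r \<ge> 0"
    and cells: "t \<in> grad_cell G N z" "t + axis i (x $ i) \<in> grad_cell G N z"
    and e1: "\<bar>g (t + axis i (x $ i)) - g t - x $ i * G i t\<bar> \<le> \<bar>x $ i\<bar> / Suc N"
    and e2: "lin_error g G I (t + axis i (x $ i)) x \<le> r / Suc N"
  shows "lin_error g G (insert i I) t x \<le> (2 + real CARD('m)) * r / Suc N"
proof -
  let ?t = "t + axis i (x $ i)"
  have [simp]: "finite I" by simp
  have xr: "\<bar>x $ j\<bar> \<le> r" for j using x by (simp add: cube_def)
  have "\<bar>(\<Sum>j\<in>I. x $ j * G j ?t) - (\<Sum>j\<in>I. x $ j * G j t)\<bar> = \<bar>\<Sum>j\<in>I. x $ j * (G j ?t - G j t)\<bar>"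
    by (simp add: sum_subtractf right_diff_distrib)
  also have "\<dots> \<le> (\<Sum>j\<in>I. \<bar>x $ j * (G j ?t - G j t)\<bar>)" by (rule sum_abs)
  also have "\<dots> \<le> (\<Sum>j\<in>I. r * (1 / Suc N))"
    unfolding abs_mult using xr r grad_cell_diff[OF cells(2) cells(1)]
    by (intro sum_mono mult_mono) auto
  also have "\<dots> \<le> CARD('m) * (r * (1 / Suc N))"
    using r card_mono[of UNIV I] by (simp del: of_nat_Suc) (intro divide_right_mono mult_right_mono, auto)
  finally have e3: "\<bar>(\<Sum>j\<in>I. x $ j * G j ?t) - (\<Sum>j\<in>I. x $ j * G j t)\<bar> \<le> CARD('m) * (r * (1 / Suc N))" .
  have e1': "\<bar>g ?t - g t - x $ i * G i t\<bar> \<le> r * (1 / Suc N)"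
    using e1 xr[of i] by (rule_tac order_trans) (auto simp del: of_nat_Suc intro: divide_right_mono)
  have p: "t + proj (insert i I) x = ?t + proj I x"
    using i by (simp add: proj_def)
  have "lin_error g G (insert i I) t x = \<bar>(g (?t + proj I x) - g ?t - (\<Sum>j\<in>I. x $ j * G j ?t)) + (g ?t - g t - x $ i * G i t)
     + ((\<Sum>j\<in>I. x $ j * G j ?t) - (\<Sum>j\<in>I. x $ j * G j t))\<bar>"
    unfolding lin_error_def p using i by simp
  also have "\<dots> \<le> r * (1 / Suc N) + r * (1 / Suc N) + CARD('m) * (r * (1 / Suc N))"
    using e3 e1' e2[unfolded lin_error_def] by (simp del: of_nat_Suc)
  also have "\<dots> = (2 + real CARD('m)) * r / Suc N" by (simp add: add_divide_distrib distrib_right del: of_nat_Suc)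
  finally show ?thesis .
qed

text \<open>The new coordinate is changed first: for most increments \<open>y\<close> the point \<open>t + axis i y\<close> stays in
  the set \<open>B\<close>, where the error in the other coordinates is controlled at the same scale.\<close>

lemma approx_insert:
  fixes t :: "real^'m"
  assumes i: "i \<notin> I"
    and IH: "\<And>n. \<exists>K. t \<in> approx_set g G I n K"
    and es: "ess_deriv (\<lambda>e. g (t + axis i e)) (G i t)"
    and dn: "\<And>N K z. t \<in> approx_set g G I N K \<inter> grad_cell G N z \<Longrightarrow> \<exists>K'. \<forall>k\<ge>K'.
      emeasure lborel {y. \<bar>y\<bar> \<le> (1/2)^k \<and> t + axis i y \<notin> approx_set g G I N K \<inter> grad_cell G N z} \<le> ennreal ((1/2)^k / Suc N)"
  shows "\<exists>K. t \<in> approx_set g G (insert i I) n K"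
proof -
  define m where "m = CARD('m)"
  \<comment> \<open>The error will carry the factor \<open>2 + m\<close> and the measure of the bad
    set the factor \<open>2^m / 2 + 1\<close>. The number \<open>2^m + m + 3\<close> exceeds both,
    so \<open>c\<close> times either stays below \<open>1 / Suc n\<close>.\<close>
  define N where "N = Suc n * (2^m + m + 3)"
  define c :: real where "c = 1 / Suc N"
  have c0: "c > 0" by (simp add: c_def)
  have cc: "c * (2^m + m + 3) \<le> 1 / Suc n"
  proof -
    have "real (Suc n) * (2^m + m + 3) \<le> real (Suc N)" by (simp add: N_def algebra_simps)
    then have "(2^m + m + 3) / real (Suc N) \<le> 1 / Suc n" by (simp add: field_simps del: of_nat_Suc)
    then show ?thesis by (simp add: c_def)
  qed
  obtain K0 where K0: "t \<in> approx_set g G I N K0" using IH by blast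
  define z where "z j = \<lfloor>real (Suc N) * G j t\<rfloor>" for j
  have tz: "t \<in> grad_cell G N z" by (simp add: grad_cell_def z_def)
  define B where "B = approx_set g G I N K0 \<inter> grad_cell G N z"
  have [measurable]: "B \<in> sets borel" unfolding B_def by measurable
  obtain K2 where K2: "\<And>k. k \<ge> K2 \<Longrightarrow> emeasure lborel {y. \<bar>y\<bar> \<le> (1/2)^k \<and> t + axis i y \<notin> B} \<le> ennreal ((1/2)^k / Suc N)"
    using dn[of N K0 z] K0 tz unfolding B_def by auto
  have a0: "t + axis i 0 = t" by (simp add: axis_def vec_eq_iff)
  obtain k1 where k1: "AE y in lborel. \<bar>y\<bar> < 1 / Suc k1 \<longrightarrow> \<bar>g (t + axis i y) - g t - y * G i t\<bar> \<le> \<bar>y\<bar> / Suc N"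
    using es unfolding ess_deriv_def a0 by blast
  obtain K3 where K3: "(1/2)^K3 < 1 / real (Suc k1)" using real_arch_pow_inv[of "1 / real (Suc k1)" "1/2"] by auto
  define K where "K = max K0 (max K2 K3)"
  have "t \<in> approx_set g G (insert i I) n K"
    unfolding approx_set_def
  proof (intro CollectI allI impI)
    fix k assume k: "k \<ge> K"
    define r :: real where "r = (1/2)^k"
    have r0: "r > 0" by (simp add: r_def)
    have "r \<le> (1/2)^K3" unfolding r_def using k by (intro power_decreasing) (auto simp: K_def)
    then have rk1: "r < 1 / Suc k1" using K3 by simp
    \<comment> \<open>\<open>Y\<close> collects the bad values of the new coordinate,
      \<open>Q\<close> the bad increments in the old coordinates once the new one has led to a point
      of \<open>B\<close>. Since \<open>i\<close> is not in \<open>I\<close>, \<open>Q y x\<close>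
      does not depend on \<open>x $ i\<close>, as \<open>cube_resample\<close> demands.\<close>
    define Y where "Y y \<longleftrightarrow> t + axis i y \<notin> B \<or> \<not> \<bar>g (t + axis i y) - g t - y * G i t\<bar> \<le> \<bar>y\<bar> / Suc N" for y
    have [measurable]: "Measurable.pred borel Y" unfolding Y_def by measurable
    define Q where "Q y x \<longleftrightarrow> t + axis i y \<in> B \<and> lin_error g G I (t + axis i y) x > r / Suc N" for y x
    have Qm: "Measurable.pred (borel \<Otimes>\<^sub>M borel) (\<lambda>(y, x). Q y x)" unfolding Q_def case_prod_unfold by measurable
    have [measurable]: "Measurable.pred borel (\<lambda>x. Q (x $ i) x)" unfolding Q_def by measurable
    let ?A1 = "{x \<in> cube r. Y (x $ i)}" and ?A2 = "{x \<in> cube r. Q (x $ i) x}"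
    have sub: "{x \<in> cube r. lin_error g G (insert i I) t x > r / Suc n} \<subseteq> ?A1 \<union> ?A2"
    proof (rule subsetI, rule ccontr)
      fix x assume x: "x \<in> {x \<in> cube r. lin_error g G (insert i I) t x > r / Suc n}" and "x \<notin> ?A1 \<union> ?A2"
      then have nY: "\<not> Y (x $ i)" and nQ: "\<not> Q (x $ i) x" and xc: "x \<in> cube r" by auto
      have tB: "t + axis i (x $ i) \<in> B" using nY by (simp add: Y_def)
      have "lin_error g G (insert i I) t x \<le> (2 + real CARD('m)) * r / Suc N"
        using i xc _ tz
      proof (rule lin_error_insert)
        show "0 \<le> r" using r0 by simp
        show "t + axis i (x $ i) \<in> grad_cell G N z" using tB by (simp add: B_def)
        show "\<bar>g (t + axis i (x $ i)) - g t - x $ i * G i t\<bar> \<le> \<bar>x $ i\<bar> / Suc N" using nY by (simp add: Y_def)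
        show "lin_error g G I (t + axis i (x $ i)) x \<le> r / Suc N" using nQ tB by (simp add: Q_def not_less)
      qed
      also have "\<dots> = (c * (2 + m)) * r" by (simp add: c_def m_def)
      also have "\<dots> \<le> (1 / Suc n) * r"
      proof (rule mult_right_mono)
        have "c * (2 + m) \<le> c * (2^m + m + 3)" using c0 by (intro mult_left_mono) auto
        then show "c * (2 + m) \<le> 1 / Suc n" using cc by linarith
      qed (use r0 in simp)
      finally show False using x by simp
    qed
    have canc: "X \<le> ennreal v" if "ennreal (2 * r) * X \<le> ennreal (2 * r) * ennreal v" for X v
      using that r0 by (subst (asm) ennreal_mult_le_mult_iff) auto
    \<comment> \<open>Resampling turns the volume into \<open>(2 * r)^m\<close> times the proportion
      of bad \<open>y\<close> in \<open>{- r..r}\<close>. The failures of the essential derivative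
      are a null set, and leaving \<open>B\<close> has proportion at most
      \<open>c / 2\<close>.\<close>
    have A1: "emeasure lborel ?A1 \<le> ennreal (c * (2 * r)^m / 2)"
    proof (rule canc)
      have "ennreal (2 * r) * emeasure lborel ?A1 = (\<integral>\<^sup>+y. indicator {- r..r} y * emeasure lborel {x::real^'m. x \<in> cube r \<and> Y y} \<partial>lborel)"
        using r0 by (subst cube_resample) auto
      also have "\<dots> \<le> (\<integral>\<^sup>+y. ennreal ((2 * r)^m) * indicator {y. \<bar>y\<bar> \<le> r \<and> t + axis i y \<notin> B} y \<partial>lborel)"
      proof (rule nn_integral_mono_AE, use k1 in eventually_elim)
        fix y assume y: "\<bar>y\<bar> < 1 / Suc k1 \<longrightarrow> \<bar>g (t + axis i y) - g t - y * G i t\<bar> \<le> \<bar>y\<bar> / Suc N"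
        show "indicator {- r..r} y * emeasure lborel {x::real^'m. x \<in> cube r \<and> Y y} \<le> ennreal ((2 * r)^m) * indicator {y. \<bar>y\<bar> \<le> r \<and> t + axis i y \<notin> B} y"
        proof (cases "\<bar>y\<bar> \<le> r \<and> Y y")
          case True
          then have "t + axis i y \<notin> B" using y rk1 by (auto simp: Y_def)
          then show ?thesis using True r0 by (simp add: emeasure_cube m_def abs_le_iff)
        next
          case False
          then have "y \<notin> {- r..r} \<or> {x::real^'m. x \<in> cube r \<and> Y y} = {}" by auto
          then show ?thesis by auto
        qed
      qed
      also have "\<dots> = ennreal ((2 * r)^m) * emeasure lborel {y. \<bar>y\<bar> \<le> r \<and> t + axis i y \<notin> B}"
        by (rule nn_integral_cmult_indicator) measurable
      also have "\<dots> \<le> ennreal ((2 * r)^m) * ennreal (r / Suc N)"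
        using K2[of k] k by (intro mult_left_mono) (auto simp: K_def r_def)
      also have "\<dots> = ennreal (2 * r) * ennreal (c * (2 * r)^m / 2)"
        using r0 c0 by (simp add: ennreal_mult[symmetric] c_def del: of_nat_Suc)
      finally show "ennreal (2 * r) * emeasure lborel ?A1 \<le> ennreal (2 * r) * ennreal (c * (2 * r)^m / 2)" .
    qed
    \<comment> \<open>For each \<open>y\<close> leading to a point of \<open>B\<close>, membership
      in \<open>approx_set\<close> bounds the bad volume by \<open>r^m * c\<close>; averaging over
      \<open>y\<close> preserves the bound.\<close>
    have A2: "emeasure lborel ?A2 \<le> ennreal (r^m * c)"
    proof (rule canc)
      have "ennreal (2 * r) * emeasure lborel ?A2 = (\<integral>\<^sup>+y. indicator {- r..r} y * emeasure lborel {x::real^'m. x \<in> cube r \<and> Q y x} \<partial>lborel)"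
      proof (rule cube_resample[OF Qm])
        fix y and x x' :: "real^'m" assume e: "\<And>j. j \<noteq> i \<Longrightarrow> x $ j = x' $ j"
        have "x $ j = x' $ j" if "j \<in> I" for j using that i e[of j] by auto
        then have "proj I x = proj I x'" "(\<Sum>j\<in>I. x $ j * G j s) = (\<Sum>j\<in>I. x' $ j * G j s)" for s
          by (auto simp: proj_def)
        then show "Q y x = Q y x'" by (simp add: Q_def lin_error_def)
      qed (use r0 in auto)
      also have "\<dots> \<le> (\<integral>\<^sup>+y. ennreal (r^m * c) * indicator {- r..r} y \<partial>lborel)"
      proof (rule nn_integral_mono)
        fix y
        have "emeasure lborel {x::real^'m. x \<in> cube r \<and> Q y x} \<le> ennreal (r^m * c)"
        proof (cases "t + axis i y \<in> B")
          case True
          then have "t + axis i y \<in> approx_set g G I N K0" by (simp add: B_def)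
          then have "emeasure lborel {x \<in> cube r. lin_error g G I (t + axis i y) x > r / Suc N} \<le> ennreal (r^m / Suc N)"
            using k unfolding approx_set_def r_def m_def K_def by auto
          then show ?thesis using True by (simp add: Q_def c_def)
        qed (simp add: Q_def)
        then show "indicator {- r..r} y * emeasure lborel {x::real^'m. x \<in> cube r \<and> Q y x} \<le> ennreal (r^m * c) * indicator {- r..r} y"
          by (auto simp: indicator_def)
      qed
      also have "\<dots> = ennreal (2 * r) * ennreal (r^m * c)"
        using r0 by (simp add: nn_integral_cmult_indicator mult.commute)
      finally show "ennreal (2 * r) * emeasure lborel ?A2 \<le> ennreal (2 * r) * ennreal (r^m * c)" .
    qed
    have "emeasure lborel {x \<in> cube r. lin_error g G (insert i I) t x > r / Suc n} \<le> emeasure lborel (?A1 \<union> ?A2)"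
      by (rule emeasure_mono[OF sub]) measurable
    also have "\<dots> \<le> emeasure lborel ?A1 + emeasure lborel ?A2"
      by (rule emeasure_subadditive) measurable
    also have "\<dots> \<le> ennreal (c * (2 * r)^m / 2) + ennreal (r^m * c)"
      using A1 A2 by (rule add_mono)
    also have "\<dots> = ennreal (c * (2 * r)^m / 2 + r^m * c)"
      using r0 c0 by (intro ennreal_plus[symmetric]) auto
    also have "\<dots> \<le> ennreal (r^m / Suc n)"
    proof (rule ennreal_leI)
      have "c * (2 * r)^m / 2 + r^m * c = (c * (2^m / 2 + 1)) * r^m"
        by (simp add: power_mult_distrib field_simps)
      also have "\<dots> \<le> (1 / Suc n) * r^m"
      proof (rule mult_right_mono)
        have "c * (2^m / 2 + 1) \<le> c * (2^m + m + 3)" using c0 by (intro mult_left_mono) auto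
        then show "c * (2^m / 2 + 1) \<le> 1 / Suc n" using cc by linarith
      qed (use r0 in simp)
      finally show "c * (2 * r)^m / 2 + r^m * c \<le> r^m / Suc n" by simp
    qed
    finally show "emeasure lborel {x \<in> cube ((1/2)^k). lin_error g G (insert i I) t x > (1/2)^k / Suc n} \<le> ennreal (((1/2)^k)^CARD('m) / Suc n)"
      by (simp add: r_def m_def)
  qed
  then show ?thesis by blast
qed

text \<open>Induction on the coordinates moved; with none moved the error is \<open>0\<close>. The
  density statement is taken simultaneously for all of the countably many sets
  \<open>approx_set g G I N K \<inter> grad_cell G N z\<close>, since the one needed depends on
  \<open>t\<close>.\<close>

lemma AE_approx_set:
  assumes ess: "\<And>i. AE t in lborel. ess_deriv (\<lambda>e. g (t + axis i e)) (G i t)"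
  shows "AE t in lborel. \<forall>n. \<exists>K. t \<in> approx_set g G I n K"
proof -
  have "finite I" by simp
  then show ?thesis
  proof (induction I)
    case empty
    have pos: "\<not> (1/2::real)^k / (1 + real n) < 0" for k n by (simp add: not_less)
    have "t \<in> approx_set g G {} n 0" for t n
      by (simp add: approx_set_def lin_error_def proj_def pos)
    then show ?case by blast
  next
    case (insert i I)
    have "AE t in lborel. \<forall>N K z. t \<in> approx_set g G I N K \<inter> grad_cell G N z \<longrightarrow> (\<forall>n. \<exists>K'. \<forall>k\<ge>K'.
      emeasure lborel {y. \<bar>y\<bar> \<le> (1/2)^k \<and> t + axis i y \<notin> approx_set g G I N K \<inter> grad_cell G N z} \<le> ennreal ((1/2)^k / Suc n))"
      unfolding AE_all_countable by (intro allI AE_line_density) measurable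
    with insert.IH ess[of i] show ?case
    proof eventually_elim
      case (elim t)
      show ?case
        by (intro allI approx_insert insert.hyps(2) elim(1)[rule_format] elim(2)) (use elim(3) in blast)
    qed
  qed
qed

text \<open>The cubes around \<open>t\<close> and \<open>s\<close> overlap so much that some point \<open>q\<close> is good for both.\<close>

lemma approx_pair_cube:
  assumes t: "t \<in> approx_set g G UNIV n K" "t \<in> grad_cell G n z"
    and s: "s \<in> approx_set g G UNIV n K" "s \<in> grad_cell G n z"
    and k: "k \<ge> K" and n: "n \<ge> 2"
    and ts: "\<And>j. \<bar>t $ j - s $ j\<bar> \<le> (1/2)^k"
  shows "\<bar>g s - g t - (\<Sum>j\<in>UNIV. (s - t) $ j * (real_of_int (z j) / Suc n))\<bar> \<le> (2 + 2 * CARD('m)) * (1/2)^k / Suc n"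
proof -
  define m where "m = CARD('m)"
  define r :: real where "r = (1/2)^k"
  have r0: "r > 0" by (simp add: r_def)
  define bad where "bad u x \<longleftrightarrow> lin_error g G UNIV u x > r / Suc n" for u x
  have [measurable]: "Measurable.pred borel (\<lambda>q. bad u (q - u))" for u unfolding bad_def by measurable
  have shift: "emeasure lborel {q. q - u \<in> cube r \<and> bad u (q - u)} \<le> ennreal (r^m / Suc n)" if u: "u \<in> approx_set g G UNIV n K" for u
  proof -
    have "emeasure lborel {q. q - u \<in> cube r \<and> bad u (q - u)} = emeasure (distr lborel borel ((+) u)) {q. q - u \<in> cube r \<and> bad u (q - u)}"
      by (simp add: lborel_distr_plus)
    also have "\<dots> = emeasure lborel {x \<in> cube r. bad u x}"
      by (subst emeasure_distr) (auto intro!: arg_cong2[where f=emeasure])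
    also have "\<dots> \<le> ennreal (r^m / Suc n)"
      using u k unfolding approx_set_def bad_def r_def m_def by auto
    finally show ?thesis .
  qed
  \<comment> \<open>The intersection of the cubes of radius \<open>r\<close> about \<open>t\<close>
    and \<open>s\<close>. Its sides have length at least \<open>r\<close> because the centres differ
    by at most \<open>r\<close> in each coordinate.\<close>
  let ?l = "(\<chi> j. max (t $ j) (s $ j) - r) :: real^'m" and ?u = "(\<chi> j. min (t $ j) (s $ j) + r) :: real^'m"
  have rlen: "r \<le> ?u $ j - ?l $ j" for j using ts[of j] by (auto simp: r_def max_def min_def)
  \<comment> \<open>The two bad sets have total measure at most \<open>2 * r^m / Suc n\<close>,
    which is below \<open>r^m\<close> because \<open>n \<ge> 2\<close>; they cannot fill the
    intersection.\<close>
  have "\<exists>q \<in> cbox ?l ?u. \<not> (q - t \<in> cube r \<and> bad t (q - t)) \<and> \<not> (q - s \<in> cube r \<and> bad s (q - s))"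
  proof (rule ccontr)
    assume "\<not> ?thesis"
    then have "cbox ?l ?u \<subseteq> {q. q - t \<in> cube r \<and> bad t (q - t)} \<union> {q. q - s \<in> cube r \<and> bad s (q - s)}" by blast
    then have "emeasure lborel (cbox ?l ?u) \<le> emeasure lborel ({q. q - t \<in> cube r \<and> bad t (q - t)} \<union> {q. q - s \<in> cube r \<and> bad s (q - s)})"
      by (rule emeasure_mono) measurable
    also have "\<dots> \<le> emeasure lborel {q. q - t \<in> cube r \<and> bad t (q - t)} + emeasure lborel {q. q - s \<in> cube r \<and> bad s (q - s)}"
      by (rule emeasure_subadditive) measurable
    also have "\<dots> \<le> ennreal (r^m / Suc n) + ennreal (r^m / Suc n)"
      using shift[OF t(1)] shift[OF s(1)] by (rule add_mono)
    also have "\<dots> = ennreal (2 * (r^m / Suc n))"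
      using r0 by (simp add: ennreal_plus[symmetric] del: ennreal_plus)
    also have "emeasure lborel (cbox ?l ?u) = ennreal (\<Prod>j\<in>UNIV. ?u $ j - ?l $ j)"
      by (rule emeasure_lborel_cbox_cart) (use rlen r0 in \<open>smt (verit)\<close>)
    finally have le: "(\<Prod>j\<in>UNIV. ?u $ j - ?l $ j) \<le> 2 * (r^m / Suc n)"
      using r0 by (subst (asm) ennreal_le_iff) auto
    have "(\<Prod>j\<in>(UNIV::'m set). r) \<le> (\<Prod>j\<in>UNIV. ?u $ j - ?l $ j)"
      using rlen r0 by (intro prod_mono) auto
    then have "r^m \<le> 2 * (r^m / Suc n)" using le by (simp add: m_def)
    then have "real (Suc n) \<le> 2" using r0 by (simp add: field_simps del: of_nat_Suc)
    then show False using n by simp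
  qed
  then obtain q where q: "q \<in> cbox ?l ?u" "\<not> (q - t \<in> cube r \<and> bad t (q - t))" "\<not> (q - s \<in> cube r \<and> bad s (q - s))" by blast
  have qj: "max (t $ j) (s $ j) - r \<le> q $ j \<and> q $ j \<le> min (t $ j) (s $ j) + r" for j
    using q(1) by (simp add: mem_box_cart)
  have qt: "\<bar>(q - t) $ j\<bar> \<le> r" and qs: "\<bar>(q - s) $ j\<bar> \<le> r" for j
    using qj[of j] by (auto simp: abs_le_iff max_def min_def split: if_splits)
  have et: "\<bar>g q - g t - (\<Sum>j\<in>UNIV. (q - t) $ j * G j t)\<bar> \<le> r / Suc n"
    using q(2) qt by (auto simp: bad_def cube_def lin_error_def proj_UNIV not_less)
  have es: "\<bar>g q - g s - (\<Sum>j\<in>UNIV. (q - s) $ j * G j s)\<bar> \<le> r / Suc n"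
    using q(3) qs by (auto simp: bad_def cube_def lin_error_def proj_UNIV not_less)
  have lin: "\<bar>(\<Sum>j\<in>UNIV. (q - u) $ j * G j u) - (\<Sum>j\<in>UNIV. (q - u) $ j * (real_of_int (z j) / Suc n))\<bar> \<le> m * (r * (1 / Suc n))"
    if u: "u \<in> grad_cell G n z" "\<And>j. \<bar>(q - u) $ j\<bar> \<le> r" for u
  proof -
    have "\<bar>(\<Sum>j\<in>UNIV. (q - u) $ j * G j u) - (\<Sum>j\<in>UNIV. (q - u) $ j * (real_of_int (z j) / Suc n))\<bar> = \<bar>\<Sum>j\<in>UNIV. (q - u) $ j * (G j u - real_of_int (z j) / Suc n)\<bar>"
      by (simp add: sum_subtractf right_diff_distrib)
    also have "\<dots> \<le> (\<Sum>j\<in>UNIV. \<bar>(q - u) $ j * (G j u - real_of_int (z j) / Suc n)\<bar>)" by (rule sum_abs)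
    also have "\<dots> \<le> (\<Sum>j\<in>(UNIV::'m set). r * (1 / Suc n))"
      unfolding abs_mult using u r0 grad_cell_value[OF u(1)] by (intro sum_mono mult_mono) auto
    finally show ?thesis by (simp add: m_def)
  qed
  have split: "(\<Sum>j\<in>UNIV. (s - t) $ j * (real_of_int (z j) / Suc n)) = (\<Sum>j\<in>UNIV. (q - t) $ j * (real_of_int (z j) / Suc n)) - (\<Sum>j\<in>UNIV. (q - s) $ j * (real_of_int (z j) / Suc n))"
    unfolding sum_subtractf[symmetric] by (rule sum.cong) (auto simp: left_diff_distrib diff_divide_distrib)
  have "\<bar>g s - g t - (\<Sum>j\<in>UNIV. (s - t) $ j * (real_of_int (z j) / Suc n))\<bar> \<le> 2 * (r / Suc n) + 2 * (m * (r * (1 / Suc n)))"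
    unfolding split using et es lin[OF t(2) qt] lin[OF s(2) qs] by linarith
  also have "\<dots> = (2 + 2 * real m) * r / Suc n"
    by (simp add: add_divide_distrib distrib_right del: of_nat_Suc)
  finally show ?thesis by (simp add: m_def r_def)
qed

text \<open>The scale is chosen by \<open>(1/2)^Suc k < norm (s - t)\<close> and
  \<open>norm (s - t) \<le> (1/2)^k\<close>, so \<open>(1/2)^k\<close> is at most twice the distance
  and the constant doubles. The closeness assumption forces \<open>k \<ge> K\<close>.\<close>

lemma approx_pair:
  assumes t: "t \<in> approx_set g G UNIV n K" "t \<in> grad_cell G n z"
    and s: "s \<in> approx_set g G UNIV n K" "s \<in> grad_cell G n z"
    and n: "n \<ge> 2" and close: "norm (s - t) \<le> (1/2)^K"
  shows "\<bar>g s - g t - (\<Sum>j\<in>UNIV. (s - t) $ j * (real_of_int (z j) / Suc n))\<bar> \<le> (4 + 4 * CARD('m)) / Suc n * norm (s - t)"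
proof (cases "s = t")
  case False
  let ?d = "norm (s - t)"
  have d: "?d > 0" using False by simp
  have ex: "\<exists>k. (1/2)^k < ?d" using real_arch_pow_inv[OF d, of "1/2"] by auto
  define k' where "k' = (LEAST k. (1/2)^k < ?d)"
  have k': "(1/2)^k' < ?d" unfolding k'_def using ex by (rule LeastI_ex)
  have "(1/2)^k' < (1/2::real)^K" using k' close by (rule less_le_trans)
  moreover have "(1/2)^K \<le> (1/2::real)^k'" if "k' \<le> K" using that by (intro power_decreasing) auto
  ultimately have "K < k'" by (meson not_le)
  then obtain k where k: "k' = Suc k" "k \<ge> K" by (cases k') auto
  have dk: "?d \<le> (1/2)^k"
    using not_less_Least[of k "\<lambda>k. (1/2)^k < ?d"] k by (simp add: k'_def not_less)
  have "\<bar>t $ j - s $ j\<bar> \<le> (1/2)^k" for j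
    using component_le_norm_cart[of "s - t" j] dk by (simp add: abs_minus_commute)
  from approx_pair_cube[OF t s k(2) n this]
  have "\<bar>g s - g t - (\<Sum>j\<in>UNIV. (s - t) $ j * (real_of_int (z j) / Suc n))\<bar> \<le> (2 + 2 * CARD('m)) / Suc n * (1/2)^k" by simp
  also have "\<dots> \<le> (2 + 2 * CARD('m)) / Suc n * (2 * ?d)"
    using k' k by (intro mult_left_mono) auto
  finally show ?thesis by (simp add: field_simps)
qed simp

end

section \<open>Pieces on which the map is expanding\<close>

lemma negligible_expanding_vimage:
  fixes g :: "'a::euclidean_space \<Rightarrow> 'a"
  assumes E: "negligible E" and c: "c > 0"
    and expand: "\<And>s t. s \<in> X \<Longrightarrow> t \<in> X \<Longrightarrow> c * norm (s - t) \<le> norm (g s - g t)"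
    and XE: "g ` X \<subseteq> E"
  shows "negligible X"
proof -
  have inj: "inj_on g X"
  proof (rule inj_onI)
    fix s t assume st: "s \<in> X" "t \<in> X" "g s = g t"
    then show "s = t" using expand[of s t] c by (simp add: mult_le_0_iff)
  qed
  let ?f = "the_inv_into X g"
  have "negligible (?f ` (g ` X))"
  proof (rule negligible_locally_Lipschitz_image)
    show "negligible (g ` X)" using E XE by (rule negligible_subset)
    fix x assume "x \<in> g ` X"
    then obtain s where s: "s \<in> X" "x = g s" by auto
    have "norm (?f y - ?f x) \<le> (1 / c) * norm (y - x)" if y: "y \<in> g ` X" for y
    proof -
      obtain t where t: "t \<in> X" "y = g t" using y by auto
      show ?thesis using expand[OF t(1) s(1)] c s t inj
        by (simp add: the_inv_into_f_f field_simps)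
    qed
    then show "\<exists>T B. open T \<and> x \<in> T \<and> (\<forall>y\<in>g ` X \<inter> T. norm (?f y - ?f x) \<le> B * norm (y - x))"
      by (intro exI[of _ UNIV] exI[of _ "1 / c"]) auto
  qed simp
  moreover have "?f ` (g ` X) = X"
    using inj by (auto simp: image_image the_inv_into_f_f)
  ultimately show ?thesis by simp
qed

lemma norm_matrix_vector_le:
  fixes C :: "real^'m::finite^'m"
  assumes "\<And>l j. \<bar>C $ l $ j\<bar> \<le> c"
  shows "norm (C *v x) \<le> (real CARD('m) * real CARD('m) * c) * norm x"
proof -
  have "norm (C *v x) \<le> (\<Sum>l\<in>UNIV. \<bar>(C *v x) $ l\<bar>)" by (rule norm_le_l1_cart)
  also have "\<dots> \<le> (\<Sum>l\<in>(UNIV::'m set). \<Sum>j\<in>(UNIV::'m set). c * norm x)"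
  proof (rule sum_mono)
    fix l
    have "\<bar>(C *v x) $ l\<bar> \<le> (\<Sum>j\<in>UNIV. \<bar>C $ l $ j * x $ j\<bar>)"
      unfolding matrix_vector_mult_def by (simp add: sum_abs)
    also have "\<dots> \<le> (\<Sum>j\<in>(UNIV::'m set). c * norm x)"
      unfolding abs_mult using assms component_le_norm_cart[of x]
      by (intro sum_mono mult_mono) (auto intro: order_trans[OF abs_ge_zero assms])
    finally show "\<bar>(C *v x) $ l\<bar> \<le> (\<Sum>j\<in>(UNIV::'m set). c * norm x)" .
  qed
  finally show ?thesis by simp
qed

theorem AE_not_invertible_and_null:
  fixes g :: "real^'m::finite \<Rightarrow> real^'m" and G :: "'m \<Rightarrow> 'm \<Rightarrow> real^'m \<Rightarrow> real"
  assumes gm: "\<And>l. (\<lambda>t. g t $ l) \<in> borel_measurable borel"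
    and Gm: "\<And>i l. G i l \<in> borel_measurable borel"
    and ess: "\<And>i l. AE t in lborel. ess_deriv (\<lambda>e. g (t + axis i e) $ l) (G i l t)"
    and E: "E \<in> null_sets lborel"
  shows "AE t in lborel. \<not> (invertible (\<chi> i l. G i l t) \<and> g t \<in> E)"
proof -
  define m where "m = real CARD('m)"
  define V where "V l n K = approx_set (\<lambda>t. g t $ l) (\<lambda>i. G i l) UNIV n K" for l n K
  define W where "W l n z = grad_cell (\<lambda>i. G i l) n z" for l n z
  \<comment> \<open>Rows are components and columns are directions, the transpose of the matrix in
    the statement; \<open>Z\<close> holds the rounded entries.\<close>
  define C where "C n Z = ((\<chi> l j. real_of_int (Z l j) / Suc n) :: real^'m^'m)" for n :: nat and Z :: "'m \<Rightarrow> 'm \<Rightarrow> int"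
  \<comment> \<open>The constant \<open>4 + 4 * m\<close> of \<open>approx_pair\<close>, summed over
    the \<open>m\<close> components: the linear approximation errs by at most
    \<open>\<beta> / Suc n\<close> times the distance.\<close>
  define \<beta> where "\<beta> = m * (4 + 4 * m)"
  have Vmono: "V l n K \<subseteq> V l n K'" if "K \<le> K'" for l n K K'
    using that by (auto simp: V_def approx_set_def)
  have Eneg: "negligible E"
    using E by (simp add: negligible_iff_null_sets null_sets_completionI)
  obtain D :: "(real^'m) set" where D: "countable D" "\<And>X. open X \<Longrightarrow> X \<noteq> {} \<Longrightarrow> \<exists>d\<in>D. d \<in> X"
    using countable_dense_exists by blast
  \<comment> \<open>The radius is half of \<open>(1/2)^K\<close>, so that \<open>approx_pair\<close>
    applies to any two points of a piece. The rounded matrix stretches by at least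
    \<open>(\<beta> + 1) / Suc n\<close>, and the approximation loses at most
    \<open>\<beta> / Suc n\<close>; hence \<open>g\<close> expands by
    \<open>1 / Suc n\<close>.\<close>
  define X where "X n K Z q = {t. (\<forall>l. t \<in> V l n K \<and> t \<in> W l n (Z l)) \<and> dist t q < (1/2)^K / 2 \<and> g t \<in> E \<and>
     n \<ge> 2 \<and> (\<forall>x. (\<beta> + 1) / Suc n * norm x \<le> norm (C n Z *v x))}" for n K Z q
  have negX: "negligible (X n K Z q)" for n K Z q
  proof (cases "n \<ge> 2 \<and> (\<forall>x. (\<beta> + 1) / Suc n * norm x \<le> norm (C n Z *v x))")
    case True
    show ?thesis
    proof (rule negligible_expanding_vimage[OF Eneg, of "1 / Suc n" "X n K Z q" g])
      fix s t assume s: "s \<in> X n K Z q" and t: "t \<in> X n K Z q"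
      have "dist s t < (1/2)^K / 2 + (1/2)^K / 2"
        using s t by (intro dist_triangle_less_add[of s q]) (auto simp: X_def dist_commute)
      then have st: "norm (s - t) \<le> (1/2)^K" by (simp add: dist_norm)
      have comp: "\<bar>(g s - g t - C n Z *v (s - t)) $ l\<bar> \<le> (4 + 4 * m) / Suc n * norm (s - t)" for l
      proof -
        have "\<bar>g s $ l - g t $ l - (\<Sum>j\<in>UNIV. (s - t) $ j * (real_of_int (Z l j) / Suc n))\<bar> \<le> (4 + 4 * CARD('m)) / Suc n * norm (s - t)"
          by (rule approx_pair[of "\<lambda>t. g t $ l" "\<lambda>i. G i l", OF gm Gm _ _ _ _ _ st])
            (use s t True in \<open>auto simp: X_def V_def W_def\<close>)
        moreover have "(\<Sum>j\<in>UNIV. (s - t) $ j * (real_of_int (Z l j) / Suc n)) = (C n Z *v (s - t)) $ l"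
          unfolding matrix_vector_mult_def C_def by (simp add: mult.commute)
        ultimately show ?thesis by (simp add: m_def)
      qed
      have "norm (g s - g t - C n Z *v (s - t)) \<le> (\<Sum>l\<in>UNIV. \<bar>(g s - g t - C n Z *v (s - t)) $ l\<bar>)"
        by (rule norm_le_l1_cart)
      also have "\<dots> \<le> (\<Sum>l\<in>(UNIV::'m set). (4 + 4 * m) / Suc n * norm (s - t))"
        by (intro sum_mono comp)
      also have "\<dots> = \<beta> / Suc n * norm (s - t)" by (simp add: \<beta>_def m_def)
      finally have 1: "norm (g s - g t - C n Z *v (s - t)) \<le> \<beta> / Suc n * norm (s - t)" .
      have 2: "(\<beta> + 1) / Suc n * norm (s - t) \<le> norm (C n Z *v (s - t))" using True by blast
      have 3: "norm (C n Z *v (s - t)) \<le> norm (g s - g t) + norm (g s - g t - C n Z *v (s - t))"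
        using norm_triangle_ineq4[of "g s - g t" "g s - g t - C n Z *v (s - t)"] by simp
      have "(\<beta> + 1) / Suc n * norm (s - t) = \<beta> / Suc n * norm (s - t) + 1 / Suc n * norm (s - t)"
        by (simp add: add_divide_distrib distrib_right)
      then show "1 / Suc n * norm (s - t) \<le> norm (g s - g t)" using 1 2 3 by linarith
    qed (auto simp: X_def)
  next
    case False
    then have "X n K Z q = {}" by (auto simp: X_def)
    then show ?thesis by simp
  qed
  have "AE t in lborel. \<forall>n K Z. \<forall>q\<in>D. t \<notin> X n K Z q"
    unfolding AE_all_countable by (intro allI AE_ball_countable' D AE_negligible negX)
  moreover have "AE t in lborel. \<forall>l n. \<exists>K. t \<in> V l n K"
    unfolding V_def by (subst AE_all_countable) (intro allI AE_approx_set gm Gm ess)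
  ultimately show ?thesis
  proof eventually_elim
    case (elim t)
    show ?case
    proof
      assume A: "invertible (\<chi> i l. G i l t) \<and> g t \<in> E"
      define A where "A = ((\<chi> l i. G i l t) :: real^'m^'m)"
      have "A = transpose (\<chi> i l. G i l t)" by (simp add: A_def transpose_def)
      then have "invertible A" using transpose_invertible[OF conjunct1[OF A]] by simp
      then obtain \<kappa> where \<kappa>: "\<kappa> > 0" "\<And>x. \<kappa> * norm x \<le> norm (A *v x)"
        using linear_inj_bounded_below_pos[OF matrix_vector_mul_linear[of A] inj_matrix_vector_mult] by metis
      \<comment> \<open>Rounding the entries changes the matrix by at most
        \<open>m * m / Suc n\<close> in norm. The bound
        \<open>(m * m + \<beta> + 1) / Suc n \<le> \<kappa>\<close> therefore leaves the
        \<open>\<beta> + 1\<close> asked for in \<open>X\<close>.\<close>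
      obtain n0 :: nat where n0: "real n0 > (m * m + \<beta> + 1) / \<kappa>" using reals_Archimedean2 by blast
      define n where "n = max 2 n0"
      have "(m * m + \<beta> + 1) / \<kappa> < real (Suc n)" using n0 by (simp add: n_def)
      then have n\<kappa>: "(m * m + \<beta> + 1) / Suc n \<le> \<kappa>" using \<kappa>(1)
        by (simp add: field_simps del: of_nat_Suc)
      define Z where "Z l j = \<lfloor>real (Suc n) * G j l t\<rfloor>" for l j
      have tW: "t \<in> W l n (Z l)" for l by (simp add: W_def grad_cell_def Z_def)
      have "\<forall>l. \<exists>K. t \<in> V l n K" using elim(2) by blast
      then obtain Kl where Kl: "\<And>l. t \<in> V l n (Kl l)" unfolding choice_iff by blast
      \<comment> \<open>The sets \<open>V l n K\<close> grow with \<open>K\<close>, so the largest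
        value serves all components.\<close>
      define K where "K = Max (range Kl)"
      have tV: "t \<in> V l n K" for l
        using Kl[of l] Vmono[of "Kl l" K l n] by (auto simp: K_def)
      obtain q where q: "q \<in> D" "q \<in> ball t ((1/2)^K / 2)"
        using D(2)[of "ball t ((1/2)^K / 2)"] by (auto simp: not_le)
      have "(\<beta> + 1) / Suc n * norm x \<le> norm (C n Z *v x)" for x
      proof -
        have "\<bar>(A - C n Z) $ l $ j\<bar> \<le> 1 / Suc n" for l j
          using grad_cell_value[OF tW[of l, unfolded W_def], of j] by (simp add: A_def C_def)
        from norm_matrix_vector_le[of "A - C n Z", OF this]
        have 1: "norm ((A - C n Z) *v x) \<le> (m * m / Suc n) * norm x" by (simp add: m_def)
        have "A *v x = (A - C n Z) *v x + C n Z *v x" by (simp add: matrix_vector_mult_diff_rdistrib)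
        then have "norm (A *v x) \<le> norm ((A - C n Z) *v x) + norm (C n Z *v x)"
          by (metis norm_triangle_ineq)
        then have "\<kappa> * norm x \<le> (m * m / Suc n) * norm x + norm (C n Z *v x)" using 1 \<kappa>(2)[of x] by linarith
        moreover have "(m * m + \<beta> + 1) / Suc n * norm x \<le> \<kappa> * norm x" using n\<kappa> by (rule mult_right_mono) simp
        moreover have "(m * m + \<beta> + 1) / Suc n * norm x = (m * m / Suc n) * norm x + (\<beta> + 1) / Suc n * norm x"
          by (simp add: add_divide_distrib distrib_right)
        ultimately show ?thesis by linarith
      qed
      then have "t \<in> X n K Z q"
        using tV tW q A by (auto simp: X_def n_def dist_commute)
      then show False using elim(1) q(1) by blast
    qed
  qed
qed

section \<open>Quasi-invariant actions\<close>

lemma axis_zero: "axis i 0 = (0 :: real^'m)"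
  by (simp add: axis_def vec_eq_iff)

lemma norm_axis_real: "norm (axis i r :: real^'m::finite) = \<bar>r\<bar>"
proof -
  have "axis i r = r *\<^sub>R (axis i 1 :: real^'m)" by (simp add: axis_def vec_eq_iff)
  then show ?thesis by simp
qed

text \<open>Isolates what is used of the configurations. The bound holds on each \<open>Om n\<close>
  separately, with a constant that may grow with \<open>n\<close> and with the size \<open>R\<close>
  of the parameter. An upper bound on the transported measure suffices as an axiom: applied to
  \<open>- t\<close> it becomes a lower bound.\<close>

locale quasi_invariant_action = prob_space M for M :: "'w measure" +
  fixes T :: "real^'m::finite \<Rightarrow> 'w \<Rightarrow> 'w" and Om :: "nat \<Rightarrow> 'w set" and C :: "nat \<Rightarrow> nat \<Rightarrow> real"
  assumes T_measurable: "(\<lambda>(t, \<omega>). T t \<omega>) \<in> borel \<Otimes>\<^sub>M M \<rightarrow>\<^sub>M M"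
    and T_add: "\<And>s t \<omega>. \<omega> \<in> space M \<Longrightarrow> T s (T t \<omega>) = T (s + t) \<omega>"
    and T_zero: "\<And>\<omega>. \<omega> \<in> space M \<Longrightarrow> T 0 \<omega> = \<omega>"
    and Om_sets: "\<And>n. Om n \<in> sets M"
    and Om_cover: "\<And>\<omega>. \<omega> \<in> space M \<Longrightarrow> \<exists>n. \<omega> \<in> Om n"
    and quasi: "\<And>A n t R. A \<in> sets M \<Longrightarrow> norm t \<le> real R \<Longrightarrow>
      emeasure M {\<omega> \<in> Om n. T t \<omega> \<in> A} \<le> ennreal (C n R) * emeasure M (A \<inter> Om n)"
begin

section \<open>Null sets and integrals along orbits\<close>

lemma T_raw[measurable (raw)]:
  assumes "u \<in> borel_measurable N" "v \<in> N \<rightarrow>\<^sub>M M"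
  shows "(\<lambda>x. T (u x) (v x)) \<in> N \<rightarrow>\<^sub>M M"
  using measurable_compose[OF measurable_Pair[OF assms] T_measurable] by simp

lemmas [measurable] = Om_sets

lemma T_space: "\<omega> \<in> space M \<Longrightarrow> T t \<omega> \<in> space M"
  by (rule measurable_space[where M = M]) measurable

text \<open>The failures of \<open>Q\<close> are enclosed in a measurable null set. Its preimage is
  null on each \<open>Om n\<close> by quasi-invariance, and these events cover the space.\<close>

lemma AE_T:
  assumes "AE \<omega> in M. Q \<omega>"
  shows "AE \<omega> in M. Q (T t \<omega>)"
proof -
  obtain N where N: "N \<in> null_sets M" "{\<omega> \<in> space M. \<not> Q \<omega>} \<subseteq> N"
    using assms by (auto simp: eventually_ae_filter)
  then have [measurable]: "N \<in> sets M" by auto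
  obtain R :: nat where R: "norm t \<le> real R" using real_arch_simple by blast
  have "{\<omega> \<in> Om n. T t \<omega> \<in> N} \<in> null_sets M" for n
  proof (rule null_setsI)
    have "emeasure M (N \<inter> Om n) \<le> emeasure M N" by (rule emeasure_mono) auto
    then have "emeasure M (N \<inter> Om n) = 0" using N(1) by auto
    then show "emeasure M {\<omega> \<in> Om n. T t \<omega> \<in> N} = 0" using quasi[OF \<open>N \<in> sets M\<close> R, of n] by simp
    have "{\<omega> \<in> Om n. T t \<omega> \<in> N} = Om n \<inter> {\<omega> \<in> space M. T t \<omega> \<in> N}"
      using sets.sets_into_space[OF Om_sets] by auto
    also have "\<dots> \<in> sets M" by measurable
    finally show "{\<omega> \<in> Om n. T t \<omega> \<in> N} \<in> sets M" .
  qed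
  then have "(\<Union>n. {\<omega> \<in> Om n. T t \<omega> \<in> N}) \<in> null_sets M" by auto
  then show ?thesis
  proof (rule AE_I', intro subsetI)
    fix \<omega> assume "\<omega> \<in> {\<omega> \<in> space M. \<not> Q (T t \<omega>)}"
    then have \<omega>: "\<omega> \<in> space M" "\<not> Q (T t \<omega>)" by auto
    then have "T t \<omega> \<in> N" using N(2) T_space by auto
    then show "\<omega> \<in> (\<Union>n. {\<omega> \<in> Om n. T t \<omega> \<in> N})" using Om_cover[OF \<omega>(1)] by auto
  qed
qed

text \<open>Each \<open>T (\<sigma> r)\<close> pulls null sets back to null sets, and Fubini
  exchanges the two quantifiers. The parametrization \<open>\<sigma>\<close> is
  \<open>axis i\<close> for orbits in one direction and the identity for full orbits.\<close>

lemma AE_orbit: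
  fixes \<sigma> :: "'a::euclidean_space \<Rightarrow> real^'m"
  assumes [measurable]: "\<sigma> \<in> borel_measurable borel" and Q: "AE \<omega> in M. Q \<omega>"
  shows "AE \<omega> in M. AE r in lborel. Q (T (\<sigma> r) \<omega>)"
proof -
  obtain N where N: "N \<in> null_sets M" "{\<omega> \<in> space M. \<not> Q \<omega>} \<subseteq> N"
    using Q by (auto simp: eventually_ae_filter)
  then have [measurable]: "N \<in> sets M" by auto
  interpret P: pair_sigma_finite M "lborel :: 'a measure" ..
  have "AE r in (lborel :: 'a measure). AE \<omega> in M. T (\<sigma> r) \<omega> \<notin> N"
    using N(1) by (intro AE_I2 AE_T AE_not_in)
  then have orb: "AE \<omega> in M. AE r in (lborel :: 'a measure). T (\<sigma> r) \<omega> \<notin> N"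
    by (subst P.AE_commute) measurable
  show ?thesis
  proof (rule AE_mp[OF orb], rule AE_I2, rule impI)
    fix \<omega> assume \<omega>: "\<omega> \<in> space M" and "AE r in (lborel :: 'a measure). T (\<sigma> r) \<omega> \<notin> N"
    then show "AE r in (lborel :: 'a measure). Q (T (\<sigma> r) \<omega>)"
      using N(2) T_space[OF \<omega>] by (auto elim!: eventually_mono)
  qed
qed

text \<open>Fubini yields a single \<open>r\<close> for which \<open>Q\<close> holds almost surely
  after \<open>T (\<sigma> r)\<close>; applying \<open>T (- \<sigma> r)\<close> removes the
  shift.\<close>

lemma AE_of_AE_orbit:
  fixes \<sigma> :: "'a::euclidean_space \<Rightarrow> real^'m"
  assumes [measurable]: "\<sigma> \<in> borel_measurable borel" and [measurable]: "Measurable.pred M Q"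
    and Q: "AE \<omega> in M. AE r in lborel. Q (T (\<sigma> r) \<omega>)"
  shows "AE \<omega> in M. Q \<omega>"
proof -
  interpret P: pair_sigma_finite M "lborel :: 'a measure" ..
  have AEr: "AE r in (lborel :: 'a measure). AE \<omega> in M. Q (T (\<sigma> r) \<omega>)"
    using Q by (subst (asm) P.AE_commute) measurable
  have "\<exists>r. AE \<omega> in M. Q (T (\<sigma> r) \<omega>)"
  proof (rule ccontr)
    assume "\<nexists>r. AE \<omega> in M. Q (T (\<sigma> r) \<omega>)"
    then have no: "(AE \<omega> in M. Q (T (\<sigma> r) \<omega>)) \<longleftrightarrow> False" for r by blast
    have "AE r in (lborel :: 'a measure). False"
      using AEr unfolding no .
    then show False by (subst (asm) AE_iff_measurable[of UNIV]) auto
  qed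
  then obtain r where "AE \<omega> in M. Q (T (\<sigma> r) \<omega>)" by blast
  from AE_T[OF this, of "- \<sigma> r"] show ?thesis
    by (rule AE_mp) (auto simp: T_add T_zero)
qed

lemma nn_integral_T_le:
  assumes [measurable]: "u \<in> borel_measurable M" and R: "norm t \<le> real R"
  shows "(\<integral>\<^sup>+\<omega>. u (T t \<omega>) * indicator (Om n) \<omega> \<partial>M) \<le> ennreal (C n R) * (\<integral>\<^sup>+\<omega>. u \<omega> \<partial>M)"
proof -
  define N where "N = density M (indicator (Om n))"
  have [measurable_cong, simp]: "sets N = sets M" by (simp add: N_def)
  have [simp]: "space N = space M" by (simp add: N_def)
  have Nem: "emeasure N A = emeasure M (A \<inter> Om n)" if "A \<in> sets M" for A
    using that by (simp add: N_def emeasure_restricted Int_commute)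
  have le: "distr N M (T t) \<le> scale_measure (ennreal (C n R)) N"
  proof (subst le_measure)
    show "\<forall>A\<in>sets (distr N M (T t)). emeasure (distr N M (T t)) A \<le> emeasure (scale_measure (ennreal (C n R)) N) A"
    proof
      fix A assume "A \<in> sets (distr N M (T t))"
      then have A[measurable]: "A \<in> sets M" by simp
      have "emeasure (distr N M (T t)) A = emeasure M (T t -` A \<inter> space M \<inter> Om n)"
        by (subst emeasure_distr) (auto simp: Nem)
      also have "T t -` A \<inter> space M \<inter> Om n = {\<omega> \<in> Om n. T t \<omega> \<in> A}"
        using sets.sets_into_space[OF Om_sets] by auto
      also have "emeasure M \<dots> \<le> ennreal (C n R) * emeasure M (A \<inter> Om n)"
        by (rule quasi[OF A R])
      finally show "emeasure (distr N M (T t)) A \<le> emeasure (scale_measure (ennreal (C n R)) N) A"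
        using A by (simp add: Nem)
    qed
  qed simp
  have "(\<integral>\<^sup>+\<omega>. u (T t \<omega>) * indicator (Om n) \<omega> \<partial>M) = (\<integral>\<^sup>+\<omega>. u (T t \<omega>) \<partial>N)"
    unfolding N_def by (subst nn_integral_density) (auto simp: mult.commute)
  also have "\<dots> = (\<integral>\<^sup>+\<omega>. u \<omega> \<partial>distr N M (T t))"
    by (subst nn_integral_distr) auto
  also have "\<dots> \<le> (\<integral>\<^sup>+\<omega>. u \<omega> \<partial>scale_measure (ennreal (C n R)) N)"
    by (rule nn_integral_mono_measure[OF _ le]) simp
  also have "\<dots> = ennreal (C n R) * (\<integral>\<^sup>+\<omega>. u \<omega> \<partial>N)"
    by (rule nn_integral_scale_measure) simp
  also have "(\<integral>\<^sup>+\<omega>. u \<omega> \<partial>N) \<le> (\<integral>\<^sup>+\<omega>. u \<omega> \<partial>M)"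
    unfolding N_def by (subst nn_integral_density) (auto intro!: nn_integral_mono simp: indicator_def)
  finally show ?thesis by (simp add: mult_left_mono)
qed

text \<open>The joint integral over \<open>Om n\<close> and \<open>{- real R..real R}\<close> is at
  most \<open>C n R\<close> times the integral of \<open>u\<close> times the length, since
  \<open>norm (axis i r) = \<bar>r\<bar>\<close>. This supplies local integrability on almost every
  orbit in direction \<open>i\<close>.\<close>

lemma AE_orbit_nn_integral_finite:
  assumes [measurable]: "u \<in> borel_measurable M" and fin: "(\<integral>\<^sup>+\<omega>. u \<omega> \<partial>M) < \<infinity>"
  shows "AE \<omega> in M. \<forall>R::nat. (\<integral>\<^sup>+r. u (T (axis i r) \<omega>) * indicator {- real R..real R} r \<partial>lborel) < \<infinity>"
proof -
  interpret P: pair_sigma_finite M "lborel :: real measure" ..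
  have "AE \<omega> in M. \<omega> \<in> Om n \<longrightarrow> (\<integral>\<^sup>+r. u (T (axis i r) \<omega>) * indicator {- real R..real R} r \<partial>lborel) < \<infinity>" for n R :: nat
  proof -
    have "(\<integral>\<^sup>+\<omega>. (\<integral>\<^sup>+r. u (T (axis i r) \<omega>) * indicator {- real R..real R} r \<partial>lborel) * indicator (Om n) \<omega> \<partial>M)
      = (\<integral>\<^sup>+\<omega>. (\<integral>\<^sup>+r. u (T (axis i r) \<omega>) * indicator {- real R..real R} r * indicator (Om n) \<omega> \<partial>lborel) \<partial>M)"
      by (intro nn_integral_cong nn_integral_multc[symmetric]) measurable
    also have "\<dots> = (\<integral>\<^sup>+r. (\<integral>\<^sup>+\<omega>. u (T (axis i r) \<omega>) * indicator {- real R..real R} r * indicator (Om n) \<omega> \<partial>M) \<partial>lborel)"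
      by (rule P.Fubini'[symmetric]) measurable
    also have "\<dots> \<le> (\<integral>\<^sup>+r. ennreal (C n R) * (\<integral>\<^sup>+\<omega>. u \<omega> \<partial>M) * indicator {- real R..real R} r \<partial>lborel)"
    proof (rule nn_integral_mono)
      fix r
      show "(\<integral>\<^sup>+\<omega>. u (T (axis i r) \<omega>) * indicator {- real R..real R} r * indicator (Om n) \<omega> \<partial>M) \<le> ennreal (C n R) * (\<integral>\<^sup>+\<omega>. u \<omega> \<partial>M) * indicator {- real R..real R} r"
      proof (cases "r \<in> {- real R..real R}")
        case True
        then have "norm (axis i r :: real^'m) \<le> real R" by (auto simp: norm_axis_real)
        from nn_integral_T_le[OF assms(1) this, of n] True show ?thesis by simp
      qed simp
    qed
    also have "\<dots> = ennreal (C n R) * (\<integral>\<^sup>+\<omega>. u \<omega> \<partial>M) * ennreal (2 * real R)"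
      by (subst nn_integral_cmult_indicator) auto
    also have "\<dots> < \<infinity>" using fin by (simp add: ennreal_mult_less_top)
    finally have *: "(\<integral>\<^sup>+\<omega>. (\<integral>\<^sup>+r. u (T (axis i r) \<omega>) * indicator {- real R..real R} r \<partial>lborel) * indicator (Om n) \<omega> \<partial>M) < \<infinity>" .
    have "AE \<omega> in M. (\<integral>\<^sup>+r. u (T (axis i r) \<omega>) * indicator {- real R..real R} r \<partial>lborel) * indicator (Om n) \<omega> \<noteq> \<infinity>"
      by (rule nn_integral_noteq_infinite) (use * in auto)
    then show ?thesis by (rule AE_mp) (auto simp: less_top)
  qed
  then have "AE \<omega> in M. \<forall>n R. \<omega> \<in> Om n \<longrightarrow> (\<integral>\<^sup>+r. u (T (axis i r) \<omega>) * indicator {- real R..real R} r \<partial>lborel) < \<infinity>"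
    unfolding AE_all_countable by blast
  then show ?thesis by (rule AE_mp) (use Om_cover in \<open>blast intro!: AE_I2\<close>)
qed

section \<open>Essential derivatives along orbits\<close>

lemma pred_ess_deriv[measurable]:
  assumes [measurable]: "\<phi> \<in> borel_measurable M" "\<delta> \<in> borel_measurable M"
  shows "Measurable.pred M (\<lambda>\<omega>. ess_deriv (\<lambda>e. \<phi> (T (axis i e) \<omega>)) (\<delta> \<omega>))"
proof -
  have [measurable]: "Measurable.pred M (\<lambda>\<omega>. AE e in lborel. \<bar>e\<bar> < 1 / Suc k \<longrightarrow>
     \<bar>\<phi> (T (axis i e) \<omega>) - \<phi> (T (axis i 0) \<omega>) - e * \<delta> \<omega>\<bar> \<le> \<bar>e\<bar> / Suc n)" for k n
    by (rule pred_AE_lborel_section) measurable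
  show ?thesis unfolding ess_deriv_def by measurable
qed

text \<open>\<open>\<phi>0\<close> and \<open>\<delta>0\<close> stand for the given functions,
  \<open>\<phi>\<close> and \<open>\<delta>\<close> for versions measurable with respect to
  \<open>M\<close>. Along almost every orbit the versions agree at the base point and for almost
  every increment, which is all that \<open>ess_deriv\<close> sees.\<close>

lemma AE_ess_deriv_of_AE_limit:
  assumes [measurable]: "\<phi> \<in> borel_measurable M" "\<delta> \<in> borel_measurable M"
    and eq: "AE \<omega> in M. \<phi>0 \<omega> = \<phi> \<omega>" "AE \<omega> in M. \<delta>0 \<omega> = \<delta> \<omega>"
    and lim: "AE \<omega> in M. ((\<lambda>e. (\<phi>0 (T (axis i e) \<omega>) - \<phi>0 \<omega>) / e) \<longlongrightarrow> \<delta>0 \<omega>) (at 0)"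
  shows "AE \<omega> in M. ess_deriv (\<lambda>e. \<phi> (T (axis i e) \<omega>)) (\<delta> \<omega>)"
proof -
  have "AE \<omega> in M. AE e in lborel. \<phi>0 (T (axis i (e::real)) \<omega>) = \<phi> (T (axis i e) \<omega>)"
    by (rule AE_orbit) (use eq in auto)
  with eq lim AE_space show ?thesis
  proof (eventually_elim, goal_cases)
    case (1 \<omega>)
    have *: "\<phi> (T (axis i 0) \<omega>) = \<phi>0 \<omega>" unfolding axis_zero using 1 T_zero by simp
    show ?case
    proof (rule ess_derivI)
      fix c :: real assume "c > 0"
      then have "\<forall>\<^sub>F e in at 0. dist ((\<phi>0 (T (axis i e) \<omega>) - \<phi>0 \<omega>) / e) (\<delta>0 \<omega>) < c"
        using 1(3) tendstoD by blast
      then obtain d where d: "d > 0" "\<And>e. e \<noteq> 0 \<Longrightarrow> \<bar>e\<bar> < d \<Longrightarrow> \<bar>(\<phi>0 (T (axis i e) \<omega>) - \<phi>0 \<omega>) / e - \<delta>0 \<omega>\<bar> < c"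
        unfolding eventually_at by (auto simp: dist_real_def)
      have "AE e in lborel. \<bar>e\<bar> < d \<longrightarrow> \<bar>\<phi> (T (axis i e) \<omega>) - \<phi> (T (axis i 0) \<omega>) - e * \<delta> \<omega>\<bar> \<le> c * \<bar>e\<bar>"
        using 1(5) AE_lborel_singleton[of "0::real"]
      proof eventually_elim
        case (elim e)
        show ?case
        proof
          assume ed: "\<bar>e\<bar> < d"
          have "x - e * y = (x / e - y) * e" for x y using elim(2) by (simp add: field_simps)
          then have "\<bar>\<phi>0 (T (axis i e) \<omega>) - \<phi>0 \<omega> - e * \<delta>0 \<omega>\<bar> = \<bar>(\<phi>0 (T (axis i e) \<omega>) - \<phi>0 \<omega>) / e - \<delta>0 \<omega>\<bar> * \<bar>e\<bar>"
            by (simp only: abs_mult[symmetric])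
          also have "\<dots> \<le> c * \<bar>e\<bar>" using d(2)[OF elim(2) ed] by (intro mult_right_mono) auto
          finally show "\<bar>\<phi> (T (axis i e) \<omega>) - \<phi> (T (axis i 0) \<omega>) - e * \<delta> \<omega>\<bar> \<le> c * \<bar>e\<bar>"
            using 1(2) elim(1) by (simp add: *)
        qed
      qed
      then show "\<exists>d>0. AE e in lborel. \<bar>e\<bar> < d \<longrightarrow> \<bar>\<phi> (T (axis i e) \<omega>) - \<phi> (T (axis i 0) \<omega>) - e * \<delta> \<omega>\<bar> \<le> c * \<bar>e\<bar>"
        using d(1) by blast
    qed
  qed
qed

text \<open>Mean convergence over the space descends to individual orbits only along a subsequence.
  With steps \<open>\<epsilon> k\<close> whose errors are at most \<open>(1/2)^k\<close>, the sum
  \<open>u\<close> of the errors is integrable, hence locally integrable on almost every orbit, so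
  its terms tend to \<open>0\<close> there in the mean. The derivative obtained at almost every
  point of almost every orbit is carried back by \<open>AE_of_AE_orbit\<close>.\<close>

lemma AE_ess_deriv_of_mean_limit:
  assumes [measurable]: "\<phi> \<in> borel_measurable M" "\<delta> \<in> borel_measurable M"
    and fin\<phi>: "(\<integral>\<^sup>+\<omega>. ennreal \<bar>\<phi> \<omega>\<bar> \<partial>M) < \<infinity>" and fin\<delta>: "(\<integral>\<^sup>+\<omega>. ennreal \<bar>\<delta> \<omega>\<bar> \<partial>M) < \<infinity>"
    and lim: "((\<lambda>e. \<integral>\<^sup>+\<omega>. ennreal \<bar>(\<phi> (T (axis i e) \<omega>) - \<phi> \<omega>) / e - \<delta> \<omega>\<bar> \<partial>M) \<longlongrightarrow> 0) (at 0)"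
  shows "AE \<omega> in M. ess_deriv (\<lambda>e. \<phi> (T (axis i e) \<omega>)) (\<delta> \<omega>)"
proof -
  define I where "I e = (\<integral>\<^sup>+\<omega>. ennreal \<bar>(\<phi> (T (axis i e) \<omega>) - \<phi> \<omega>) / e - \<delta> \<omega>\<bar> \<partial>M)" for e
  have "\<exists>e. 0 < e \<and> e \<le> (1/2)^k \<and> I e \<le> ennreal ((1/2)^k)" for k :: nat
  proof -
    have "(I \<longlongrightarrow> 0) (at 0)" using lim by (simp add: I_def[abs_def])
    then have "\<forall>\<^sub>F e in at 0. I e < ennreal ((1/2)^k)" by (rule order_tendstoD) simp
    then obtain d where d: "d > 0" "\<And>e. e \<noteq> 0 \<Longrightarrow> \<bar>e\<bar> < d \<Longrightarrow> I e < ennreal ((1/2)^k)"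
      unfolding eventually_at by (auto simp: dist_real_def)
    define e where "e = min (d / 2) ((1/2)^k)"
    have "0 < e" "e < d" "e \<le> (1/2)^k" using d(1) by (auto simp: e_def)
    then show ?thesis using d(2)[of e] by (intro exI[of _ e]) (auto intro: less_imp_le)
  qed
  then obtain \<epsilon> where \<epsilon>: "\<And>k. 0 < \<epsilon> k" "\<And>k. \<epsilon> k \<le> (1/2)^k" "\<And>k. I (\<epsilon> k) \<le> ennreal ((1/2)^k)"
    by metis
  have \<epsilon>lim: "\<epsilon> \<longlonglongrightarrow> 0"
    by (rule tendsto_sandwich[OF _ _ tendsto_const LIMSEQ_realpow_zero[of "1/2"]])
      (auto intro!: always_eventually less_imp_le[OF \<epsilon>(1)] \<epsilon>(2))
  define u where "u \<omega> = (\<Sum>k. ennreal \<bar>(\<phi> (T (axis i (\<epsilon> k)) \<omega>) - \<phi> \<omega>) / \<epsilon> k - \<delta> \<omega>\<bar>)" for \<omega>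
  have um[measurable]: "u \<in> borel_measurable M" unfolding u_def by measurable
  have pm: "(\<lambda>\<omega>. ennreal \<bar>\<phi> \<omega>\<bar>) \<in> borel_measurable M" and qm: "(\<lambda>\<omega>. ennreal \<bar>\<delta> \<omega>\<bar>) \<in> borel_measurable M"
    by measurable
  have "(\<integral>\<^sup>+\<omega>. u \<omega> \<partial>M) = (\<Sum>k. I (\<epsilon> k))"
    unfolding u_def I_def by (rule nn_integral_suminf) measurable
  also have "\<dots> \<le> (\<Sum>k. ennreal ((1/2)^k))" by (intro suminf_le \<epsilon>) auto
  also have "\<dots> = ennreal (\<Sum>k. (1/2)^k)"
    by (rule suminf_ennreal2) (auto intro: summable_geometric)
  also have "\<dots> < \<infinity>" by simp
  finally have ufin: "(\<integral>\<^sup>+\<omega>. u \<omega> \<partial>M) < \<infinity>" .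
  have "AE \<omega> in M. AE x in lborel. ess_deriv (\<lambda>e. \<phi> (T (axis i e) (T (axis i x) \<omega>))) (\<delta> (T (axis i x) \<omega>))"
    using AE_orbit_nn_integral_finite[OF um ufin, of i] AE_orbit_nn_integral_finite[OF pm fin\<phi>, of i]
      AE_orbit_nn_integral_finite[OF qm fin\<delta>, of i] AE_space
  proof eventually_elim
    fix \<omega>
    assume u: "\<forall>R::nat. (\<integral>\<^sup>+r. u (T (axis i r) \<omega>) * indicator {- real R..real R} r \<partial>lborel) < \<infinity>"
      and p: "\<forall>R::nat. (\<integral>\<^sup>+r. ennreal \<bar>\<phi> (T (axis i r) \<omega>)\<bar> * indicator {- real R..real R} r \<partial>lborel) < \<infinity>"
      and q: "\<forall>R::nat. (\<integral>\<^sup>+r. ennreal \<bar>\<delta> (T (axis i r) \<omega>)\<bar> * indicator {- real R..real R} r \<partial>lborel) < \<infinity>"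
      and \<omega>[measurable]: "\<omega> \<in> space M"
    have ax: "T (axis i s) (T (axis i r) \<omega>) = T (axis i (r + s)) \<omega>" for r s
    proof -
      have "axis i s + axis i r = (axis i (r + s) :: real^'m)" by (auto simp: axis_def vec_eq_iff)
      then show ?thesis using T_add[OF \<omega>] by simp
    qed
    have [measurable]: "(\<lambda>r. \<phi> (T (axis i r) \<omega>)) \<in> borel_measurable borel" "(\<lambda>r. \<delta> (T (axis i r) \<omega>)) \<in> borel_measurable borel"
      by measurable
    show "AE x in lborel. ess_deriv (\<lambda>e. \<phi> (T (axis i e) (T (axis i x) \<omega>))) (\<delta> (T (axis i x) \<omega>))"
      unfolding ax
    proof (rule AE_ess_deriv_of_L1_limit[OF _ _ \<epsilon>lim \<epsilon>(1)])
      show "loc_integrable (\<lambda>r. \<phi> (T (axis i r) \<omega>))" "loc_integrable (\<lambda>r. \<delta> (T (axis i r) \<omega>))"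
        using p q by (auto simp: loc_integrable_def)
      fix R :: nat
      let ?a = "\<lambda>k. \<integral>\<^sup>+r. ennreal \<bar>(\<phi> (T (axis i (r + \<epsilon> k)) \<omega>) - \<phi> (T (axis i r) \<omega>)) / \<epsilon> k - \<delta> (T (axis i r) \<omega>)\<bar> * indicator {- real R..real R} r \<partial>lborel"
      have "(\<Sum>k. ?a k) = (\<integral>\<^sup>+r. (\<Sum>k. ennreal \<bar>(\<phi> (T (axis i (r + \<epsilon> k)) \<omega>) - \<phi> (T (axis i r) \<omega>)) / \<epsilon> k - \<delta> (T (axis i r) \<omega>)\<bar> * indicator {- real R..real R} r) \<partial>lborel)"
        by (rule nn_integral_suminf[symmetric]) measurable
      also have "\<dots> = (\<integral>\<^sup>+r. u (T (axis i r) \<omega>) * indicator {- real R..real R} r \<partial>lborel)"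
        unfolding u_def ax by (intro nn_integral_cong ennreal_suminf_multc)
      also have "\<dots> < \<infinity>" by (rule u[rule_format])
      finally have fin: "(\<Sum>k. ?a k) \<noteq> \<top>" unfolding less_top infinity_ennreal_def .
      have af: "ennreal (enn2real (?a k)) = ?a k" for k
      proof -
        have "sum ?a {k} \<le> (\<Sum>k. ?a k)" by (rule sum_le_suminf) auto
        then have "?a k \<le> (\<Sum>k. ?a k)" by simp
        also have "\<dots> < \<top>" using fin unfolding less_top .
        finally have "?a k < \<top>" .
        then show ?thesis by (rule ennreal_enn2real)
      qed
      have "summable (\<lambda>k. enn2real (?a k))"
        by (rule summable_suminf_not_top) (unfold af, rule enn2real_nonneg, rule fin)
      then have "(\<lambda>k. ennreal (enn2real (?a k))) \<longlonglongrightarrow> ennreal 0"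
        by (intro tendsto_ennrealI summable_LIMSEQ_zero)
      then show "?a \<longlonglongrightarrow> 0" unfolding af ennreal_0 .
    qed
  qed
  then show ?thesis
    by (rule AE_of_AE_orbit[where \<sigma> = "axis i", rotated 2]) measurable
qed

text \<open>Since \<open>T (axis i e) (T t \<omega>) = T (t + axis i e) \<omega>\<close>, the
  essential derivatives at \<open>T t \<omega>\<close> are the partial derivatives at
  \<open>t\<close> of the function along the orbit, to which the finite-dimensional theorem applies.
  The determinant makes the event measurable, as the return from orbits requires.\<close>

lemma AE_not_invertible_and_null_action:
  assumes [measurable]: "\<And>l. \<phi> l \<in> borel_measurable M" "\<And>i l. \<delta> i l \<in> borel_measurable M"
    and ess: "\<And>i l. AE \<omega> in M. ess_deriv (\<lambda>e. \<phi> l (T (axis i e) \<omega>)) (\<delta> i l \<omega>)"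
    and E: "E \<in> null_sets lborel"
  shows "AE \<omega> in M. \<not> (invertible ((\<chi> i l. \<delta> i l \<omega>) :: real^'m^'m) \<and> ((\<chi> l. \<phi> l \<omega>) :: real^'m) \<in> E)"
proof (rule AE_of_AE_orbit[where \<sigma> = "\<lambda>t. t"])
  have [measurable]: "E \<in> sets borel" using E by auto
  have [measurable]: "(\<lambda>\<omega>. (\<chi> l. \<phi> l \<omega>) :: real^'m) \<in> borel_measurable M"
    by (rule measurable_vec_lambda) measurable
  have [measurable]: "(\<lambda>\<omega>. det ((\<chi> i l. \<delta> i l \<omega>) :: real^'m^'m)) \<in> borel_measurable M"
    unfolding det_def by simp
  show "Measurable.pred M (\<lambda>\<omega>. \<not> (invertible ((\<chi> i l. \<delta> i l \<omega>) :: real^'m^'m) \<and> ((\<chi> l. \<phi> l \<omega>) :: real^'m) \<in> E))"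
    unfolding invertible_det_nz by measurable
  have "AE \<omega> in M. \<forall>i l. ess_deriv (\<lambda>e. \<phi> l (T (axis i e) \<omega>)) (\<delta> i l \<omega>)"
    unfolding AE_all_countable using ess by blast
  then have orb: "AE \<omega> in M. AE t in lborel. \<forall>i l. ess_deriv (\<lambda>e. \<phi> l (T (axis i e) (T t \<omega>))) (\<delta> i l (T t \<omega>))"
    by (rule AE_orbit[rotated]) simp
  show "AE \<omega> in M. AE t in lborel. \<not> (invertible ((\<chi> i l. \<delta> i l (T t \<omega>)) :: real^'m^'m) \<and> ((\<chi> l. \<phi> l (T t \<omega>)) :: real^'m) \<in> E)"
  proof (rule AE_mp[OF orb], rule AE_I2, rule impI)
    fix \<omega> assume \<omega>[measurable]: "\<omega> \<in> space M"
      and d: "AE t in lborel. \<forall>i l. ess_deriv (\<lambda>e. \<phi> l (T (axis i e) (T t \<omega>))) (\<delta> i l (T t \<omega>))"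
    show "AE t in lborel. \<not> (invertible ((\<chi> i l. \<delta> i l (T t \<omega>)) :: real^'m^'m) \<and> ((\<chi> l. \<phi> l (T t \<omega>)) :: real^'m) \<in> E)"
    proof (rule AE_not_invertible_and_null[OF _ _ _ E, of "\<lambda>t. \<chi> l. \<phi> l (T t \<omega>)" "\<lambda>i l t. \<delta> i l (T t \<omega>)"])
      show "AE t in lborel. ess_deriv (\<lambda>e. (\<chi> l. \<phi> l (T (t + axis i e) \<omega>)) $ l) (\<delta> i l (T t \<omega>))" for i l
        using d by eventually_elim (simp add: T_add[OF \<omega>] add.commute)
    qed simp_all
  qed
qed simp

end

section \<open>The flow of a time stretching\<close>

text \<open>Gronwall's inequality, applied to the square of \<open>d\<close> to stay differentiable at its zeros.\<close>

lemma gronwall_abs: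
  fixes d :: "real \<Rightarrow> real"
  assumes deriv: "\<And>s. s \<in> {0..1} \<Longrightarrow> (d has_real_derivative d' s) (at s within {0..1})"
    and le: "\<And>s. s \<in> {0..1} \<Longrightarrow> \<bar>d' s\<bar> \<le> K * \<bar>d s\<bar>"
  shows "\<bar>d 1\<bar> \<le> exp K * \<bar>d 0\<bar>"
proof -
  define F where "F s = (d s)\<^sup>2 * exp (- (2 * K * s))" for s
  have F': "(F has_real_derivative (2 * d s * d' s - 2 * K * (d s)\<^sup>2) * exp (- (2 * K * s))) (at s within {0..1})"
    if "s \<in> {0..1}" for s
    unfolding F_def by (rule derivative_eq_intros deriv[OF that] refl | simp add: algebra_simps power2_eq_square)+
  have "F 1 \<le> F 0"
  proof (rule DERIV_nonpos_imp_decreasing_open[of 0 1 F])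
    fix s :: real assume s: "0 < s" "s < 1"
    have "(F has_real_derivative (2 * d s * d' s - 2 * K * (d s)\<^sup>2) * exp (- (2 * K * s))) (at s)"
      using F'[of s] s by (simp add: at_within_Icc_at)
    moreover have "(2 * d s * d' s - 2 * K * (d s)\<^sup>2) * exp (- (2 * K * s)) \<le> 0"
    proof -
      have "d s * d' s \<le> \<bar>d s\<bar> * \<bar>d' s\<bar>" by (metis abs_ge_self abs_mult)
      also have "\<dots> \<le> \<bar>d s\<bar> * (K * \<bar>d s\<bar>)" using le[of s] s by (intro mult_left_mono) auto
      also have "\<dots> = K * (d s)\<^sup>2" by (simp add: power2_eq_square)
      finally show ?thesis by (intro mult_nonpos_nonneg) auto
    qed
    ultimately show "\<exists>y. (F has_real_derivative y) (at s) \<and> y \<le> 0" by blast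
  next
    show "continuous_on {0..1} F"
      unfolding continuous_on_eq_continuous_within using DERIV_continuous[OF F'] by blast
  qed simp
  then have "(d 1)\<^sup>2 * exp (- (2 * K)) \<le> (d 0)\<^sup>2" by (simp add: F_def)
  then have "(d 1)\<^sup>2 \<le> (d 0)\<^sup>2 * exp (2 * K)" by (simp add: exp_minus field_simps)
  also have "\<dots> = (exp K * \<bar>d 0\<bar>)\<^sup>2" by (simp add: power_mult_distrib exp_double)
  finally have "\<bar>d 1\<bar>\<^sup>2 \<le> (exp K * \<bar>d 0\<bar>)\<^sup>2" by simp
  then show ?thesis by (rule power2_le_imp_le) simp
qed

section \<open>Lipschitz continuity of the field and uniqueness of its flow\<close>

lemma H0_J_lipschitz:
  assumes "h \<in> H0"
  obtains L where "L > 0" "\<And>x y. \<bar>J h x - J h y\<bar> \<le> L * \<bar>x - y\<bar>"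
proof -
  obtain C where C: "AE t in half_line. \<bar>h t\<bar> \<le> C" and hm: "h \<in> borel_measurable half_line"
    using assms by (auto simp: H0_def)
  \<comment> \<open>The summand \<open>1\<close> keeps \<open>L\<close> positive even for
    \<open>h = 0\<close>; the construction of the flow box divides by \<open>L\<close>.\<close>
  define L where "L = max C 0 + 1"
  \<comment> \<open>Only the values of \<open>h\<close> on the half-line are under control.\<close>
  define g where "g t = indicator {0..} t * h t" for t
  have [measurable]: "g \<in> borel_measurable borel"
  proof -
    have "(\<lambda>t. indicator {0..} t *\<^sub>R h t) \<in> borel_measurable lborel"
      using hm unfolding half_line_def by (subst (asm) borel_measurable_restrict_space_iff) auto
    then show ?thesis by (simp add: g_def[abs_def])
  qed
  have gC: "AE t in lborel. \<bar>g t\<bar> \<le> L"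
  proof -
    have "AE t in lborel. t \<in> {0..} \<longrightarrow> \<bar>h t\<bar> \<le> C"
      using C unfolding half_line_def by (subst (asm) AE_restrict_space_iff) auto
    then show ?thesis by eventually_elim (auto simp: g_def L_def indicator_def)
  qed
  have bint: "integrable lborel (\<lambda>s. indicator S s *\<^sub>R g s)" "\<bar>LINT s:S|lborel. g s\<bar> \<le> L * measure lborel S"
    if S: "S \<in> sets borel" "emeasure lborel S < \<infinity>" for S
  proof -
    have [measurable]: "S \<in> sets borel" by fact
    have iL: "integrable lborel (\<lambda>s. indicator S s * L)" using S by simp
    show i: "integrable lborel (\<lambda>s. indicator S s *\<^sub>R g s)"
      by (rule Bochner_Integration.integrable_bound[OF iL]) (use gC in \<open>auto simp: indicator_def elim!: eventually_mono\<close>)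
    have "\<bar>LINT s:S|lborel. g s\<bar> \<le> (LINT s|lborel. \<bar>indicator S s *\<^sub>R g s\<bar>)"
      unfolding set_lebesgue_integral_def by (rule integral_abs_bound)
    also have "\<dots> \<le> (LINT s|lborel. indicator S s * L)"
      by (rule integral_mono_AE) (use i iL gC in \<open>auto simp: indicator_def elim!: eventually_mono\<close>)
    also have "\<dots> = L * measure lborel S" using S by simp
    finally show "\<bar>LINT s:S|lborel. g s\<bar> \<le> L * measure lborel S" .
  qed
  have si: "set_integrable lborel S g" if "S \<in> sets borel" "emeasure lborel S < \<infinity>" for S
    unfolding set_integrable_def using that by (rule bint(1))
  have Jg: "J h t = (LINT s:{0..t}|lborel. g s)" for t
    unfolding J_def set_lebesgue_integral_def by (intro Bochner_Integration.integral_cong) (auto simp: g_def indicator_def)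
  have le: "\<bar>J h y - J h x\<bar> \<le> L * (y - x)" if "0 \<le> x" "x \<le> y" for x y
  proof -
    have "J h y = (LINT s:{0..x} \<union> {x<..y}|lborel. g s)"
      unfolding Jg using that by (intro arg_cong[where f = "\<lambda>S. LINT s:S|lborel. g s"]) auto
    also have "\<dots> = J h x + (LINT s:{x<..y}|lborel. g s)"
      unfolding Jg using that by (intro set_integral_Un si) auto
    finally have "J h y - J h x = (LINT s:{x<..y}|lborel. g s)" by simp
    then show ?thesis using bint(2)[of "{x<..y}"] that by simp
  qed
  \<comment> \<open>For negative \<open>x\<close> the interval \<open>{0..x}\<close> is empty and
    \<open>J h x = 0\<close>, so the Lipschitz bound extends to the whole line.\<close>
  have neg: "J h x = J h (max x 0)" for x
  proof (cases "x < 0")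
    case True
    have "J h 0 = (LINT s:{0}|lborel. g s)" unfolding Jg by simp
    also have "\<dots> = 0" using bint(2)[of "{0}"] by simp
    finally show ?thesis using True by (simp add: J_def set_lebesgue_integral_def max_def)
  qed (simp add: max_def)
  show thesis
  proof
    show "L > 0" by (simp add: L_def)
    have "\<bar>J h x - J h y\<bar> \<le> L * \<bar>x - y\<bar>" if "x \<le> y" for x y
    proof -
      have "\<bar>J h (max y 0) - J h (max x 0)\<bar> \<le> L * (max y 0 - max x 0)" using that by (intro le) auto
      also have "\<dots> \<le> L * (y - x)" using that by (intro mult_left_mono) (auto simp: L_def max_def)
      finally show ?thesis using neg[of x] neg[of y] that by (simp add: abs_minus_commute)
    qed
    then show "\<bar>J h x - J h y\<bar> \<le> L * \<bar>x - y\<bar>" for x y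
      by (metis abs_minus_commute linear)
  qed
qed

lemma J_scale: "J (\<lambda>t. - (e * h t)) x = - e * J h x"
proof -
  have eq: "indicator {0..x} t *\<^sub>R - (e * h t) = - e * (indicator {0..x} t *\<^sub>R h t)" for t
    by simp
  show ?thesis
    unfolding J_def set_lebesgue_integral_def eq by (rule integral_mult_right_zero)
qed

text \<open>Two solutions with the same start agree at time 1 by Gronwall's inequality with constant
  \<open>\<bar>e\<bar> * L\<close>; hence any solution at hand evaluates the \<open>THE\<close> in
  \<open>time_stretch\<close>.\<close>

lemma time_stretch_eqI:
  assumes h: "h \<in> H0"
    and z: "z 0 = x" "\<And>s. s \<in> {0..1} \<Longrightarrow> 0 \<le> z s"
      "\<And>s. s \<in> {0..1} \<Longrightarrow> (z has_real_derivative - e * J h (z s)) (at s within {0..1})"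
  shows "time_stretch (\<lambda>t. - (e * h t)) x = z 1"
proof -
  obtain L where L: "L > 0" "\<And>x y. \<bar>J h x - J h y\<bar> \<le> L * \<bar>x - y\<bar>" using H0_J_lipschitz[OF h] by blast
  show ?thesis
    unfolding time_stretch_def J_scale
  proof (rule the_equality)
    show "\<exists>za. za 0 = x \<and> za 1 = z 1 \<and> (\<forall>s\<in>{0..1}. 0 \<le> za s \<and> (za has_real_derivative - e * J h (za s)) (at s within {0..1}))"
      using z by (intro exI[of _ z]) auto
  next
    fix y assume "\<exists>za. za 0 = x \<and> za 1 = y \<and> (\<forall>s\<in>{0..1}. 0 \<le> za s \<and> (za has_real_derivative - e * J h (za s)) (at s within {0..1}))"
    then obtain w where w: "w 0 = x" "w 1 = y" "\<And>s. s \<in> {0..1} \<Longrightarrow> (w has_real_derivative - e * J h (w s)) (at s within {0..1})"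
      by blast
    have "\<bar>w 1 - z 1\<bar> \<le> exp (\<bar>e\<bar> * L) * \<bar>w 0 - z 0\<bar>"
    proof (rule gronwall_abs)
      fix s :: real assume s: "s \<in> {0..1}"
      show "((\<lambda>s. w s - z s) has_real_derivative - e * J h (w s) - - e * J h (z s)) (at s within {0..1})"
        by (intro DERIV_diff w(3) z(3) s)
      have "\<bar>- e * J h (w s) - - e * J h (z s)\<bar> = \<bar>e\<bar> * \<bar>J h (w s) - J h (z s)\<bar>"
        by (simp add: abs_mult[symmetric] algebra_simps)
      also have "\<dots> \<le> \<bar>e\<bar> * (L * \<bar>w s - z s\<bar>)" by (intro mult_left_mono L) auto
      finally show "\<bar>- e * J h (w s) - - e * J h (z s)\<bar> \<le> \<bar>e\<bar> * L * \<bar>w s - z s\<bar>" by simp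
    qed
    then show "y = z 1" using w z by simp
  qed
qed

lemma time_stretch_fixed:
  assumes "h \<in> H0" "x \<ge> 0" "J h x = 0"
  shows "time_stretch (\<lambda>t. - (e * h t)) x = x"
  using time_stretch_eqI[OF assms(1), of "\<lambda>_. x" x e] assms by simp

text \<open>Separation of variables: \<open>\<rho>\<close> is an antiderivative of \<open>1 / v\<close>, and the Lipschitz bound at the
  zeros of \<open>v\<close> makes it diverge at both ends.\<close>

lemma flow_box_exists:
  fixes v :: "real \<Rightarrow> real"
  assumes L: "L > 0" "\<And>x y. \<bar>v x - v y\<bar> \<le> L * \<bar>x - y\<bar>"
    and ab: "a < b" and pos: "\<And>x. x \<in> {a<..<b} \<Longrightarrow> v x > 0" and zero: "v a = 0" "v b = 0"
  obtains \<rho> \<psi> :: "real \<Rightarrow> real" where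
    "\<And>r. \<psi> r \<in> {a<..<b}" "\<And>r. \<rho> (\<psi> r) = r" "\<And>x. x \<in> {a<..<b} \<Longrightarrow> \<psi> (\<rho> x) = x"
    "\<And>r. (\<psi> has_real_derivative v (\<psi> r)) (at r)" "\<rho> \<in> borel_measurable borel"
proof -
  have vcont: "isCont v x" for x
  proof -
    have "L-lipschitz_on UNIV v"
      using L by (intro lipschitz_onI) (auto simp: dist_real_def)
    then have "continuous_on UNIV v" by (rule lipschitz_on_continuous_on)
    then show ?thesis by (simp add: continuous_on_eq_continuous_at)
  qed
  have "\<exists>F. \<forall>x::real. ereal a < ereal x \<longrightarrow> ereal x < ereal b \<longrightarrow> (F has_vector_derivative (1 / v x)) (at x)"
  proof (rule einterval_antiderivative)
    fix x :: real assume "ereal a < ereal x" "ereal x < ereal b"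
    then have "v x \<noteq> 0" using pos[of x] by auto
    then show "isCont (\<lambda>x. 1 / v x) x" by (intro continuous_intros vcont)
  qed (use ab in simp)
  then obtain F where F: "\<And>x. x \<in> {a<..<b} \<Longrightarrow> (F has_real_derivative 1 / v x) (at x)"
    by (auto simp: has_real_derivative_iff_has_vector_derivative)
  have Fcont: "isCont F x" if "x \<in> {a<..<b}" for x using F[OF that] by (rule DERIV_isCont)
  have Fmono: "F x < F y" if "x \<in> {a<..<b}" "y \<in> {a<..<b}" "x < y" for x y
  proof (rule DERIV_pos_imp_increasing[OF that(3)])
    fix t assume "x \<le> t" "t \<le> y"
    then have t: "t \<in> {a<..<b}" using that by auto
    then show "\<exists>y. (F has_real_derivative y) (at t) \<and> y > 0" using F[OF t] pos[OF t] by (intro exI[of _ "1 / v t"]) auto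
  qed
  \<comment> \<open>Both ends are zeros of \<open>v\<close>, so \<open>1 / v\<close> dominates
    \<open>1 / (L * (x - a))\<close> and \<open>1 / (L * (b - x))\<close>, whose integrals diverge
    logarithmically.\<close>
  have va: "v x \<le> L * (x - a)" "v x \<le> L * (b - x)" if "x \<in> {a<..<b}" for x
    using L(2)[of x a] L(2)[of x b] that zero by auto
  define c where "c = (a + b) / 2"
  have c: "c \<in> {a<..<b}" using ab by (auto simp: c_def)
  have low: "\<exists>x\<in>{a<..<b}. F x \<le> r" for r
  proof -
    \<comment> \<open>The point \<open>x\<close> is placed so that
      \<open>ln (x - a) = ln (c - a) - L * K\<close>; comparison with \<open>ln (t - a) / L\<close>
      then puts \<open>F x\<close> at least \<open>K\<close> below \<open>F c\<close>. The condition
      \<open>K \<ge> 0\<close> keeps \<open>x\<close> left of \<open>c\<close>.\<close>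
    define K where "K = max 0 (F c - r)"
    define x where "x = a + (c - a) * exp (- (L * K))"
    have K0: "K \<ge> 0" "F c - K \<le> r" by (auto simp: K_def)
    have e: "(c - a) * exp (- (L * K)) \<le> (c - a) * 1"
      using c L K0 by (intro mult_left_mono) auto
    have x: "a < x" using c by (simp add: x_def)
    have "x \<le> a + (c - a) * 1" unfolding x_def using e by (rule add_left_mono)
    then have xc: "x \<le> c" by simp
    let ?G = "\<lambda>t. F t - ln (t - a) / L"
    have "?G x \<le> ?G c"
    proof (rule DERIV_nonneg_imp_nondecreasing[OF xc])
      fix t assume "x \<le> t" "t \<le> c"
      then have t: "t \<in> {a<..<b}" using x xc c by auto
      have "(?G has_real_derivative 1 / v t - (1 / (t - a)) / L) (at t)"
        using t L by (auto intro!: derivative_eq_intros F)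
      moreover have "(1 / (t - a)) / L \<le> 1 / v t"
        using va(1)[OF t] pos[OF t] t L by (simp add: frac_le mult.commute)
      ultimately show "\<exists>y. (?G has_real_derivative y) (at t) \<and> y \<ge> 0" by (intro exI[of _ "1 / v t - (1 / (t - a)) / L"]) simp
    qed
    moreover have "ln (x - a) = ln (c - a) - L * K"
      using c by (simp add: x_def ln_mult)
    ultimately have "F x \<le> F c - K" using L by (simp add: diff_divide_distrib)
    then show ?thesis using x xc c K0 by (intro bexI[of _ x]) auto
  qed
  have high: "\<exists>x\<in>{a<..<b}. r \<le> F x" for r
  proof -
    define K where "K = max 0 (r - F c)"
    define x where "x = b - (b - c) * exp (- (L * K))"
    have K0: "K \<ge> 0" "r \<le> F c + K" by (auto simp: K_def)
    have e: "(b - c) * exp (- (L * K)) \<le> (b - c) * 1"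
      using c L K0 by (intro mult_left_mono) auto
    have x: "x < b" using c by (simp add: x_def)
    have "b - (b - c) * 1 \<le> x" unfolding x_def using e by (rule diff_left_mono)
    then have xc: "c \<le> x" by simp
    let ?G = "\<lambda>t. F t + ln (b - t) / L"
    have "?G c \<le> ?G x"
    proof (rule DERIV_nonneg_imp_nondecreasing[OF xc])
      fix t assume "c \<le> t" "t \<le> x"
      then have t: "t \<in> {a<..<b}" using x xc c by auto
      have "(?G has_real_derivative 1 / v t + (- 1 / (b - t)) / L) (at t)"
        using t L by (auto intro!: derivative_eq_intros F)
      moreover have "(1 / (b - t)) / L \<le> 1 / v t"
        using va(2)[OF t] pos[OF t] t L by (simp add: frac_le mult.commute)
      ultimately show "\<exists>y. (?G has_real_derivative y) (at t) \<and> y \<ge> 0" by (intro exI[of _ "1 / v t + (- 1 / (b - t)) / L"]) simp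
    qed
    moreover have "ln (b - x) = ln (b - c) - L * K"
      using c by (simp add: x_def ln_mult)
    ultimately have "F c + K \<le> F x" using L by (simp add: diff_divide_distrib)
    then show ?thesis using x xc c K0 by (intro bexI[of _ x]) auto
  qed
  have surj: "\<exists>x\<in>{a<..<b}. F x = r" for r
  proof -
    obtain x y where x: "x \<in> {a<..<b}" "F x \<le> r" and y: "y \<in> {a<..<b}" "r \<le> F y" using low high by blast
    have xy: "x \<le> y" using Fmono[OF y(1) x(1)] x y by force
    have "\<exists>z. x \<le> z \<and> z \<le> y \<and> F z = r"
      by (rule IVT) (use x y xy in \<open>auto intro!: Fcont\<close>)
    then show ?thesis using x y by force
  qed
  define \<psi> where "\<psi> r = (SOME x. x \<in> {a<..<b} \<and> F x = r)" for r
  have \<psi>: "\<psi> r \<in> {a<..<b}" "F (\<psi> r) = r" for r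
    using someI_ex[of "\<lambda>x. x \<in> {a<..<b} \<and> F x = r"] surj[of r] unfolding \<psi>_def by blast+
  have \<psi>F: "\<psi> (F x) = x" if "x \<in> {a<..<b}" for x
    using Fmono[OF \<psi>(1)[of "F x"] that] Fmono[OF that \<psi>(1)[of "F x"]] \<psi>(2)[of "F x"]
    by (metis linorder_neqE less_irrefl)
  have \<psi>cont: "isCont \<psi> r" for r
  proof -
    let ?x = "\<psi> r"
    have "isCont \<psi> (F ?x)"
    proof (rule isCont_inverse_function2[of "(a + ?x) / 2" ?x "(?x + b) / 2"])
      show "(a + ?x) / 2 < ?x" "?x < (?x + b) / 2" using \<psi>(1)[of r] by auto
      fix z assume "(a + ?x) / 2 \<le> z" "z \<le> (?x + b) / 2"
      then have "z \<in> {a<..<b}" using \<psi>(1)[of r] by auto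
      then show "\<psi> (F z) = z" "isCont F z" by (auto intro: \<psi>F Fcont)
    qed
    then show ?thesis using \<psi>(2) by simp
  qed
  have \<psi>deriv: "(\<psi> has_real_derivative v (\<psi> r)) (at r)" for r
  proof -
    have "(\<psi> has_real_derivative inverse (1 / v (\<psi> r))) (at r)"
      by (rule DERIV_inverse_function[where f = F and a = "r - 1" and b = "r + 1"])
        (use F[OF \<psi>(1)] \<psi> \<psi>cont pos[OF \<psi>(1)[of r]] in auto)
    then show ?thesis by simp
  qed
  \<comment> \<open>\<open>F\<close> is continuous only inside the interval; cut off outside, it is
    Borel on the line.\<close>
  define \<rho> where "\<rho> x = indicator {a<..<b} x * F x" for x
  show thesis
  proof (rule that[of \<psi> \<rho>])
    have "(\<lambda>x. indicator {a<..<b} x *\<^sub>R F x) \<in> borel_measurable borel"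
      by (rule borel_measurable_continuous_on_indicator) (auto intro!: continuous_at_imp_continuous_on Fcont)
    then show "\<rho> \<in> borel_measurable borel"
      unfolding \<rho>_def by simp
    show "\<psi> r \<in> {a<..<b}" "\<rho> (\<psi> r) = r" "(\<psi> has_real_derivative v (\<psi> r)) (at r)" for r
      using \<psi>[of r] \<psi>deriv by (auto simp: \<rho>_def)
    show "x \<in> {a<..<b} \<Longrightarrow> \<psi> (\<rho> x) = x" for x by (auto simp: \<rho>_def \<psi>F)
  qed
qed

text \<open>In the coordinate \<open>r = \<rho> x\<close> the flow is a translation and Lebesgue
  measure has density \<open>w r = v (\<psi> r)\<close>, so the constant is a bound for
  \<open>w (r + t) / w r\<close>. As \<open>v\<close> is only Lipschitz, \<open>w\<close> is not
  differentiated: Gronwall's inequality bounds how far two trajectories spread, and the difference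
  quotients of \<open>\<psi>\<close> transfer this to \<open>w\<close>.\<close>

lemma flow_box_emeasure_le:
  fixes v :: "real \<Rightarrow> real"
  assumes L: "L > 0" "\<And>x y. \<bar>v x - v y\<bar> \<le> L * \<bar>x - y\<bar>"
    and pos: "\<And>x. x \<in> {a<..<b} \<Longrightarrow> v x > 0"
    and \<psi>: "\<And>r. \<psi> r \<in> {a<..<b}" "\<And>r. \<rho> (\<psi> r) = r" "\<And>x. x \<in> {a<..<b} \<Longrightarrow> \<psi> (\<rho> x) = x"
    and d\<psi>: "\<And>r. (\<psi> has_real_derivative v (\<psi> r)) (at r)" and \<rho>[measurable]: "\<rho> \<in> borel_measurable borel"
    and A[measurable]: "A \<in> sets borel"
  shows "emeasure lborel {x \<in> {a<..<b}. \<psi> (\<rho> x - t) \<in> A} \<le> ennreal (exp (L * \<bar>t\<bar>)) * emeasure lborel (A \<inter> {a<..<b})"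
proof -
  have "isCont \<psi> r" for r using d\<psi> by (rule DERIV_isCont)
  then have \<psi>c: "continuous_on UNIV \<psi>" by (simp add: continuous_on_eq_continuous_at)
  then have [measurable]: "\<psi> \<in> borel_measurable borel" by (rule borel_measurable_continuous_onI)
  have "L-lipschitz_on UNIV v"
    using L by (intro lipschitz_onI) (auto simp: dist_real_def)
  then have vc: "continuous_on UNIV v" by (rule lipschitz_on_continuous_on)
  define w where "w r = v (\<psi> r)" for r
  have w0: "w r > 0" for r using pos \<psi>(1) by (simp add: w_def)
  have wc: "continuous_on UNIV w"
    unfolding w_def by (rule continuous_on_compose2[OF vc \<psi>c]) simp
  then have [measurable]: "w \<in> borel_measurable borel" by (rule borel_measurable_continuous_onI)
  have mono: "\<psi> r < \<psi> r'" if "r < r'" for r r'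
    by (rule DERIV_pos_imp_increasing[OF that]) (use d\<psi> w0 in \<open>auto simp: w_def\<close>)
  have spread: "\<bar>\<psi> (r + t) - \<psi> (r' + t)\<bar> \<le> exp (L * \<bar>t\<bar>) * \<bar>\<psi> r - \<psi> r'\<bar>" for r r' t
  proof -
    have "\<bar>\<psi> (r + 1 * t) - \<psi> (r' + 1 * t)\<bar> \<le> exp (L * \<bar>t\<bar>) * \<bar>\<psi> (r + 0 * t) - \<psi> (r' + 0 * t)\<bar>"
    proof (rule gronwall_abs)
      fix s :: real
      show "((\<lambda>s. \<psi> (r + s * t) - \<psi> (r' + s * t)) has_real_derivative w (r + s * t) * t - w (r' + s * t) * t) (at s within {0..1})"
        unfolding w_def by (rule derivative_eq_intros DERIV_chain2[OF d\<psi>] refl | simp)+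
      have "\<bar>w (r + s * t) * t - w (r' + s * t) * t\<bar> = \<bar>t\<bar> * \<bar>w (r + s * t) - w (r' + s * t)\<bar>"
        by (simp add: abs_mult[symmetric] algebra_simps)
      also have "\<dots> \<le> \<bar>t\<bar> * (L * \<bar>\<psi> (r + s * t) - \<psi> (r' + s * t)\<bar>)"
        unfolding w_def by (intro mult_left_mono L) auto
      finally show "\<bar>w (r + s * t) * t - w (r' + s * t) * t\<bar> \<le> L * \<bar>t\<bar> * \<bar>\<psi> (r + s * t) - \<psi> (r' + s * t)\<bar>"
        by (simp add: mult_ac)
    qed
    then show ?thesis by simp
  qed
  have wle: "w (r + t) \<le> exp (L * \<bar>t\<bar>) * w r" for r t
  proof -
    have 1: "((\<lambda>\<delta>. \<bar>(\<psi> (r + t + \<delta>) - \<psi> (r + t)) / \<delta>\<bar>) \<longlongrightarrow> \<bar>w (r + t)\<bar>) (at 0)"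
      unfolding w_def using d\<psi>[of "r + t"] by (intro tendsto_rabs) (simp add: DERIV_def)
    have 2: "((\<lambda>\<delta>. exp (L * \<bar>t\<bar>) * \<bar>(\<psi> (r + \<delta>) - \<psi> r) / \<delta>\<bar>) \<longlongrightarrow> exp (L * \<bar>t\<bar>) * \<bar>w r\<bar>) (at 0)"
      unfolding w_def using d\<psi>[of r] by (intro tendsto_rabs tendsto_mult tendsto_const) (simp add: DERIV_def)
    have "\<bar>w (r + t)\<bar> \<le> exp (L * \<bar>t\<bar>) * \<bar>w r\<bar>"
    proof (rule tendsto_le[OF _ 2 1])
      show "\<forall>\<^sub>F \<delta> in at 0. \<bar>(\<psi> (r + t + \<delta>) - \<psi> (r + t)) / \<delta>\<bar> \<le> exp (L * \<bar>t\<bar>) * \<bar>(\<psi> (r + \<delta>) - \<psi> r) / \<delta>\<bar>"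
      proof (rule always_eventually, rule allI)
        fix \<delta>
        have "\<bar>\<psi> (r + t + \<delta>) - \<psi> (r + t)\<bar> / \<bar>\<delta>\<bar> \<le> (exp (L * \<bar>t\<bar>) * \<bar>\<psi> (r + \<delta>) - \<psi> r\<bar>) / \<bar>\<delta>\<bar>"
          using spread[of "r + \<delta>" t r] by (intro divide_right_mono) (auto simp: add_ac)
        then show "\<bar>(\<psi> (r + t + \<delta>) - \<psi> (r + t)) / \<delta>\<bar> \<le> exp (L * \<bar>t\<bar>) * \<bar>(\<psi> (r + \<delta>) - \<psi> r) / \<delta>\<bar>"
          by (simp add: abs_divide)
      qed
    qed simp
    then show ?thesis using w0[of r] w0[of "r + t"] by simp
  qed
  define \<nu> where "\<nu> = density lborel (\<lambda>r. ennreal (w r))"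
  have [measurable_cong, simp]: "sets \<nu> = sets borel" by (simp add: \<nu>_def)
  \<comment> \<open>The substitution is made on \<open>{- real n..real n}\<close>, and these
    intervals exhaust the line. For \<open>n = 0\<close> the interval is a single point and both
    sides vanish.\<close>
  have sub: "emeasure lborel (B \<inter> {a<..<b}) = emeasure \<nu> {r. \<psi> r \<in> B}" if B[measurable]: "B \<in> sets borel" for B
  proof -
    have fin: "emeasure lborel (B \<inter> {\<psi> (- real n)..\<psi> (real n)}) = emeasure \<nu> ({r. \<psi> r \<in> B} \<inter> {- real n..real n})" for n
    proof (cases "n = 0")
      case False
      then have n: "- real n < real n" by simp
      have "emeasure lborel (B \<inter> {\<psi> (- real n)..\<psi> (real n)}) = (\<integral>\<^sup>+x. indicator B x * indicator {\<psi> (- real n)..\<psi> (real n)} x \<partial>lborel)"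
        by (simp add: nn_integral_indicator[symmetric] indicator_inter_arith del: nn_integral_indicator)
      also have "\<dots> = (\<integral>\<^sup>+x. indicator B (\<psi> x) * ennreal (w x) * indicator {- real n..real n} x \<partial>lborel)"
        by (rule nn_integral_substitution_aux[OF _ _ _ _ _ n])
          (use w0 d\<psi> continuous_on_subset[OF wc] in \<open>auto simp: w_def intro: less_imp_le\<close>)
      also have "\<dots> = emeasure \<nu> ({r. \<psi> r \<in> B} \<inter> {- real n..real n})"
        unfolding \<nu>_def by (subst emeasure_density) (auto intro!: nn_integral_cong simp: indicator_def)
      finally show ?thesis .
    next
      case True
      have "emeasure lborel (B \<inter> {\<psi> 0}) \<le> emeasure lborel {\<psi> 0}" by (rule emeasure_mono) auto
      moreover have "emeasure \<nu> ({r. \<psi> r \<in> B} \<inter> {0}) \<le> emeasure \<nu> {0}" by (rule emeasure_mono) auto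
      moreover have "emeasure \<nu> {0} = 0"
      proof -
        have "{0::real} \<in> null_sets lborel" by auto
        then have "{0} \<in> null_sets \<nu>"
          unfolding \<nu>_def by (intro absolutely_continuousI_density[unfolded absolutely_continuous_def, THEN subsetD]) auto
        then show ?thesis by auto
      qed
      ultimately show ?thesis using True by simp
    qed
    have "emeasure lborel (B \<inter> {a<..<b}) = emeasure lborel (\<Union>n. B \<inter> {\<psi> (- real n)..\<psi> (real n)})"
    proof (rule arg_cong[where f = "emeasure lborel"], rule set_eqI, rule iffI)
      fix x assume x: "x \<in> B \<inter> {a<..<b}"
      obtain n :: nat where n: "\<bar>\<rho> x\<bar> < real n" using reals_Archimedean2 by blast
      have "\<psi> (- real n) < \<psi> (\<rho> x)" "\<psi> (\<rho> x) < \<psi> (real n)" using n by (auto intro!: mono)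
      then show "x \<in> (\<Union>n. B \<inter> {\<psi> (- real n)..\<psi> (real n)})" using x \<psi>(3)[of x] by (auto intro!: exI[of _ n])
    next
      fix x assume "x \<in> (\<Union>n. B \<inter> {\<psi> (- real n)..\<psi> (real n)})"
      then obtain n where "x \<in> B" "\<psi> (- real n) \<le> x" "x \<le> \<psi> (real n)" by auto
      then show "x \<in> B \<inter> {a<..<b}" using \<psi>(1)[of "- real n"] \<psi>(1)[of "real n"] by auto
    qed
    also have "\<dots> = (SUP n. emeasure lborel (B \<inter> {\<psi> (- real n)..\<psi> (real n)}))"
    proof (rule SUP_emeasure_incseq[symmetric])
      have "\<psi> r \<le> \<psi> r'" if "r \<le> r'" for r r' using mono[of r r'] that by (cases "r = r'") auto
      then show "incseq (\<lambda>n. B \<inter> {\<psi> (- real n)..\<psi> (real n)})"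
        by (intro monoI Int_mono order_refl) (simp add: atLeastatMost_subset_iff)
    qed auto
    also have "\<dots> = (SUP n. emeasure \<nu> ({r. \<psi> r \<in> B} \<inter> {- real n..real n}))" unfolding fin ..
    also have "\<dots> = emeasure \<nu> (\<Union>n. {r. \<psi> r \<in> B} \<inter> {- real n..real n})"
      by (rule SUP_emeasure_incseq) (auto simp: incseq_def)
    also have "(\<Union>n. {r. \<psi> r \<in> B} \<inter> {- real n..real n}) = {r. \<psi> r \<in> B}"
    proof (intro set_eqI iffI)
      fix r assume "r \<in> {r. \<psi> r \<in> B}"
      moreover obtain n :: nat where "\<bar>r\<bar> < real n" using reals_Archimedean2 by blast
      ultimately show "r \<in> (\<Union>n. {r. \<psi> r \<in> B} \<inter> {- real n..real n})" by (auto intro!: exI[of _ n])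
    qed auto
    finally show ?thesis .
  qed
  have "emeasure lborel {x \<in> {a<..<b}. \<psi> (\<rho> x - t) \<in> A} = emeasure lborel ({x. \<psi> (\<rho> x - t) \<in> A} \<inter> {a<..<b})"
    by (rule arg_cong[where f = "emeasure lborel"]) auto
  also have "\<dots> = emeasure \<nu> {r. \<psi> r \<in> {x. \<psi> (\<rho> x - t) \<in> A}}" by (rule sub) measurable
  also have "\<dots> = (\<integral>\<^sup>+r. ennreal (w r) * indicator {r. \<psi> (r - t) \<in> A} r \<partial>lborel)"
    unfolding \<nu>_def using \<psi>(2) by (subst emeasure_density) auto
  also have "\<dots> = (\<integral>\<^sup>+r. ennreal (w (t + 1 * r)) * indicator {r. \<psi> (r - t) \<in> A} (t + 1 * r) \<partial>lborel)"
    by (subst nn_integral_real_affine[of _ 1 t]) auto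
  also have "\<dots> \<le> (\<integral>\<^sup>+r. ennreal (exp (L * \<bar>t\<bar>)) * (ennreal (w r) * indicator {r. \<psi> r \<in> A} r) \<partial>lborel)"
  proof (rule nn_integral_mono)
    fix r
    have "ennreal (w (t + r)) \<le> ennreal (exp (L * \<bar>t\<bar>)) * ennreal (w r)"
      using wle[of r t] w0 by (subst ennreal_mult[symmetric]) (auto intro: less_imp_le simp: add.commute ennreal_leI)
    then show "ennreal (w (t + 1 * r)) * indicator {r. \<psi> (r - t) \<in> A} (t + 1 * r) \<le> ennreal (exp (L * \<bar>t\<bar>)) * (ennreal (w r) * indicator {r. \<psi> r \<in> A} r)"
      by (auto simp: indicator_def)
  qed
  also have "\<dots> = ennreal (exp (L * \<bar>t\<bar>)) * emeasure \<nu> {r. \<psi> r \<in> A}"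
    unfolding \<nu>_def by (subst nn_integral_cmult) (auto simp: emeasure_density)
  also have "\<dots> = ennreal (exp (L * \<bar>t\<bar>)) * emeasure lborel (A \<inter> {a<..<b})" by (simp add: sub)
  finally show ?thesis .
qed

lemma time_stretch_flow_box:
  assumes h: "h \<in> H0" and ab: "0 \<le> a" "a < b"
    and pos: "\<And>t. t \<in> {a<..<b} \<Longrightarrow> J h t > 0" and zero: "\<And>t. t \<in> {0..} - {a<..<b} \<Longrightarrow> J h t = 0"
  obtains \<rho> \<psi> L where "\<rho> \<in> borel_measurable borel" "\<psi> \<in> borel_measurable borel" "L \<ge> 0"
    "\<And>r. \<psi> r \<in> {a<..<b}" "\<And>r. \<rho> (\<psi> r) = r" "\<And>x. x \<in> {a<..<b} \<Longrightarrow> \<psi> (\<rho> x) = x"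
    "\<And>x e. x \<in> {a<..<b} \<Longrightarrow> time_stretch (\<lambda>t. - (e * h t)) x = \<psi> (\<rho> x - e)"
    "\<And>A t. A \<in> sets borel \<Longrightarrow>
      emeasure lborel {x \<in> {a<..<b}. \<psi> (\<rho> x - t) \<in> A} \<le> ennreal (exp (L * \<bar>t\<bar>)) * emeasure lborel (A \<inter> {a<..<b})"
proof -
  obtain L where L: "L > 0" "\<And>x y. \<bar>J h x - J h y\<bar> \<le> L * \<bar>x - y\<bar>" using H0_J_lipschitz[OF h] by blast
  have z: "J h a = 0" "J h b = 0" using zero ab by auto
  obtain \<rho> \<psi> where \<psi>: "\<And>r. \<psi> r \<in> {a<..<b}" "\<And>r. \<rho> (\<psi> r) = r" "\<And>x. x \<in> {a<..<b} \<Longrightarrow> \<psi> (\<rho> x) = x"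
    and d: "\<And>r. (\<psi> has_real_derivative J h (\<psi> r)) (at r)" and \<rho>: "\<rho> \<in> borel_measurable borel"
    by (rule flow_box_exists[of L "J h" a b, OF L ab(2) _ z], erule pos, rule that)
  show thesis
  proof (rule that[OF \<rho> _ _ \<psi>])
    have "isCont \<psi> r" for r using d by (rule DERIV_isCont)
    then show "\<psi> \<in> borel_measurable borel"
      by (intro borel_measurable_continuous_onI) (simp add: continuous_on_eq_continuous_at)
    show "L \<ge> 0" using L by simp
    show "time_stretch (\<lambda>t. - (e * h t)) x = \<psi> (\<rho> x - e)" if x: "x \<in> {a<..<b}" for x e
    proof -
      have "time_stretch (\<lambda>t. - (e * h t)) x = \<psi> (\<rho> x - e * 1)"
      \<comment> \<open>The field \<open>J h\<close> has unit speed in the coordinate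
        \<open>\<rho>\<close>, so the field \<open>- e * J h\<close> translates with speed
        \<open>- e\<close>.\<close>
      proof (rule time_stretch_eqI[OF h, of "\<lambda>s. \<psi> (\<rho> x - e * s)"])
        fix s
        show "0 \<le> \<psi> (\<rho> x - e * s)" using \<psi>(1)[of "\<rho> x - e * s"] ab by auto
        show "((\<lambda>s. \<psi> (\<rho> x - e * s)) has_real_derivative - e * J h (\<psi> (\<rho> x - e * s))) (at s within {0..1})"
        proof -
          have D: "((\<lambda>s. \<rho> x - e * s) has_real_derivative - e) (at s)"
            by (auto intro!: derivative_eq_intros)
          show ?thesis
            using has_field_derivative_at_within[OF DERIV_chain2[OF d D]] by (simp add: mult.commute)
        qed
      qed (use \<psi>(3)[OF x] in simp)
      then show ?thesis by simp
    qed
    show "emeasure lborel {x \<in> {a<..<b}. \<psi> (\<rho> x - t) \<in> A} \<le> ennreal (exp (L * \<bar>t\<bar>)) * emeasure lborel (A \<inter> {a<..<b})"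
      if "A \<in> sets borel" for A t
      by (rule flow_box_emeasure_le[OF L pos \<psi> d \<rho> that])
  qed
qed

section \<open>Quasi-invariance of the Poisson law\<close>

text \<open>The difference of the two measures is countably additive on the algebra; its Caratheodory
  extension is the difference on the generated sigma-algebra.\<close>

lemma emeasure_le_extend:
  assumes alg: "algebra \<Omega> \<A>"
    and sets: "sets N1 = sigma_sets \<Omega> \<A>" "sets N2 = sigma_sets \<Omega> \<A>"
    and fin: "finite_measure N1" "finite_measure N2"
    and le: "\<And>A. A \<in> \<A> \<Longrightarrow> emeasure N1 A \<le> emeasure N2 A"
    and A: "A \<in> sigma_sets \<Omega> \<A>"
  shows "emeasure N1 A \<le> emeasure N2 A"
proof -
  interpret algebra \<Omega> \<A> by fact
  interpret N1: finite_measure N1 by fact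
  interpret N2: finite_measure N2 by fact
  define f where "f A = emeasure N2 A - emeasure N1 A" for A
  have in1: "A \<in> \<A> \<Longrightarrow> A \<in> sets N1" and in2: "A \<in> \<A> \<Longrightarrow> A \<in> sets N2" for A
    using sets by auto
  have f_add: "f A + emeasure N1 A = emeasure N2 A" if "A \<in> \<A>" for A
    unfolding f_def using le[OF that] by (rule diff_add_cancel_ennreal)
  have "positive \<A> f" by (simp add: positive_def f_def)
  moreover have "countably_additive \<A> f"
  proof (rule countably_additiveI)
    fix B :: "nat \<Rightarrow> 'a set" assume B: "range B \<subseteq> \<A>" "disjoint_family B" "(\<Union>i. B i) \<in> \<A>"
    have "(\<Sum>i. f (B i)) + emeasure N1 (\<Union>i. B i) = (\<Sum>i. f (B i)) + (\<Sum>i. emeasure N1 (B i))"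
      using B in1 by (subst suminf_emeasure) auto
    also have "\<dots> = (\<Sum>i. f (B i) + emeasure N1 (B i))"
      by (rule suminf_add) auto
    also have "\<dots> = (\<Sum>i. emeasure N2 (B i))"
      using B f_add by (intro suminf_cong) auto
    also have "\<dots> = emeasure N2 (\<Union>i. B i)"
      using B in2 by (intro suminf_emeasure) auto
    also have "\<dots> = f (\<Union>i. B i) + emeasure N1 (\<Union>i. B i)"
      using f_add[OF B(3)] by simp
    finally show "(\<Sum>i. f (B i)) = f (\<Union>i. B i)"
      by (metis ennreal_add_diff_cancel_right N1.emeasure_finite infinity_ennreal_def)
  qed
  ultimately obtain \<kappa> where \<kappa>: "\<And>A. A \<in> \<A> \<Longrightarrow> \<kappa> A = f A" "measure_space \<Omega> (sigma_sets \<Omega> \<A>) \<kappa>"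
    using caratheodory' by blast
  have ca: "countably_additive (sigma_sets \<Omega> \<A>) \<kappa>" and pos: "positive (sigma_sets \<Omega> \<A>) \<kappa>"
    using \<kappa>(2) by (auto simp: measure_space_def)
  define K where "K = measure_of \<Omega> (sigma_sets \<Omega> \<A>) \<kappa>"
  have sig: "sigma_algebra \<Omega> (sigma_sets \<Omega> \<A>)" using \<kappa>(2) by (auto simp: measure_space_def)
  have Ksets: "sets K = sigma_sets \<Omega> \<A>" and Kspace: "space K = \<Omega>"
    using sig by (auto simp: K_def sigma_algebra.sets_measure_of_eq sigma_algebra.space_measure_of_eq)
  have Kem: "emeasure K A = \<kappa> A" if "A \<in> sigma_sets \<Omega> \<A>" for A
    unfolding K_def by (rule emeasure_measure_of_sigma[OF sig pos ca that])
  have sp: "space N1 = \<Omega>" "space N2 = \<Omega>"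
    using sets Ksets Kspace by (metis sets_eq_imp_space_eq)+
  \<comment> \<open>Stated as a sum because subtraction in \<open>ennreal\<close> is truncated;
    finiteness of \<open>N2\<close> permits the cancellation in the complement step.\<close>
  have "emeasure K A + emeasure N1 A = emeasure N2 A"
  proof (rule sigma_sets_induct_disjoint[OF _ _ A])
    show "Int_stable \<A>" using Int by (auto simp: Int_stable_def)
    show "\<A> \<subseteq> Pow \<Omega>" by (rule space_closed)
    show "emeasure K B + emeasure N1 B = emeasure N2 B" if "B \<in> \<A>" for B
      using that f_add[OF that] \<kappa>(1)[OF that] Kem[of B] by simp
    show "emeasure K {} + emeasure N1 {} = emeasure N2 {}" by simp
  next
    fix B assume B: "B \<in> sigma_sets \<Omega> \<A>" and eq: "emeasure K B + emeasure N1 B = emeasure N2 B"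
    have top: "emeasure K \<Omega> + emeasure N1 \<Omega> = emeasure N2 \<Omega>"
      using f_add[OF top] \<kappa>(1)[OF top] Kem[of \<Omega>] by (simp add: sigma_sets_top)
    have "(emeasure K (\<Omega> - B) + emeasure N1 (\<Omega> - B)) + emeasure N2 B = emeasure N2 (\<Omega> - B) + emeasure N2 B"
    proof -
      have compl: "emeasure N (space N - B) + emeasure N B = emeasure N (space N)" if "B \<in> sets N" for N :: "'a measure"
      proof -
        have "(space N - B) \<union> B = space N" using sets.sets_into_space[OF that] by auto
        then show ?thesis using that plus_emeasure[of "space N - B" N B] by auto
      qed
      have "emeasure N2 (\<Omega> - B) + emeasure N2 B = emeasure N2 \<Omega>" using compl[of N2] B sets sp by simp
      moreover have "emeasure N1 (\<Omega> - B) + emeasure N1 B = emeasure N1 \<Omega>" using compl[of N1] B sets sp by simp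
      moreover have "emeasure K (\<Omega> - B) + emeasure K B = emeasure K \<Omega>" using compl[of K] B Ksets Kspace by simp
      ultimately show ?thesis
        unfolding eq[symmetric] using top by (simp add: ac_simps) (metis ac_simps)
    qed
    then show "emeasure K (\<Omega> - B) + emeasure N1 (\<Omega> - B) = emeasure N2 (\<Omega> - B)"
      by (metis ennreal_add_diff_cancel_right N2.emeasure_finite infinity_ennreal_def)
  next
    fix B :: "nat \<Rightarrow> 'a set"
    assume B: "disjoint_family B" "range B \<subseteq> sigma_sets \<Omega> \<A>" "\<And>i. emeasure K (B i) + emeasure N1 (B i) = emeasure N2 (B i)"
    have "emeasure K (\<Union>i. B i) + emeasure N1 (\<Union>i. B i) = (\<Sum>i. emeasure K (B i)) + (\<Sum>i. emeasure N1 (B i))"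
      using B sets Ksets by (subst (1 2) suminf_emeasure) auto
    also have "\<dots> = (\<Sum>i. emeasure K (B i) + emeasure N1 (B i))" by (rule suminf_add) auto
    also have "\<dots> = (\<Sum>i. emeasure N2 (B i))" using B(3) by simp
    also have "\<dots> = emeasure N2 (\<Union>i. B i)" using B sets by (intro suminf_emeasure) auto
    finally show "emeasure K (\<Union>i. B i) + emeasure N1 (\<Union>i. B i) = emeasure N2 (\<Union>i. B i)" .
  qed
  then show ?thesis by (metis add.commute le_iff_add)
qed

text \<open>Independence of counts is given for disjoint families, while a cylinder event may
  involve overlapping sets. A new set \<open>A\<close> cuts every block in two and adjoins the part
  of \<open>A\<close> not yet covered. Empty blocks are discarded because distinct blocks will need
  distinct preimages.\<close>

lemma disjoint_refinement:
  assumes ring: "\<And>A B. A \<in> R \<Longrightarrow> B \<in> R \<Longrightarrow> A \<inter> B \<in> R \<and> A - B \<in> R"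
    and "finite \<A>" "\<A> \<subseteq> R"
  shows "\<exists>\<B>. finite \<B> \<and> \<B> \<subseteq> R \<and> disjoint \<B> \<and> {} \<notin> \<B> \<and> \<Union>\<B> = \<Union>\<A> \<and> (\<forall>B\<in>\<B>. \<forall>A\<in>\<A>. B \<subseteq> A \<or> B \<inter> A = {})"
  using assms(2,3)
proof (induction \<A>)
  case empty
  show ?case by (intro exI[of _ "{}"]) (auto simp: disjoint_def)
next
  case (insert A \<A>)
  then obtain \<B> where \<B>: "finite \<B>" "\<B> \<subseteq> R" "disjoint \<B>" "{} \<notin> \<B>" "\<Union>\<B> = \<Union>\<A>"
    "\<And>B A. B \<in> \<B> \<Longrightarrow> A \<in> \<A> \<Longrightarrow> B \<subseteq> A \<or> B \<inter> A = {}" by auto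
  have AR: "A \<in> R" using insert.prems by simp
  have diff: "A - \<Union>\<C> \<in> R" if "finite \<C>" "\<C> \<subseteq> R" for \<C>
    using that
  proof (induction \<C>)
    case (insert C \<C>)
    have "A - \<Union>(insert C \<C>) = (A - \<Union>\<C>) - C" by auto
    then show ?case using insert ring by auto
  qed (simp add: AR)
  define \<D> where "\<D> = ((\<lambda>B. B \<inter> A) ` \<B> \<union> (\<lambda>B. B - A) ` \<B> \<union> {A - \<Union>\<B>}) - {{}}"
  show ?case
  proof (intro exI[of _ \<D>] conjI)
    show "finite \<D>" using \<B>(1) by (simp add: \<D>_def)
    show "\<D> \<subseteq> R" using ring \<B>(1,2) AR diff[OF \<B>(1,2)] by (auto simp: \<D>_def)
    show "{} \<notin> \<D>" by (simp add: \<D>_def)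
    have disj: "B \<inter> C = {}" if "B \<in> \<B>" "C \<in> \<B>" "B \<noteq> C" for B C
      using \<B>(3) that by (auto simp: disjoint_def)
    show "disjoint \<D>"
    proof (rule disjointI)
      fix X Y assume XY: "X \<in> \<D>" "Y \<in> \<D>" "X \<noteq> Y"
      show "X \<inter> Y = {}"
      proof (rule ccontr)
        assume "X \<inter> Y \<noteq> {}"
        then obtain p where p: "p \<in> X" "p \<in> Y" by auto
        have uniq: "B = C" if "B \<in> \<B>" "C \<in> \<B>" "p \<in> B" "p \<in> C" for B C
          using disj[OF that(1,2)] that(3,4) by blast
        have "X = Y" if XD: "X \<in> \<D>" "p \<in> X" and YD: "Y \<in> \<D>" "p \<in> Y" for X Y
        proof -
          have form: "X = A - \<Union>\<B> \<and> p \<notin> \<Union>\<B> \<or> (\<exists>B\<in>\<B>. p \<in> B \<and> (p \<in> A \<and> X = B \<inter> A \<or> p \<notin> A \<and> X = B - A))"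
            if "X \<in> \<D>" "p \<in> X" for X
          proof -
            from that(1) consider B where "B \<in> \<B>" "X = B \<inter> A" | B where "B \<in> \<B>" "X = B - A" | "X = A - \<Union>\<B>"
              by (auto simp: \<D>_def)
            then show ?thesis using that(2) by cases blast+
          qed
          show ?thesis
          proof (cases "p \<in> \<Union>\<B>")
            case True
            then obtain B where B: "B \<in> \<B>" "p \<in> B" by blast
            have val: "Z = (if p \<in> A then B \<inter> A else B - A)" if Z: "Z \<in> \<D>" "p \<in> Z" for Z
            proof -
              obtain B' where B': "B' \<in> \<B>" "p \<in> B'" "p \<in> A \<and> Z = B' \<inter> A \<or> p \<notin> A \<and> Z = B' - A"
                using form[OF Z] True by blast
              have "B' = B" using uniq[OF B'(1) B(1) B'(2) B(2)] .
              then show ?thesis using B'(3) by (cases "p \<in> A") simp_all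
            qed
            show ?thesis unfolding val[OF XD] val[OF YD] ..
          next
            case False
            then have "X = A - \<Union>\<B>" "Y = A - \<Union>\<B>" using form[OF XD] form[OF YD] by blast+
            then show ?thesis by simp
          qed
        qed
        then show False using XY p by blast
      qed
    qed
    have U: "\<Union>(\<C> - {{}}) = \<Union>\<C>" for \<C> :: "'a set set" by (intro set_eqI iffI) (elim UnionE DiffE, rule UnionI, assumption+, elim UnionE, rule UnionI, rule DiffI, assumption, simp, metis empty_iff, assumption)
    have "\<Union>\<D> = (\<Union>B\<in>\<B>. B \<inter> A) \<union> (\<Union>B\<in>\<B>. B - A) \<union> (A - \<Union>\<B>)"
      unfolding \<D>_def U by (simp add: Un_commute)
    also have "\<dots> = A \<union> \<Union>\<B>"
      by (rule set_eqI) (simp, metis)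
    finally have "\<Union>\<D> = A \<union> \<Union>\<B>" .
    then show "\<Union>\<D> = \<Union>(insert A \<A>)" unfolding \<B>(5) by simp
    show "\<forall>B\<in>\<D>. \<forall>A'\<in>insert A \<A>. B \<subseteq> A' \<or> B \<inter> A' = {}"
    proof (intro ballI)
      fix D A' assume D: "D \<in> \<D>" and A': "A' \<in> insert A \<A>"
      from D consider B where "B \<in> \<B>" "D = B \<inter> A" | B where "B \<in> \<B>" "D = B - A" | "D = A - \<Union>\<B>"
        by (auto simp: \<D>_def)
      then show "D \<subseteq> A' \<or> D \<inter> A' = {}"
      proof cases
        case 1
        then show ?thesis using \<B>(6)[of B A'] A' by (cases "A' = A") auto
      next
        case 2
        then show ?thesis using \<B>(6)[of B A'] A' by (cases "A' = A") auto
      next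
        case 3
        then show ?thesis using A' \<B>(5) by auto
      qed
    qed
  qed
qed

section \<open>Counts in bounded sets and their joint law\<close>

definition half_space :: "(real \<times> 'u) set" where
  "half_space = {0..} \<times> UNIV"

text \<open>Closed under intersections and differences; on these sets both the intensity and the
  counts of a configuration are finite.\<close>

definition bounded_half_sets :: "(real \<times> 'u::metric_space) set set" where
  "bounded_half_sets = {A \<in> sets (borel \<Otimes>\<^sub>M borel). bounded A \<and> A \<subseteq> half_space}"

lemma sets_half_space[measurable]: "half_space \<in> sets (borel \<Otimes>\<^sub>M borel)"
  unfolding half_space_def by (intro pair_measureI) auto

lemma bounded_half_sets_Int_Diff:
  "A \<in> bounded_half_sets \<Longrightarrow> B \<in> bounded_half_sets \<Longrightarrow> A \<inter> B \<in> bounded_half_sets \<and> A - B \<in> bounded_half_sets"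
  by (auto simp: bounded_half_sets_def intro: bounded_subset)

lemma finite_configuration_Int:
  "\<omega> \<in> configurations \<Longrightarrow> A \<in> bounded_half_sets \<Longrightarrow> finite (\<omega> \<inter> A)"
  by (auto simp: configurations_def bounded_half_sets_def)

lemma card_configuration_Union:
  assumes "\<omega> \<in> configurations" "finite \<B>" "\<B> \<subseteq> bounded_half_sets" "disjoint \<B>"
  shows "card (\<omega> \<inter> \<Union>\<B>) = (\<Sum>B\<in>\<B>. card (\<omega> \<inter> B))"
proof -
  have "\<omega> \<inter> \<Union>\<B> = (\<Union>B\<in>\<B>. \<omega> \<inter> B)" by auto
  also have "card \<dots> = (\<Sum>B\<in>\<B>. card (\<omega> \<inter> B))"
  proof (rule card_UN_disjoint[OF assms(2)])
    show "\<forall>B\<in>\<B>. finite (\<omega> \<inter> B)" using assms finite_configuration_Int by blast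
    show "\<forall>B\<in>\<B>. \<forall>C\<in>\<B>. B \<noteq> C \<longrightarrow> \<omega> \<inter> B \<inter> (\<omega> \<inter> C) = {}"
      using assms(4) unfolding disjoint_def by blast
  qed
  finally show ?thesis .
qed

locale poisson_configurations =
  fixes \<mu> :: "'u::metric_space measure" and P :: "(real \<times> 'u) set measure"
  assumes sets_\<mu>: "sets \<mu> = sets borel" and sigma_finite: "sigma_finite_measure \<mu>"
    and finite_bounded: "\<And>B. B \<in> bounded_borel \<Longrightarrow> emeasure \<mu> B < \<infinity>"
    and law: "poisson_law \<mu> P"
begin

sublocale P: prob_space P using law by (simp add: poisson_law_def)

sublocale \<mu>: sigma_finite_measure \<mu> by (rule sigma_finite)

lemma space_P: "space P = configurations"
proof -
  have "sets P = sets vague_borel" using law by (simp add: poisson_law_def)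
  from sets_eq_imp_space_eq[OF this] show ?thesis by (simp add: vague_borel_def space_measure_of_conv)
qed

lemma space_intensity: "space (intensity \<mu>) = half_space"
  using sets_eq_imp_space_eq[OF sets_\<mu>]
  by (simp add: intensity_def half_line_def space_pair_measure half_space_def space_restrict_space)

lemma measurable_id_intensity: "(\<lambda>x. x) \<in> intensity \<mu> \<rightarrow>\<^sub>M borel \<Otimes>\<^sub>M borel"
proof -
  have 1: "(\<lambda>x. x) \<in> half_line \<rightarrow>\<^sub>M borel"
    unfolding half_line_def by (intro measurable_restrict_space1) simp
  have 2: "(\<lambda>x. x) \<in> \<mu> \<rightarrow>\<^sub>M borel" using sets_\<mu> by (intro measurable_ident_sets)
  have "(\<lambda>x. (fst x, snd x)) \<in> half_line \<Otimes>\<^sub>M \<mu> \<rightarrow>\<^sub>M borel \<Otimes>\<^sub>M borel"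
    by (intro measurable_Pair measurable_compose[OF measurable_fst 1] measurable_compose[OF measurable_snd 2])
  then show ?thesis by (simp add: intensity_def)
qed

lemma bounded_half_sets_intensity: "A \<in> bounded_half_sets \<Longrightarrow> A \<in> sets (intensity \<mu>)"
proof -
  assume A: "A \<in> bounded_half_sets"
  then have "(\<lambda>x. x) -` A \<inter> space (intensity \<mu>) \<in> sets (intensity \<mu>)"
    by (intro measurable_sets[OF measurable_id_intensity]) (simp add: bounded_half_sets_def)
  moreover have "(\<lambda>x. x) -` A \<inter> space (intensity \<mu>) = A"
    using A by (auto simp: space_intensity bounded_half_sets_def)
  ultimately show ?thesis by simp
qed

lemma emeasure_intensity_finite:
  assumes "A \<in> bounded_half_sets"
  shows "emeasure (intensity \<mu>) A < \<infinity>"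
proof -
  have "bounded A" "A \<subseteq> half_space" using assms by (auto simp: bounded_half_sets_def)
  then obtain c :: "real \<times> 'u" and e where e: "\<And>x. x \<in> A \<Longrightarrow> dist c x \<le> e" unfolding bounded_def by blast
  obtain s x0 where c: "c = (s, x0)" by (cases c)
  let ?B = "cball x0 e"
  have sub: "A \<subseteq> ({0..} \<inter> cball s e) \<times> ?B"
  proof
    fix x assume x: "x \<in> A"
    have "dist s (fst x) \<le> e" "dist x0 (snd x) \<le> e"
      using e[OF x] dist_fst_le[of c x] dist_snd_le[of c x] c by auto
    moreover have "fst x \<ge> 0" using x \<open>A \<subseteq> half_space\<close> by (auto simp: half_space_def)
    ultimately show "x \<in> ({0..} \<inter> cball s e) \<times> ?B" by (cases x) auto
  qed
  have S: "{0..} \<inter> cball s e \<in> sets half_line"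
    by (auto simp: half_line_def sets_restrict_space)
  have B: "?B \<in> sets \<mu>" by (simp add: sets_\<mu>)
  have "emeasure (intensity \<mu>) A \<le> emeasure (intensity \<mu>) (({0..} \<inter> cball s e) \<times> ?B)"
    using sub S B by (intro emeasure_mono) (auto simp: intensity_def)
  also have "\<dots> = emeasure half_line ({0..} \<inter> cball s e) * emeasure \<mu> ?B"
    unfolding intensity_def by (rule \<mu>.emeasure_pair_measure_Times[OF S B])
  also have "\<dots> < \<infinity>"
  proof -
    have "emeasure half_line ({0..} \<inter> cball s e) = emeasure lborel ({0..} \<inter> cball s e)"
      unfolding half_line_def by (subst emeasure_restrict_space) auto
    also have "\<dots> \<le> emeasure lborel (cball s e)" by (rule emeasure_mono) auto
    also have "\<dots> < \<infinity>" by (rule emeasure_bounded_finite) simp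
    finally have "emeasure half_line ({0..} \<inter> cball s e) < \<infinity>" .
    moreover have "emeasure \<mu> ?B < \<infinity>" by (rule finite_bounded) (simp add: bounded_borel_def)
    ultimately show ?thesis by (simp add: ennreal_mult_less_top)
  qed
  finally show ?thesis .
qed

definition \<Lambda> :: "(real \<times> 'u) set \<Rightarrow> real" where
  "\<Lambda> A = measure (intensity \<mu>) A"

lemma emeasure_intensity: "A \<in> bounded_half_sets \<Longrightarrow> emeasure (intensity \<mu>) A = ennreal (\<Lambda> A)"
  unfolding \<Lambda>_def by (rule emeasure_eq_ennreal_measure) (auto dest: emeasure_intensity_finite)

lemma \<Lambda>_Union:
  assumes "finite I" "\<And>i. i \<in> I \<Longrightarrow> B i \<in> bounded_half_sets" "disjoint_family_on B I"
  shows "\<Lambda> (\<Union>i\<in>I. B i) = (\<Sum>i\<in>I. \<Lambda> (B i))"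
  unfolding \<Lambda>_def
proof (rule measure_finite_Union[OF assms(1) _ assms(3)])
  show "B ` I \<subseteq> sets (intensity \<mu>)" using assms(2) bounded_half_sets_intensity by auto
  show "emeasure (intensity \<mu>) (B i) \<noteq> \<infinity>" if "i \<in> I" for i
    using emeasure_intensity_finite[OF assms(2)[OF that]] by auto
qed

lemma finite_intensity_setsI: "A \<in> bounded_half_sets \<Longrightarrow> A \<in> finite_intensity_sets \<mu>"
  unfolding finite_intensity_sets_def using bounded_half_sets_intensity emeasure_intensity_finite by blast

lemma indep_counts:
  assumes "finite \<B>" "\<B> \<subseteq> bounded_half_sets" "disjoint \<B>"
  shows "P.indep_vars (\<lambda>_. count_space UNIV) (\<lambda>A \<omega>. card (\<omega> \<inter> A)) \<B>"
proof -
  have "\<forall>\<A>. finite \<A> \<and> \<A> \<subseteq> finite_intensity_sets \<mu> \<and> disjoint \<A> \<longrightarrow>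
        P.indep_vars (\<lambda>_. count_space UNIV) (\<lambda>A \<omega>. card (\<omega> \<inter> A)) \<A>"
    using law unfolding poisson_law_def by (elim conjE)
  moreover have "\<B> \<subseteq> finite_intensity_sets \<mu>" using assms(2) finite_intensity_setsI by blast
  ultimately show ?thesis using assms by blast
qed

text \<open>The measurability of the counts is part of their independence, already for one-element families.
  The vague topology is therefore never needed.\<close>

lemma measurable_card_P: "A \<in> bounded_half_sets \<Longrightarrow> (\<lambda>\<omega>. card (\<omega> \<inter> A)) \<in> P \<rightarrow>\<^sub>M count_space UNIV"
proof -
  assume "A \<in> bounded_half_sets"
  then have "P.indep_vars (\<lambda>_. count_space UNIV) (\<lambda>A \<omega>. card (\<omega> \<inter> A)) {A}"
    by (intro indep_counts) (auto simp: disjoint_def)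
  then show ?thesis by (simp add: P.indep_vars_def2)
qed

definition poisson_prob :: "real \<Rightarrow> nat \<Rightarrow> real" where
  "poisson_prob l k = exp (- l) * l ^ k / fact k"

lemma prob_card: "A \<in> bounded_half_sets \<Longrightarrow> P.prob {\<omega> \<in> space P. card (\<omega> \<inter> A) = k} = poisson_prob (\<Lambda> A) k"
proof -
  assume A: "A \<in> bounded_half_sets"
  then have "P.prob {\<omega> \<in> space P. finite (\<omega> \<inter> A) \<and> card (\<omega> \<inter> A) = k} = poisson_prob (\<Lambda> A) k"
  proof -
    have "\<forall>A \<in> finite_intensity_sets \<mu>. \<forall>k. P.prob {\<omega> \<in> space P. finite (\<omega> \<inter> A) \<and> card (\<omega> \<inter> A) = k} =
          exp (- measure (intensity \<mu>) A) * measure (intensity \<mu>) A ^ k / fact k"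
      using law unfolding poisson_law_def by (elim conjE)
    then show ?thesis using finite_intensity_setsI[OF A] by (simp add: poisson_prob_def \<Lambda>_def)
  qed
  moreover have "{\<omega> \<in> space P. finite (\<omega> \<inter> A) \<and> card (\<omega> \<inter> A) = k} = {\<omega> \<in> space P. card (\<omega> \<inter> A) = k}"
    using A finite_configuration_Int space_P by auto
  ultimately show ?thesis by simp
qed

lemma prob_cards:
  assumes \<B>: "finite \<B>" "\<B> \<subseteq> bounded_half_sets" "disjoint \<B>"
  shows "P.prob {\<omega> \<in> configurations. \<forall>B\<in>\<B>. card (\<omega> \<inter> B) = k B} = (\<Prod>B\<in>\<B>. poisson_prob (\<Lambda> B) (k B))"
proof (cases "\<B> = {}")
  case True
  then show ?thesis using P.prob_space by (simp add: space_P)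
next
  case False
  have "P.indep_vars (\<lambda>_. count_space UNIV) (\<lambda>A \<omega>. card (\<omega> \<inter> A)) \<B>"
    using \<B> by (rule indep_counts)
  then have "P.prob (\<Inter>B\<in>\<B>. (\<lambda>\<omega>. card (\<omega> \<inter> B)) -` {k B} \<inter> space P) = (\<Prod>B\<in>\<B>. P.prob ((\<lambda>\<omega>. card (\<omega> \<inter> B)) -` {k B} \<inter> space P))"
    by (rule P.indep_varsD[OF _ False \<B>(1) order_refl]) auto
  also have "(\<Inter>B\<in>\<B>. (\<lambda>\<omega>. card (\<omega> \<inter> B)) -` {k B} \<inter> space P) = {\<omega> \<in> configurations. \<forall>B\<in>\<B>. card (\<omega> \<inter> B) = k B}"
    using False by (auto simp: space_P)
  also have "(\<Prod>B\<in>\<B>. P.prob ((\<lambda>\<omega>. card (\<omega> \<inter> B)) -` {k B} \<inter> space P)) = (\<Prod>B\<in>\<B>. poisson_prob (\<Lambda> B) (k B))"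
  proof (rule prod.cong)
    fix B assume "B \<in> \<B>"
    then have "P.prob {\<omega> \<in> space P. card (\<omega> \<inter> B) = k B} = poisson_prob (\<Lambda> B) (k B)"
      using \<B> by (intro prob_card) auto
    moreover have "(\<lambda>\<omega>. card (\<omega> \<inter> B)) -` {k B} \<inter> space P = {\<omega> \<in> space P. card (\<omega> \<inter> B) = k B}" by auto
    ultimately show "P.prob ((\<lambda>\<omega>. card (\<omega> \<inter> B)) -` {k B} \<inter> space P) = poisson_prob (\<Lambda> B) (k B)" by simp
  qed simp
  finally show ?thesis .
qed

section \<open>The sigma-algebra generated by the counts\<close>

lemma space_count_algebra: "space (count_algebra :: (real \<times> 'u) set measure) = configurations"
  by (simp add: count_algebra_def space_measure_of_conv)

lemma sets_count_algebra:
  "sets (count_algebra :: (real \<times> 'u) set measure) = sigma_sets configurations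
     {{\<omega> \<in> configurations. card (\<omega> \<inter> A) = k} | A k. A \<in> bounded_half_sets}"
proof -
  have "{{\<omega> \<in> configurations. card (\<omega> \<inter> A) = k} | A k. A \<in> sets (borel \<Otimes>\<^sub>M borel) \<and> bounded A}
    = {{\<omega> \<in> configurations. card (\<omega> \<inter> A) = k} | A k. A \<in> (bounded_half_sets :: (real \<times> 'u) set set)}" (is "?L = ?R")
  proof (intro set_eqI iffI)
    fix E assume "E \<in> ?L"
    then obtain A k where A: "E = {\<omega> \<in> configurations. card (\<omega> \<inter> A) = k}" "A \<in> sets (borel \<Otimes>\<^sub>M borel)" "bounded A" by auto
    have "\<omega> \<inter> A = \<omega> \<inter> (A \<inter> half_space)" if "\<omega> \<in> configurations" for \<omega>
      using that by (auto simp: configurations_def half_space_def)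
    then have "E = {\<omega> \<in> configurations. card (\<omega> \<inter> (A \<inter> half_space)) = k}" using A(1) by auto
    moreover have "A \<inter> half_space \<in> bounded_half_sets"
      using A by (auto simp: bounded_half_sets_def intro: bounded_subset)
    ultimately show "E \<in> ?R" by blast
  next
    fix E assume "E \<in> ?R"
    then show "E \<in> ?L" by (auto simp: bounded_half_sets_def)
  qed
  then show ?thesis unfolding count_algebra_def by (subst sets_measure_of) auto
qed

lemma subalgebra_count: "subalgebra P count_algebra"
  unfolding subalgebra_def
proof
  show "space count_algebra = space P" by (simp add: space_count_algebra space_P)
  show "sets count_algebra \<subseteq> sets P"
    unfolding sets_count_algebra space_P[symmetric]
  proof (rule sets.sigma_sets_subset, rule subsetI)
    fix E assume "E \<in> {{\<omega> \<in> space P. card (\<omega> \<inter> A) = k} | A k. A \<in> (bounded_half_sets :: (real \<times> 'u) set set)}"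
    then obtain A k where A: "A \<in> bounded_half_sets" "E = {\<omega> \<in> space P. card (\<omega> \<inter> A) = k}" by auto
    have "(\<lambda>\<omega>. card (\<omega> \<inter> A)) -` {k} \<inter> space P \<in> sets P"
      by (rule measurable_sets[OF measurable_card_P[OF A(1)]]) simp
    moreover have "(\<lambda>\<omega>. card (\<omega> \<inter> A)) -` {k} \<inter> space P = E" using A by auto
    ultimately show "E \<in> sets P" by simp
  qed
qed

text \<open>The law restricted to the counts. Explicit generators make it possible to check the
  measurability of the stretchings and to compare transported laws; the null sets of
  \<open>P\<close> are recovered through the completion.\<close>

definition M :: "(real \<times> 'u) set measure" where
  "M = restr_to_subalg P count_algebra"

lemma space_M: "space M = configurations"
  by (simp add: M_def space_restr_to_subalg space_P)

lemma sets_M: "sets M = sets count_algebra"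
  by (simp add: M_def sets_restr_to_subalg[OF subalgebra_count])

lemma emeasure_M: "A \<in> sets M \<Longrightarrow> emeasure M A = emeasure P A"
  unfolding sets_M unfolding M_def by (rule emeasure_restr_to_subalg[OF subalgebra_count])

sublocale M: prob_space M
proof
  show "emeasure M (space M) = 1"
    using emeasure_M[OF sets.top] P.emeasure_space_1 by (simp add: space_M space_P)
qed

lemma measurable_card: "A \<in> bounded_half_sets \<Longrightarrow> (\<lambda>\<omega>. card (\<omega> \<inter> A)) \<in> M \<rightarrow>\<^sub>M count_space UNIV"
proof -
  assume A: "A \<in> bounded_half_sets"
  have "(\<lambda>\<omega>. card (\<omega> \<inter> A)) -` {k} \<inter> space M \<in> sets M" for k
  proof -
    have "(\<lambda>\<omega>. card (\<omega> \<inter> A)) -` {k} \<inter> space M = {\<omega> \<in> configurations. card (\<omega> \<inter> A) = k}" by (auto simp: space_M)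
    then show ?thesis unfolding sets_M sets_count_algebra using A by (auto intro!: sigma_sets.Basic)
  qed
  then show ?thesis by (subst measurable_count_space_eq_countable) auto
qed

section \<open>Cylinder events and their atoms\<close>

definition determined :: "(real \<times> 'u) set set \<Rightarrow> (real \<times> 'u) set set \<Rightarrow> bool" where
  "determined \<B> E \<longleftrightarrow> E \<subseteq> configurations \<and>
     (\<forall>\<omega>\<in>configurations. \<forall>\<omega>'\<in>configurations. (\<forall>B\<in>\<B>. card (\<omega> \<inter> B) = card (\<omega>' \<inter> B)) \<longrightarrow> \<omega> \<in> E \<longrightarrow> \<omega>' \<in> E)"

text \<open>An inequality between measures does not in general pass from an intersection-stable
  generator to the sigma-algebra; \<open>emeasure_le_extend\<close> needs an algebra.\<close>

definition cylinders :: "(real \<times> 'u) set set set" where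
  "cylinders = {E. \<exists>\<B>. finite \<B> \<and> \<B> \<subseteq> bounded_half_sets \<and> determined \<B> E}"

definition atom :: "(real \<times> 'u) set set \<Rightarrow> ((real \<times> 'u) set \<Rightarrow> nat) \<Rightarrow> (real \<times> 'u) set set" where
  "atom \<B> k = {\<omega> \<in> configurations. \<forall>B\<in>\<B>. card (\<omega> \<inter> B) = k B}"

text \<open>The restriction to \<open>\<B>\<close> fixes the values elsewhere, so distinct profiles
  differ on some block and have disjoint atoms, and for finite \<open>\<B>\<close> there are only
  countably many.\<close>

definition profiles :: "(real \<times> 'u) set set \<Rightarrow> (real \<times> 'u) set set \<Rightarrow> ((real \<times> 'u) set \<Rightarrow> nat) set" where
  "profiles \<B> E = (\<lambda>\<omega>. \<lambda>B\<in>\<B>. card (\<omega> \<inter> B)) ` E"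

lemma countable_profiles: "finite \<B> \<Longrightarrow> countable (profiles \<B> E)"
  by (rule countable_subset[OF _ countable_PiE[of \<B> "\<lambda>_. UNIV"]]) (auto simp: profiles_def)

lemma determined_eq_atoms:
  assumes "determined \<B> E"
  shows "E = (\<Union>k\<in>profiles \<B> E. atom \<B> k)"
proof (intro set_eqI iffI)
  fix \<omega> assume "\<omega> \<in> E"
  then show "\<omega> \<in> (\<Union>k\<in>profiles \<B> E. atom \<B> k)"
    using assms by (auto simp: determined_def profiles_def atom_def intro!: bexI[of _ \<omega>])
next
  fix \<omega> assume "\<omega> \<in> (\<Union>k\<in>profiles \<B> E. atom \<B> k)"
  then obtain \<omega>' where "\<omega>' \<in> E" "\<omega> \<in> configurations" "\<forall>B\<in>\<B>. card (\<omega> \<inter> B) = card (\<omega>' \<inter> B)"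
    by (auto simp: profiles_def atom_def)
  then show "\<omega> \<in> E" using assms unfolding determined_def by (metis subsetD)
qed

lemma sets_atom:
  assumes "finite \<B>" "\<B> \<subseteq> bounded_half_sets"
  shows "atom \<B> k \<in> sets M"
proof -
  have "(\<Inter>B\<in>\<B>. (\<lambda>\<omega>. card (\<omega> \<inter> B)) -` {k B} \<inter> space M) \<in> sets M" if "\<B> \<noteq> {}"
    using assms that by (intro sets.finite_INT measurable_sets[OF measurable_card]) auto
  moreover have "atom \<B> k = (\<Inter>B\<in>\<B>. (\<lambda>\<omega>. card (\<omega> \<inter> B)) -` {k B} \<inter> space M)" if "\<B> \<noteq> {}"
    using that by (auto simp: atom_def space_M)
  moreover have "atom {} k = space M" by (simp add: atom_def space_M)
  ultimately show ?thesis by (cases "\<B> = {}") auto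
qed

lemma disjoint_atoms: "disjoint_family_on (atom \<B>) (profiles \<B> E)"
  unfolding disjoint_family_on_def
proof (intro ballI impI)
  fix k l assume k: "k \<in> profiles \<B> E" "l \<in> profiles \<B> E" "k \<noteq> l"
  show "atom \<B> k \<inter> atom \<B> l = {}"
  proof (rule ccontr)
    assume "atom \<B> k \<inter> atom \<B> l \<noteq> {}"
    then obtain \<omega> where "\<forall>B\<in>\<B>. card (\<omega> \<inter> B) = k B \<and> card (\<omega> \<inter> B) = l B" by (auto simp: atom_def)
    then have "\<forall>B\<in>\<B>. k B = l B" by auto
    then have "k = l" using k by (auto simp: profiles_def restrict_def fun_eq_iff)
    then show False using k by simp
  qed
qed

lemma sets_determined:
  assumes "finite \<B>" "\<B> \<subseteq> bounded_half_sets" "determined \<B> E"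
  shows "E \<in> sets M"
  by (subst determined_eq_atoms[OF assms(3)])
    (intro sets.countable_UN' image_subsetI countable_profiles sets_atom assms)

lemma determined_mono: "determined \<B> E \<Longrightarrow> \<B> \<subseteq> \<B>' \<Longrightarrow> determined \<B>' E"
  unfolding determined_def by (meson subsetD)

lemma algebra_cylinders: "algebra configurations cylinders"
  unfolding algebra_iff_Un
proof (intro conjI ballI)
  show "cylinders \<subseteq> Pow configurations" by (auto simp: cylinders_def determined_def)
  show "{} \<in> cylinders" by (auto simp: cylinders_def determined_def)
  fix E assume "E \<in> cylinders"
  then obtain \<B> where \<B>: "finite \<B>" "\<B> \<subseteq> bounded_half_sets" "determined \<B> E" by (auto simp: cylinders_def)
  have "determined \<B> (configurations - E)"
    using \<B>(3) unfolding determined_def by (metis DiffD1 DiffD2 DiffI Diff_subset)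
  then show "configurations - E \<in> cylinders" using \<B> by (auto simp: cylinders_def)
  fix F assume "F \<in> cylinders"
  then obtain \<C> where \<C>: "finite \<C>" "\<C> \<subseteq> bounded_half_sets" "determined \<C> F" by (auto simp: cylinders_def)
  have "determined (\<B> \<union> \<C>) E" "determined (\<B> \<union> \<C>) F" using \<B> \<C> by (auto intro: determined_mono)
  then have "determined (\<B> \<union> \<C>) (E \<union> F)" unfolding determined_def by blast
  then show "E \<union> F \<in> cylinders" using \<B> \<C> by (auto simp: cylinders_def intro!: exI[of _ "\<B> \<union> \<C>"])
qed

lemma sets_M_cylinders: "sets M = sigma_sets configurations cylinders"
proof
  show "sets M \<subseteq> sigma_sets configurations cylinders"
    unfolding sets_M sets_count_algebra
  proof (rule sigma_sets_mono', rule subsetI)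
    fix E assume "E \<in> {{\<omega> \<in> configurations. card (\<omega> \<inter> A) = k} | A k. A \<in> (bounded_half_sets :: (real \<times> 'u) set set)}"
    then obtain A k where A: "A \<in> bounded_half_sets" "E = {\<omega> \<in> configurations. card (\<omega> \<inter> A) = k}" by auto
    then have "determined {A} E" by (auto simp: determined_def)
    then show "E \<in> cylinders" using A unfolding cylinders_def by (intro CollectI exI[of _ "{A}"]) auto
  qed
  have "cylinders \<subseteq> sets M" using sets_determined by (auto simp: cylinders_def)
  then show "sigma_sets configurations cylinders \<subseteq> sets M"
    unfolding space_M[symmetric] by (rule sets.sigma_sets_subset)
qed

end

section \<open>Configurations moved by a map of the half-space\<close>

context poisson_configurations
begin

text \<open>Induction over \<open>W\<close>, starting from rectangles, where the count is an
  indicator in \<open>t\<close> times an ordinary count. Complements are taken inside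
  \<open>B0\<close>, where counts are finite; disjoint unions become countable sums, hence the
  detour through \<open>ennreal\<close>.\<close>

lemma measurable_card_section:
  assumes W: "W \<in> sets (N \<Otimes>\<^sub>M (borel \<Otimes>\<^sub>M borel))" and B0: "B0 \<in> bounded_half_sets"
  shows "(\<lambda>(t, \<omega>). card (\<omega> \<inter> {x \<in> B0. (t, x) \<in> W})) \<in> N \<Otimes>\<^sub>M M \<rightarrow>\<^sub>M count_space UNIV"
proof -
  define F where "F W = (\<lambda>(t, \<omega>). ennreal (card (\<omega> \<inter> {x \<in> B0. (t, x) \<in> W})))" for W :: "('a \<times> real \<times> 'u) set"
  have fin: "finite (\<omega> \<inter> {x \<in> B0. Q x})" if "\<omega> \<in> configurations" for \<omega> Q
    using finite_configuration_Int[OF that B0] by (rule rev_finite_subset) auto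
  let ?X = "borel \<Otimes>\<^sub>M borel :: (real \<times> 'u) measure"
  have "W \<in> sigma_sets (space N \<times> space ?X) {a \<times> b | a b. a \<in> sets N \<and> b \<in> sets ?X}"
    using W by (simp only: sets_pair_measure)
  then have "F W \<in> borel_measurable (N \<Otimes>\<^sub>M M)"
  proof (induct W rule: sigma_sets_induct_disjoint[OF Int_stable_pair_measure_generator pair_measure_closed, consumes 1, case_names basic empty compl union])
    case (basic W)
    then obtain a b where ab: "W = a \<times> b" "a \<in> sets N" "b \<in> sets ?X" by auto
    have "B0 \<inter> b \<in> bounded_half_sets"
      using B0 ab by (auto simp: bounded_half_sets_def intro: bounded_subset)
    note [measurable] = measurable_card[OF this] ab(2)
    have "F W = (\<lambda>(t, \<omega>). indicator a t * ennreal (card (\<omega> \<inter> (B0 \<inter> b))))"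
    proof (rule ext, clarify)
      fix t \<omega>
      have "{x \<in> B0. (t, x) \<in> W} = (if t \<in> a then B0 \<inter> b else {})" by (auto simp: ab)
      then show "F W (t, \<omega>) = indicator a t * ennreal (card (\<omega> \<inter> (B0 \<inter> b)))"
        by (simp add: F_def indicator_def)
    qed
    also have "\<dots> \<in> borel_measurable (N \<Otimes>\<^sub>M M)" by measurable
    finally show ?case .
  next
    case empty
    have "F {} = (\<lambda>_. 0)" by (auto simp: F_def)
    then show ?case by simp
  next
    case (compl W)
    note [measurable] = measurable_card[OF B0] compl(2)
    have "F (space N \<times> space ?X - W) p = (case p of (t, \<omega>) \<Rightarrow> ennreal (card (\<omega> \<inter> B0)) - F W p)" if "p \<in> space (N \<Otimes>\<^sub>M M)" for p
    proof -
      obtain t \<omega> where p: "p = (t, \<omega>)" "t \<in> space N" "\<omega> \<in> configurations"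
        using \<open>p \<in> space _\<close> by (auto simp: space_pair_measure space_M)
      have "\<omega> \<inter> {x \<in> B0. (t, x) \<in> space N \<times> space ?X - W} = (\<omega> \<inter> B0) - (\<omega> \<inter> {x \<in> B0. (t, x) \<in> W})"
        using p(2) by (auto simp: space_pair_measure)
      also have "card \<dots> = card (\<omega> \<inter> B0) - card (\<omega> \<inter> {x \<in> B0. (t, x) \<in> W})"
        by (rule card_Diff_subset[OF fin[OF p(3)]]) auto
      finally have "card (\<omega> \<inter> {x \<in> B0. (t, x) \<in> space N \<times> space ?X - W}) = card (\<omega> \<inter> B0) - card (\<omega> \<inter> {x \<in> B0. (t, x) \<in> W})" .
      moreover have "card (\<omega> \<inter> {x \<in> B0. (t, x) \<in> W}) \<le> card (\<omega> \<inter> B0)"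
        by (rule card_mono) (use finite_configuration_Int[OF p(3) B0] in auto)
      ultimately show ?thesis
        by (simp add: F_def p ennreal_minus of_nat_diff)
    qed
    then have "F (space N \<times> space ?X - W) \<in> borel_measurable (N \<Otimes>\<^sub>M M) \<longleftrightarrow>
      (\<lambda>p. case p of (t, \<omega>) \<Rightarrow> ennreal (card (\<omega> \<inter> B0)) - F W p) \<in> borel_measurable (N \<Otimes>\<^sub>M M)"
      by (intro measurable_cong) auto
    also have "\<dots>" unfolding case_prod_unfold by measurable
    finally show ?case .
  next
    case (union W)
    note [measurable] = union(3)
    have "F (\<Union>i. W i) p = (\<Sum>i. F (W i) p)" if "p \<in> space (N \<Otimes>\<^sub>M M)" for p
    proof -
      obtain t \<omega> where p: "p = (t, \<omega>)" "t \<in> space N" "\<omega> \<in> configurations"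
        using \<open>p \<in> space _\<close> by (auto simp: space_pair_measure space_M)
      have F: "F W (t, \<omega>) = emeasure (count_space UNIV) (\<omega> \<inter> {x \<in> B0. (t, x) \<in> W})" for W
        using fin[OF p(3)] by (simp add: F_def emeasure_count_space_finite ennreal_of_nat_eq_real_of_nat)
      have "(\<Sum>i. F (W i) p) = emeasure (count_space UNIV) (\<Union>i. \<omega> \<inter> {x \<in> B0. (t, x) \<in> W i})"
        unfolding p F by (rule suminf_emeasure) (use union(1) in \<open>auto simp: disjoint_family_on_def\<close>)
      also have "(\<Union>i. \<omega> \<inter> {x \<in> B0. (t, x) \<in> W i}) = \<omega> \<inter> {x \<in> B0. (t, x) \<in> (\<Union>i. W i)}" by auto
      finally show ?thesis unfolding p F by simp
    qed
    then have "F (\<Union>i. W i) \<in> borel_measurable (N \<Otimes>\<^sub>M M) \<longleftrightarrow> (\<lambda>p. \<Sum>i. F (W i) p) \<in> borel_measurable (N \<Otimes>\<^sub>M M)"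
      by (intro measurable_cong) auto
    also have "\<dots>" by measurable
    finally show ?case .
  qed
  then have [measurable]: "F W \<in> borel_measurable (N \<Otimes>\<^sub>M M)" .
  show ?thesis
  proof (subst measurable_count_space_eq_countable, simp, intro conjI ballI)
    fix k :: nat
    have "(\<lambda>(t, \<omega>). card (\<omega> \<inter> {x \<in> B0. (t, x) \<in> W})) -` {k} \<inter> space (N \<Otimes>\<^sub>M M) = {p \<in> space (N \<Otimes>\<^sub>M M). F W p = ennreal k}"
      by (auto simp: F_def)
    also have "\<dots> \<in> sets (N \<Otimes>\<^sub>M M)" by measurable
    finally show "(\<lambda>(t, \<omega>). card (\<omega> \<inter> {x \<in> B0. (t, x) \<in> W})) -` {k} \<inter> space (N \<Otimes>\<^sub>M M) \<in> sets (N \<Otimes>\<^sub>M M)" .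
  qed simp
qed

text \<open>A point whose image falls into a bounded set \<open>B\<close> lies in \<open>K\<close>
  or has not moved, so it belongs to the bounded set \<open>B \<union> K\<close>.\<close>

lemma image_configuration:
  assumes \<omega>: "\<omega> \<in> configurations" and half: "\<And>x. x \<in> half_space \<Longrightarrow> \<Psi> x \<in> half_space"
    and K: "K \<in> bounded_half_sets" and outside: "\<And>x. x \<in> half_space \<Longrightarrow> x \<notin> K \<Longrightarrow> \<Psi> x = x"
  shows "\<Psi> ` \<omega> \<in> configurations"
proof -
  have sub: "\<omega> \<subseteq> half_space" using \<omega> by (simp add: configurations_def half_space_def)
  have "finite (\<Psi> ` \<omega> \<inter> B)" if "bounded B" for B
  proof -
    have "bounded (B \<union> K)" using that K by (simp add: bounded_half_sets_def)
    then have "finite (\<Psi> ` (\<omega> \<inter> (B \<union> K)))" using \<omega> by (simp add: configurations_def)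
    moreover have "\<Psi> ` \<omega> \<inter> B \<subseteq> \<Psi> ` (\<omega> \<inter> (B \<union> K))"
    proof
      fix y assume "y \<in> \<Psi> ` \<omega> \<inter> B"
      then obtain x where x: "x \<in> \<omega>" "y = \<Psi> x" "\<Psi> x \<in> B" by auto
      then have "x \<in> B \<union> K" using outside[of x] sub by (cases "x \<in> K") auto
      then show "y \<in> \<Psi> ` (\<omega> \<inter> (B \<union> K))" using x by auto
    qed
    ultimately show ?thesis by (rule rev_finite_subset)
  qed
  moreover have "\<Psi> ` \<omega> \<subseteq> half_space" using half sub by blast
  ultimately show ?thesis by (simp add: configurations_def half_space_def)
qed

text \<open>Injectivity keeps points from merging, so counts of the image are counts on the
  preimage.\<close>

lemma card_image_Int:
  assumes "\<omega> \<in> configurations" "inj_on \<Psi> half_space"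
  shows "card (\<Psi> ` \<omega> \<inter> A) = card (\<omega> \<inter> {x \<in> half_space. \<Psi> x \<in> A})"
proof -
  have sub: "\<omega> \<subseteq> half_space" using assms(1) by (simp add: configurations_def half_space_def)
  then have "\<Psi> ` \<omega> \<inter> A = \<Psi> ` (\<omega> \<inter> {x \<in> half_space. \<Psi> x \<in> A})" by auto
  also have "card \<dots> = card (\<omega> \<inter> {x \<in> half_space. \<Psi> x \<in> A})"
    by (rule card_image, rule inj_on_subset[OF assms(2)]) auto
  finally show ?thesis .
qed

text \<open>Having \<open>k\<close> image points in \<open>A\<close> means having \<open>k\<close>
  points in the preimage of \<open>A\<close>, which lies in \<open>A \<union> K\<close>.
  Measurability jointly with the parameter is what Fubini along orbits needs.\<close>

lemma measurable_image_configuration: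
  assumes \<Psi>: "(\<lambda>(t, x). \<Psi> t x) \<in> N \<Otimes>\<^sub>M (borel \<Otimes>\<^sub>M borel) \<rightarrow>\<^sub>M borel \<Otimes>\<^sub>M borel"
    and half: "\<And>t x. x \<in> half_space \<Longrightarrow> \<Psi> t x \<in> half_space"
    and inj: "\<And>t. inj_on (\<Psi> t) half_space"
    and K: "K \<in> bounded_half_sets" and outside: "\<And>t x. x \<in> half_space \<Longrightarrow> x \<notin> K \<Longrightarrow> \<Psi> t x = x"
  shows "(\<lambda>(t, \<omega>). \<Psi> t ` \<omega>) \<in> N \<Otimes>\<^sub>M M \<rightarrow>\<^sub>M M"
proof (rule measurable_sigma_sets)
  show "sets M = sigma_sets configurations
     {{\<omega> \<in> configurations. card (\<omega> \<inter> A) = k} | A k. A \<in> bounded_half_sets}"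
    by (simp add: sets_M sets_count_algebra)
  show "(\<lambda>(t, \<omega>). \<Psi> t ` \<omega>) \<in> space (N \<Otimes>\<^sub>M M) \<rightarrow> configurations"
    using image_configuration[OF _ half K outside] by (auto simp: space_pair_measure space_M)
next
  fix E assume "E \<in> {{\<omega> \<in> configurations. card (\<omega> \<inter> A) = k} | A k. A \<in> (bounded_half_sets :: (real \<times> 'u) set set)}"
  then obtain A k where A: "A \<in> bounded_half_sets" "E = {\<omega> \<in> configurations. card (\<omega> \<inter> A) = k}" by auto
  define B0 where "B0 = A \<union> K"
  have B0: "B0 \<in> bounded_half_sets" using A(1) K by (auto simp: B0_def bounded_half_sets_def)
  have Am: "A \<in> sets (borel \<Otimes>\<^sub>M borel)" using A(1) by (simp add: bounded_half_sets_def)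
  define W where "W = (\<lambda>(t, x). \<Psi> t x) -` A \<inter> space (N \<Otimes>\<^sub>M (borel \<Otimes>\<^sub>M borel))"
  have W: "W \<in> sets (N \<Otimes>\<^sub>M (borel \<Otimes>\<^sub>M borel))" unfolding W_def by (rule measurable_sets[OF \<Psi> Am])
  have eq: "{x \<in> half_space. \<Psi> t x \<in> A} = {x \<in> B0. (t, x) \<in> W}" if "t \<in> space N" for t
  proof (intro set_eqI iffI)
    fix x assume x: "x \<in> {x \<in> half_space. \<Psi> t x \<in> A}"
    then have "x \<in> B0" using outside[of x t] by (cases "x \<in> K") (auto simp: B0_def)
    then show "x \<in> {x \<in> B0. (t, x) \<in> W}" using x that by (simp add: W_def space_pair_measure)
  next
    fix x assume "x \<in> {x \<in> B0. (t, x) \<in> W}"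
    then show "x \<in> {x \<in> half_space. \<Psi> t x \<in> A}" using B0 by (auto simp: W_def bounded_half_sets_def)
  qed
  have "(\<lambda>(t, \<omega>). \<Psi> t ` \<omega>) -` E \<inter> space (N \<Otimes>\<^sub>M M) = (\<lambda>(t, \<omega>). card (\<omega> \<inter> {x \<in> B0. (t, x) \<in> W})) -` {k} \<inter> space (N \<Otimes>\<^sub>M M)"
    using image_configuration[OF _ half K outside] card_image_Int[OF _ inj] eq
    by (auto simp: A(2) space_pair_measure space_M)
  also have "\<dots> \<in> sets (N \<Otimes>\<^sub>M M)"
    by (rule measurable_sets[OF measurable_card_section[OF W B0]]) simp
  finally show "(\<lambda>(t, \<omega>). \<Psi> t ` \<omega>) -` E \<inter> space (N \<Otimes>\<^sub>M M) \<in> sets (N \<Otimes>\<^sub>M M)" .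
qed auto

section \<open>Bounds for the transported Poisson law\<close>

lemma poisson_prob_le:
  assumes "0 \<le> l'" "l' \<le> c * l"
  shows "poisson_prob l' k \<le> exp (l - l') * c ^ k * poisson_prob l k"
proof -
  have "l' ^ k \<le> (c * l) ^ k" using assms by (intro power_mono) auto
  then have "exp (- l') * l' ^ k / fact k \<le> exp (- l') * (c * l) ^ k / fact k"
    by (intro divide_right_mono mult_left_mono) auto
  also have "\<dots> = exp (l - l') * c ^ k * (exp (- l) * l ^ k / fact k)"
    by (simp add: exp_diff exp_minus power_mult_distrib field_simps)
  finally show ?thesis by (simp add: poisson_prob_def)
qed

lemma poisson_prob_nonneg: "0 \<le> l \<Longrightarrow> 0 \<le> poisson_prob l k"
  by (simp add: poisson_prob_def)

text \<open>The inequality is checked on the atoms of a finite partition refining \<open>K\<close>, where both sides are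
  products of Poisson probabilities. The exponential factors cancel because \<open>\<Psi>\<close> preserves \<open>K\<close>.\<close>

lemma emeasure_M_quasi:
  assumes bij: "bij_betw \<Psi> half_space half_space"
    and pre: "\<And>A. A \<in> bounded_half_sets \<Longrightarrow> {x \<in> half_space. \<Psi> x \<in> A} \<in> bounded_half_sets"
    and K: "K \<in> bounded_half_sets" and outside: "\<And>x. x \<in> half_space \<Longrightarrow> x \<notin> K \<Longrightarrow> \<Psi> x = x"
    and inv: "\<And>x. x \<in> K \<Longrightarrow> \<Psi> x \<in> K"
    and c: "c \<ge> 0" and le: "\<And>A. A \<in> bounded_half_sets \<Longrightarrow> A \<subseteq> K \<Longrightarrow> \<Lambda> {x \<in> half_space. \<Psi> x \<in> A} \<le> c * \<Lambda> A"
    and meas[measurable]: "(\<lambda>\<omega>. \<Psi> ` \<omega>) \<in> M \<rightarrow>\<^sub>M M"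
    and E: "E \<in> sets M"
  shows "emeasure M {\<omega> \<in> configurations. card (\<omega> \<inter> K) = n \<and> \<Psi> ` \<omega> \<in> E}
    \<le> ennreal (c ^ n) * emeasure M (E \<inter> {\<omega> \<in> configurations. card (\<omega> \<inter> K) = n})"
proof -
  define pb where "pb A = {x \<in> half_space. \<Psi> x \<in> A}" for A
  define On where "On = {\<omega> \<in> configurations. card (\<omega> \<inter> K) = n}"
  have inj: "inj_on \<Psi> half_space" and half: "\<And>x. x \<in> half_space \<Longrightarrow> \<Psi> x \<in> half_space"
    using bij by (auto simp: bij_betw_def)
  have conf: "\<Psi> ` \<omega> \<in> configurations" if "\<omega> \<in> configurations" for \<omega>
    using image_configuration[OF that half K outside] .
  have card_pb: "card (\<Psi> ` \<omega> \<inter> A) = card (\<omega> \<inter> pb A)" if "\<omega> \<in> configurations" for \<omega> A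
    unfolding pb_def using that inj by (rule card_image_Int)
  have Khalf: "K \<subseteq> half_space" using K by (simp add: bounded_half_sets_def)
  \<comment> \<open>Points outside \<open>K\<close> do not move, so none enters \<open>K\<close>; by
    \<open>inv\<close> none leaves it.\<close>
  have pbK: "pb K = K"
    using inv outside Khalf unfolding pb_def by (auto, metis)
  have \<Lambda>0: "\<Lambda> A \<ge> 0" for A by (simp add: \<Lambda>_def)
  have On_sets[measurable]: "On \<in> sets M"
    using sets_atom[of "{K}" "\<lambda>_. n"] K by (simp add: atom_def On_def)
  have On_iff: "\<Psi> ` \<omega> \<in> On \<longleftrightarrow> \<omega> \<in> On" if "\<omega> \<in> configurations" for \<omega>
    using that conf card_pb[OF that, of K] by (simp add: On_def pbK)
  have cyl: "emeasure M {\<omega> \<in> On. \<Psi> ` \<omega> \<in> F} \<le> ennreal (c ^ n) * emeasure M (F \<inter> On)" if F: "F \<in> cylinders" for F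
  proof -
    obtain \<A> where \<A>: "finite \<A>" "\<A> \<subseteq> bounded_half_sets" "determined \<A> F" using F by (auto simp: cylinders_def)
    \<comment> \<open>\<open>K\<close> is refined together with the sets determining
      \<open>F\<close>, so that each block lies inside \<open>K\<close> or in the region where
      nothing moves.\<close>
    have "\<exists>\<B>. finite \<B> \<and> \<B> \<subseteq> bounded_half_sets \<and> disjoint \<B> \<and> {} \<notin> \<B> \<and> \<Union>\<B> = \<Union>(insert K \<A>) \<and>
        (\<forall>B\<in>\<B>. \<forall>A\<in>insert K \<A>. B \<subseteq> A \<or> B \<inter> A = {})"
      by (rule disjoint_refinement[OF bounded_half_sets_Int_Diff]) (use \<A> K in auto)
    then obtain \<B> where \<B>0: "finite \<B>" "\<B> \<subseteq> bounded_half_sets" "disjoint \<B>" "{} \<notin> \<B>" "\<Union>\<B> = \<Union>(insert K \<A>)"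
      "\<forall>B\<in>\<B>. \<forall>A\<in>insert K \<A>. B \<subseteq> A \<or> B \<inter> A = {}"
      by (elim exE conjE) (rule that)
    note \<B> = \<B>0(1-5) \<B>0(6)[rule_format]
    have un: "A = \<Union>{B \<in> \<B>. B \<subseteq> A}" if "A \<in> insert K \<A>" for A
    proof -
      have "A \<subseteq> \<Union>\<B>" using that \<B>(5) by blast
      then show ?thesis using \<B>(6)[OF _ that] by blast
    qed
    have card_un: "card (\<omega> \<inter> A) = (\<Sum>B\<in>{B \<in> \<B>. B \<subseteq> A}. card (\<omega> \<inter> B))"
      if "A \<in> insert K \<A>" "\<omega> \<in> configurations" for A \<omega>
    proof -
      have "card (\<omega> \<inter> \<Union>{B \<in> \<B>. B \<subseteq> A}) = (\<Sum>B\<in>{B \<in> \<B>. B \<subseteq> A}. card (\<omega> \<inter> B))"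
        by (rule card_configuration_Union[OF that(2)]) (use \<B> in \<open>auto simp: disjoint_def\<close>)
      then show ?thesis using un[OF that(1)] by simp
    qed
    have det: "determined \<B> (F \<inter> On)"
      unfolding determined_def
    proof (intro conjI ballI impI)
      show "F \<inter> On \<subseteq> configurations" by (auto simp: On_def)
      fix \<omega> \<omega>' assume w: "\<omega> \<in> configurations" "\<omega>' \<in> configurations" "\<forall>B\<in>\<B>. card (\<omega> \<inter> B) = card (\<omega>' \<inter> B)" "\<omega> \<in> F \<inter> On"
      have eq: "card (\<omega> \<inter> A) = card (\<omega>' \<inter> A)" if "A \<in> insert K \<A>" for A
        unfolding card_un[OF that w(1)] card_un[OF that w(2)] using w(3) by (intro sum.cong) auto
      have "\<omega>' \<in> F" using \<A>(3) w eq unfolding determined_def by blast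
      moreover have "\<omega>' \<in> On" using w eq[of K] by (simp add: On_def)
      ultimately show "\<omega>' \<in> F \<inter> On" by simp
    qed
    define I where "I = profiles \<B> (F \<inter> On)"
    have cI: "countable I" unfolding I_def by (rule countable_profiles[OF \<B>(1)])
    have FO: "F \<inter> On = (\<Union>k\<in>I. atom \<B> k)" unfolding I_def by (rule determined_eq_atoms[OF det])
    define at' where "at' k = {\<omega> \<in> configurations. \<Psi> ` \<omega> \<in> atom \<B> k}" for k
    have at'_sets: "at' k \<in> sets M" for k
    proof -
      have "at' k = (\<lambda>\<omega>. \<Psi> ` \<omega>) -` atom \<B> k \<inter> space M" by (auto simp: at'_def space_M)
      then show ?thesis using measurable_sets[OF meas sets_atom[OF \<B>(1,2)]] by simp
    qed
    have pre_eq: "{\<omega> \<in> On. \<Psi> ` \<omega> \<in> F} = (\<Union>k\<in>I. at' k)"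
    proof -
      have "{\<omega> \<in> On. \<Psi> ` \<omega> \<in> F} = {\<omega> \<in> configurations. \<Psi> ` \<omega> \<in> F \<inter> On}"
        using On_iff by (auto simp: On_def)
      then show ?thesis unfolding FO by (auto simp: at'_def)
    qed
    have disj': "disjoint_family_on at' I"
      using disjoint_atoms[of \<B> "F \<inter> On"] unfolding disjoint_family_on_def at'_def I_def by blast
    have pb_bhs: "pb B \<in> bounded_half_sets" if "B \<in> \<B>" for B unfolding pb_def using pre that \<B>(2) by auto
    have pb_out: "pb B = B" if B: "B \<in> \<B>" "B \<inter> K = {}" for B
    proof (intro set_eqI iffI)
      fix x assume "x \<in> pb B"
      then have x: "x \<in> half_space" "\<Psi> x \<in> B" by (auto simp: pb_def)
      have "x \<notin> K" using inv[of x] x B by blast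
      then show "x \<in> B" using outside[OF x(1)] x by simp
    next
      fix x assume x: "x \<in> B"
      have "x \<in> half_space" "x \<notin> K" using x B \<B>(2) by (auto simp: bounded_half_sets_def)
      then show "x \<in> pb B" using outside x by (simp add: pb_def)
    qed
    \<comment> \<open>Disjoint nonempty blocks have different preimages because
      \<open>\<Psi>\<close> maps onto the half-space. This lets the counts be reindexed by the
      preimages.\<close>
    have inj_pb: "inj_on pb \<B>"
    proof (rule inj_onI, rule ccontr)
      fix B C assume BC: "B \<in> \<B>" "C \<in> \<B>" "pb B = pb C" "B \<noteq> C"
      then have "B \<inter> C = {}" using \<B>(3) by (auto simp: disjoint_def)
      moreover obtain y where y: "y \<in> B" using \<B>(4) BC(1) by (metis ex_in_conv)
      moreover have "y \<in> half_space" using y BC(1) \<B>(2) by (auto simp: bounded_half_sets_def)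
      then have "y \<in> \<Psi> ` half_space" using bij by (simp add: bij_betw_def)
      then obtain x where "y = \<Psi> x" "x \<in> half_space" by (rule imageE)
      ultimately show False using BC(3) by (auto simp: pb_def)
    qed
    have disj_pb: "disjoint (pb ` \<B>)"
    proof (rule disjointI)
      fix X Y assume "X \<in> pb ` \<B>" "Y \<in> pb ` \<B>" "X \<noteq> Y"
      then obtain B C where BC: "B \<in> \<B>" "C \<in> \<B>" "X = pb B" "Y = pb C" "B \<noteq> C" by auto
      then have "B \<inter> C = {}" using \<B>(3) by (auto simp: disjoint_def)
      then show "X \<inter> Y = {}" using BC by (auto simp: pb_def)
    qed
    have main: "emeasure M (at' k) \<le> ennreal (c ^ n) * emeasure M (atom \<B> k)" if k: "k \<in> I" for k
    proof -
      define k' where "k' C = k (the_inv_into \<B> pb C)" for C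
      have k': "k' (pb B) = k B" if "B \<in> \<B>" for B
        using that inj_pb by (simp add: k'_def the_inv_into_f_f)
      have "at' k = {\<omega> \<in> configurations. \<forall>C\<in>pb ` \<B>. card (\<omega> \<inter> C) = k' C}"
        using conf card_pb k' by (auto simp: at'_def atom_def)
      then have "P.prob (at' k) = (\<Prod>C\<in>pb ` \<B>. poisson_prob (\<Lambda> C) (k' C))"
        using prob_cards[of "pb ` \<B>" k'] \<B>(1) pb_bhs disj_pb by auto
      also have "\<dots> = (\<Prod>B\<in>\<B>. poisson_prob (\<Lambda> (pb B)) (k B))"
        by (subst prod.reindex[OF inj_pb]) (auto simp: k')
      \<comment> \<open>Blocks outside \<open>K\<close> equal their preimages and cost nothing; a
        block inside \<open>K\<close> holding \<open>k B\<close> points costs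
        \<open>c ^ k B\<close>.\<close>
      also have "\<dots> \<le> (\<Prod>B\<in>\<B>. exp (\<Lambda> B - \<Lambda> (pb B)) * (if B \<subseteq> K then c ^ k B else 1) * poisson_prob (\<Lambda> B) (k B))"
      proof (rule prod_mono, intro conjI)
        fix B assume B: "B \<in> \<B>"
        show "0 \<le> poisson_prob (\<Lambda> (pb B)) (k B)" by (rule poisson_prob_nonneg[OF \<Lambda>0])
        show "poisson_prob (\<Lambda> (pb B)) (k B) \<le> exp (\<Lambda> B - \<Lambda> (pb B)) * (if B \<subseteq> K then c ^ k B else 1) * poisson_prob (\<Lambda> B) (k B)"
        proof (cases "B \<subseteq> K")
          case True
          have "\<Lambda> (pb B) \<le> c * \<Lambda> B" unfolding pb_def using le[OF _ True] B \<B>(2) by auto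
          then show ?thesis using poisson_prob_le[OF \<Lambda>0] True by simp
        next
          case False
          then have BK: "B \<inter> K = {}" using \<B>(6)[OF B, of K] by auto
          have "pb B = B" by (rule pb_out[OF B BK])
          then show ?thesis using False by simp
        qed
      qed
      also have "\<dots> = (\<Prod>B\<in>\<B>. exp (\<Lambda> B - \<Lambda> (pb B))) * (\<Prod>B\<in>\<B>. if B \<subseteq> K then c ^ k B else 1) * (\<Prod>B\<in>\<B>. poisson_prob (\<Lambda> B) (k B))"
        by (simp add: prod.distrib)
      also have "(\<Prod>B\<in>\<B>. exp (\<Lambda> B - \<Lambda> (pb B))) = 1"
      proof -
        let ?BK = "{B \<in> \<B>. B \<subseteq> K}"
        have fK: "finite ?BK" using \<B>(1) by simp
        have "(\<Sum>B\<in>\<B>. \<Lambda> B - \<Lambda> (pb B)) = (\<Sum>B\<in>?BK. \<Lambda> B - \<Lambda> (pb B))"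
        proof (rule sum.mono_neutral_right[OF \<B>(1)])
          show "\<forall>B\<in>\<B> - ?BK. \<Lambda> B - \<Lambda> (pb B) = 0"
          proof
            fix B assume "B \<in> \<B> - ?BK"
            then have B: "B \<in> \<B>" "B \<inter> K = {}" using \<B>(6)[of B K] by auto
            have "pb B = B" by (rule pb_out[OF B])
            then show "\<Lambda> B - \<Lambda> (pb B) = 0" by simp
          qed
        qed auto
        also have "\<dots> = (\<Sum>B\<in>?BK. \<Lambda> B) - (\<Sum>B\<in>?BK. \<Lambda> (pb B))" by (rule sum_subtractf)
        also have "(\<Sum>B\<in>?BK. \<Lambda> B) = \<Lambda> (\<Union>B\<in>?BK. B)"
          by (rule \<Lambda>_Union[OF fK, symmetric]) (use \<B> in \<open>auto simp: disjoint_family_on_def disjoint_def\<close>)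
        also have "(\<Union>B\<in>?BK. B) = K" using un[of K] by simp
        also have "(\<Sum>B\<in>?BK. \<Lambda> (pb B)) = \<Lambda> (\<Union>B\<in>?BK. pb B)"
        proof (rule \<Lambda>_Union[OF fK, symmetric])
          show "disjoint_family_on pb ?BK"
            using \<B>(3) by (auto simp: disjoint_family_on_def disjoint_def pb_def)
        qed (use pb_bhs in auto)
        also have "(\<Union>B\<in>?BK. pb B) = pb (\<Union>?BK)" by (auto simp: pb_def)
        also have "\<dots> = K" using un[of K] pbK by simp
        finally show ?thesis using \<B>(1) by (simp add: exp_sum[symmetric])
      qed
      also have "(\<Prod>B\<in>\<B>. if B \<subseteq> K then c ^ k B else 1) = c ^ n"
      proof -
        have "(\<Prod>B\<in>\<B>. if B \<subseteq> K then c ^ k B else 1) = (\<Prod>B\<in>{B \<in> \<B>. B \<subseteq> K}. c ^ k B)"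
          using \<B>(1) by (simp add: prod.inter_filter)
        also have "\<dots> = c ^ (\<Sum>B\<in>{B \<in> \<B>. B \<subseteq> K}. k B)" by (simp add: power_sum)
        \<comment> \<open>\<open>k\<close> is the profile of a configuration in \<open>On\<close>,
          and the blocks inside \<open>K\<close> partition \<open>K\<close>.\<close>
        also have "(\<Sum>B\<in>{B \<in> \<B>. B \<subseteq> K}. k B) = n"
        proof -
          obtain \<omega> where \<omega>: "\<omega> \<in> F \<inter> On" "k = (\<lambda>B\<in>\<B>. card (\<omega> \<inter> B))" using k by (auto simp: I_def profiles_def)
          have wc: "\<omega> \<in> configurations" "card (\<omega> \<inter> K) = n" using \<omega>(1) by (auto simp: On_def)
          have "(\<Sum>B\<in>{B \<in> \<B>. B \<subseteq> K}. k B) = (\<Sum>B\<in>{B \<in> \<B>. B \<subseteq> K}. card (\<omega> \<inter> B))"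
            by (rule sum.cong) (auto simp: \<omega>(2))
          also have "\<dots> = n" using card_un[of K \<omega>] wc by simp
          finally show ?thesis .
        qed
        finally show ?thesis .
      qed
      also have "(\<Prod>B\<in>\<B>. poisson_prob (\<Lambda> B) (k B)) = P.prob (atom \<B> k)"
        unfolding atom_def using prob_cards[OF \<B>(1,2,3), of k] by simp
      finally have "P.prob (at' k) \<le> c ^ n * P.prob (atom \<B> k)" by simp
      then have "ennreal (P.prob (at' k)) \<le> ennreal (c ^ n) * ennreal (P.prob (atom \<B> k))"
        using c by (subst ennreal_mult[symmetric]) (auto intro: ennreal_leI)
      then show ?thesis
        using emeasure_M[OF at'_sets] emeasure_M[OF sets_atom[OF \<B>(1,2)]] by (simp add: P.emeasure_eq_measure)
    qed
    have "emeasure M {\<omega> \<in> On. \<Psi> ` \<omega> \<in> F} = (\<integral>\<^sup>+k. emeasure M (at' k) \<partial>count_space I)"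
      unfolding pre_eq by (rule emeasure_UN_countable[OF at'_sets cI disj'])
    also have "\<dots> \<le> (\<integral>\<^sup>+k. ennreal (c ^ n) * emeasure M (atom \<B> k) \<partial>count_space I)"
      by (rule nn_integral_mono) (use main in simp)
    also have "\<dots> = ennreal (c ^ n) * (\<integral>\<^sup>+k. emeasure M (atom \<B> k) \<partial>count_space I)"
      by (rule nn_integral_cmult) simp
    also have "(\<integral>\<^sup>+k. emeasure M (atom \<B> k) \<partial>count_space I) = emeasure M (F \<inter> On)"
      unfolding FO by (rule emeasure_UN_countable[symmetric, OF sets_atom[OF \<B>(1,2)] cI]) (simp add: I_def disjoint_atoms)
    finally show ?thesis .
  qed
  \<comment> \<open>Restriction to \<open>On\<close> turns the bound on cylinders into an inequality
    between two finite measures, the form that extends to the sigma-algebra.\<close>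
  define R where "R = density M (indicator On)"
  have [measurable_cong, simp]: "sets R = sets M" and [simp]: "space R = space M" by (simp_all add: R_def)
  have Rem: "emeasure R A = emeasure M (A \<inter> On)" if "A \<in> sets M" for A
    using that by (simp add: R_def emeasure_restricted Int_commute)
  have D: "emeasure (distr R M (\<lambda>\<omega>. \<Psi> ` \<omega>)) A = emeasure M {\<omega> \<in> On. \<Psi> ` \<omega> \<in> A}" if A: "A \<in> sets M" for A
  proof -
    have "emeasure (distr R M (\<lambda>\<omega>. \<Psi> ` \<omega>)) A = emeasure M ((\<lambda>\<omega>. \<Psi> ` \<omega>) -` A \<inter> space M \<inter> On)"
      using A by (subst emeasure_distr) (auto simp: Rem measurable_sets[OF meas])
    also have "(\<lambda>\<omega>. \<Psi> ` \<omega>) -` A \<inter> space M \<inter> On = {\<omega> \<in> On. \<Psi> ` \<omega> \<in> A}"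
      by (auto simp: On_def space_M)
    finally show ?thesis .
  qed
  have "emeasure (distr R M (\<lambda>\<omega>. \<Psi> ` \<omega>)) E \<le> emeasure (scale_measure (ennreal (c ^ n)) R) E"
  proof (rule emeasure_le_extend[OF algebra_cylinders])
    show "sets (distr R M (\<lambda>\<omega>. \<Psi> ` \<omega>)) = sigma_sets configurations cylinders"
      "sets (scale_measure (ennreal (c ^ n)) R) = sigma_sets configurations cylinders"
      by (simp_all add: sets_M_cylinders)
    show "E \<in> sigma_sets configurations cylinders" using E by (simp add: sets_M_cylinders)
    have fR: "emeasure R (space M) < \<infinity>" using Rem[of "space M"] M.emeasure_finite by (simp add: less_top[symmetric])
    show "finite_measure (scale_measure (ennreal (c ^ n)) R)"
      by (rule finite_measureI) (use fR in \<open>simp add: ennreal_mult_eq_top_iff space_scale_measure\<close>)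
    show "finite_measure (distr R M (\<lambda>\<omega>. \<Psi> ` \<omega>))"
      by (rule finite_measureI) (simp add: D)
    fix A assume A: "A \<in> cylinders"
    then have "A \<in> sets M" using sets_M_cylinders by auto
    then show "emeasure (distr R M (\<lambda>\<omega>. \<Psi> ` \<omega>)) A \<le> emeasure (scale_measure (ennreal (c ^ n)) R) A"
      using cyl[OF A] by (simp add: D Rem)
  qed
  then have "emeasure M {\<omega> \<in> On. \<Psi> ` \<omega> \<in> E} \<le> ennreal (c ^ n) * emeasure M (E \<inter> On)"
    using E by (simp add: D Rem)
  moreover have "{\<omega> \<in> On. \<Psi> ` \<omega> \<in> E} = {\<omega> \<in> configurations. card (\<omega> \<inter> K) = n \<and> \<Psi> ` \<omega> \<in> E}"
    by (auto simp: On_def)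
  ultimately show ?thesis by (simp add: On_def)
qed

end

section \<open>Absolute continuity\<close>

context poisson_configurations
begin

section \<open>Passing between the full law and the law of the counts\<close>

lemma sets_P_completion: "sets P \<subseteq> sets (completion M)"
  using law unfolding poisson_law_def M_def by (elim conjE)

text \<open>A set in the completion is a set of \<open>M\<close> joined with a subset of an
  \<open>M\<close>-null set. The former lies inside \<open>N\<close>, so it is null for
  \<open>P\<close> and hence for \<open>M\<close>.\<close>

lemma null_sets_P_M:
  assumes "N \<in> null_sets P"
  shows "\<exists>N'\<in>null_sets M. N \<subseteq> N'"
proof -
  have "N \<in> sets (completion M)" using assms sets_P_completion by auto
  then obtain S N1 N2 where N: "N = S \<union> N1" "N1 \<subseteq> N2" "N2 \<in> null_sets M" "S \<in> sets M"
    by (rule sets_completionE)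
  have "S \<in> sets P" using N(4) subalgebra_count by (auto simp: sets_M subalgebra_def)
  then have "emeasure P S \<le> emeasure P N" using assms N(1) by (intro emeasure_mono) auto
  then have "emeasure M S = 0" using assms emeasure_M[OF N(4)] by auto
  then have "S \<union> N2 \<in> null_sets M" using N by auto
  then show ?thesis using N by (intro bexI[of _ "S \<union> N2"]) auto
qed

lemma AE_P_iff_AE_M: "(AE \<omega> in P. Q \<omega>) \<longleftrightarrow> (AE \<omega> in M. Q \<omega>)"
proof
  assume "AE \<omega> in P. Q \<omega>"
  then obtain N where N: "N \<in> null_sets P" "{\<omega> \<in> space P. \<not> Q \<omega>} \<subseteq> N" by (auto simp: eventually_ae_filter)
  obtain N' where "N' \<in> null_sets M" "N \<subseteq> N'" using null_sets_P_M[OF N(1)] by blast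
  then show "AE \<omega> in M. Q \<omega>" using N(2) by (intro AE_I'[of N']) (auto simp: space_M space_P)
next
  assume "AE \<omega> in M. Q \<omega>"
  then obtain N where N: "N \<in> null_sets M" "{\<omega> \<in> space M. \<not> Q \<omega>} \<subseteq> N" by (auto simp: eventually_ae_filter)
  then have "N \<in> null_sets P"
    using null_sets_restr_to_subalg[OF subalgebra_count] by (simp add: M_def)
  then show "AE \<omega> in P. Q \<omega>" using N(2) by (intro AE_I'[of N]) (auto simp: space_M space_P)
qed

lemma ex_M_version:
  fixes f :: "(real \<times> 'u) set \<Rightarrow> real"
  assumes "f \<in> borel_measurable P"
  shows "\<exists>f'\<in>borel_measurable M. AE \<omega> in M. f \<omega> = f' \<omega>"
proof (rule completion_ex_borel_measurable_real)
  show "f \<in> borel_measurable (completion M)"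
    using assms sets_P_completion unfolding measurable_def by (auto simp: space_M space_P)
qed

text \<open>Admits integrands of unknown measurability, such as the difference quotients in
  \<open>has_Lp_derivative\<close>: the nonnegative integral sees \<open>u\<close> only up to null
  sets, and \<open>v\<close> is measurable.\<close>

lemma nn_integral_P_eq_M:
  assumes "AE \<omega> in M. u \<omega> = v \<omega>" "v \<in> borel_measurable M"
  shows "(\<integral>\<^sup>+\<omega>. u \<omega> \<partial>P) = (\<integral>\<^sup>+\<omega>. v \<omega> \<partial>M)"
proof -
  have "(\<integral>\<^sup>+\<omega>. u \<omega> \<partial>P) = (\<integral>\<^sup>+\<omega>. v \<omega> \<partial>P)"
    using assms(1) by (intro nn_integral_cong_AE) (simp add: AE_P_iff_AE_M)
  also have "\<dots> = (\<integral>\<^sup>+\<omega>. v \<omega> \<partial>M)"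
    unfolding M_def using assms(2) measurable_cong_sets[OF sets_M refl]
    by (intro nn_integral_subalgebra2[OF subalgebra_count, symmetric]) auto
  finally show ?thesis .
qed

text \<open>In the coordinate \<open>\<rho> i\<close>, direction \<open>i\<close> translates the
  times in cell \<open>i\<close>. The cells are disjoint, so every point can follow the coordinate
  belonging to its own cell, and all directions combine into one action of \<open>real^'m\<close>. A
  direction with \<open>a i \<ge> b i\<close> has an empty cell and acts as the identity.\<close>

lemma grid_action:
  fixes a b :: "'m::finite \<Rightarrow> real" and \<Gamma> :: "'m \<Rightarrow> 'u set"
  assumes grid: "differential_grid a b h \<Gamma>"
  obtains T Om C where "quasi_invariant_action M T Om C"
    "\<And>i e \<omega>. \<omega> \<in> configurations \<Longrightarrow> config_stretch (\<lambda>t. e * h i t) (\<Gamma> i) \<omega> = T (axis i e :: real^'m) \<omega>"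
proof -
  have sub: "{a i..<b i} \<subseteq> {0..}" and h: "h i \<in> H0" and \<Gamma>: "\<Gamma> i \<in> bounded_borel"
    and pos: "\<And>t. t \<in> {a i<..<b i} \<Longrightarrow> J (h i) t > 0"
    and zero: "\<And>t. t \<in> {0..} - {a i<..<b i} \<Longrightarrow> J (h i) t = 0" for i
    using grid unfolding differential_grid_def by blast+
  have a0: "0 \<le> a i" if "a i < b i" for i using sub[of i] that by auto
  \<comment> \<open>The flow-box properties are asked for only if the interval is nonempty, so that
    one choice covers all directions; the zero functions serve as default.\<close>
  define box where "box i \<rho> \<psi> L \<longleftrightarrow> \<rho> \<in> borel_measurable borel \<and> \<psi> \<in> borel_measurable borel \<and> L \<ge> 0 \<and>
     (a i < b i \<longrightarrow> (\<forall>r. \<psi> r \<in> {a i<..<b i}) \<and> (\<forall>r. \<rho> (\<psi> r) = r) \<and> (\<forall>x\<in>{a i<..<b i}. \<psi> (\<rho> x) = x) \<and>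
       (\<forall>x\<in>{a i<..<b i}. \<forall>e. time_stretch (\<lambda>t. - (e * h i t)) x = \<psi> (\<rho> x - e)) \<and>
       (\<forall>A\<in>sets borel. \<forall>t. emeasure lborel {x \<in> {a i<..<b i}. \<psi> (\<rho> x - t) \<in> A}
          \<le> ennreal (exp (L * \<bar>t\<bar>)) * emeasure lborel (A \<inter> {a i<..<b i})))"
    for i and \<rho> \<psi> :: "real \<Rightarrow> real" and L :: real
  have "\<exists>\<rho> \<psi> L. box i \<rho> \<psi> L" for i
  proof (cases "a i < b i")
    case True
    obtain \<rho> \<psi> L where "\<rho> \<in> borel_measurable borel" "\<psi> \<in> borel_measurable borel" "(L::real) \<ge> 0"
      "\<And>r. \<psi> r \<in> {a i<..<b i}" "\<And>r. \<rho> (\<psi> r) = r" "\<And>x. x \<in> {a i<..<b i} \<Longrightarrow> \<psi> (\<rho> x) = x"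
      "\<And>x e. x \<in> {a i<..<b i} \<Longrightarrow> time_stretch (\<lambda>t. - (e * h i t)) x = \<psi> (\<rho> x - e)"
      "\<And>A t. A \<in> sets borel \<Longrightarrow>
        emeasure lborel {x \<in> {a i<..<b i}. \<psi> (\<rho> x - t) \<in> A} \<le> ennreal (exp (L * \<bar>t\<bar>)) * emeasure lborel (A \<inter> {a i<..<b i})"
      by (rule time_stretch_flow_box[OF h[of i] a0[OF True] True], erule pos, erule zero, rule that)
    then have "box i \<rho> \<psi> L" by (simp add: box_def)
    then show ?thesis by blast
  next
    case False
    then have "box i (\<lambda>_. 0) (\<lambda>_. 0) 0" by (simp add: box_def)
    then show ?thesis by blast
  qed
  then obtain \<rho> \<psi> L where box: "\<And>i. box i (\<rho> i) (\<psi> i) (L i)" by metis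
  have [measurable]: "\<rho> i \<in> borel_measurable borel" "\<psi> i \<in> borel_measurable borel" and L0: "L i \<ge> 0" for i
    using box[of i] by (auto simp: box_def)
  \<comment> \<open>The open interval is taken since \<open>J (h i)\<close> vanishes at
    \<open>a i\<close>: points with that time stay fixed.\<close>
  define cell where "cell i = {a i<..<b i} \<times> \<Gamma> i" for i
  have cell_ab: "a i < b i" if "x \<in> cell i" for x i using that by (auto simp: cell_def)
  have \<psi>\<rho>: "\<psi> i r \<in> {a i<..<b i}" "\<rho> i (\<psi> i r) = r" if "a i < b i" for i r
    using box[of i] that by (simp_all add: box_def)
  have \<rho>\<psi>: "\<psi> i (\<rho> i x) = x" "time_stretch (\<lambda>t. - (e * h i t)) x = \<psi> i (\<rho> i x - e)" if "x \<in> {a i<..<b i}" for i x e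
    using box[of i] that by (simp_all add: box_def)
  have emle: "emeasure lborel {x \<in> {a i<..<b i}. \<psi> i (\<rho> i x - t) \<in> A} \<le> ennreal (exp (L i * \<bar>t\<bar>)) * emeasure lborel (A \<inter> {a i<..<b i})"
    if "A \<in> sets borel" for A t i
    using box[of i] that by (cases "a i < b i") (simp_all add: box_def)
  have disj: "i = j" if "x \<in> cell i" "x \<in> cell j" for x i j
  proof (rule ccontr)
    assume "i \<noteq> j"
    then have "({a i..<b i} \<times> \<Gamma> i) \<inter> ({a j..<b j} \<times> \<Gamma> j) = {}"
      using grid unfolding differential_grid_def disjoint_family_on_def by blast
    moreover have "x \<in> {a i..<b i} \<times> \<Gamma> i" "x \<in> {a j..<b j} \<times> \<Gamma> j" using that by (auto simp: cell_def)
    ultimately show False by blast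
  qed
  have \<Gamma>m[measurable]: "\<Gamma> i \<in> sets borel" and \<Gamma>b: "bounded (\<Gamma> i)" for i using \<Gamma>[of i] by (auto simp: bounded_borel_def)
  have cell_bhs: "cell i \<in> bounded_half_sets" for i
  proof -
    have "cell i \<in> sets (borel \<Otimes>\<^sub>M borel)" unfolding cell_def by (intro pair_measureI) auto
    moreover have "bounded (cell i)" unfolding cell_def by (intro bounded_Times \<Gamma>b) simp
    moreover have "cell i \<subseteq> half_space" using a0[of i] by (auto simp: cell_def half_space_def)
    ultimately show ?thesis by (simp add: bounded_half_sets_def)
  qed
  have cell_m[measurable]: "cell i \<in> sets (borel \<Otimes>\<^sub>M borel)" for i using cell_bhs[of i] by (simp add: bounded_half_sets_def)
  define K where "K = (\<Union>i. cell i)"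
  have K: "K \<in> bounded_half_sets"
    using cell_bhs by (auto simp: K_def bounded_half_sets_def)
  \<comment> \<open>At most one indicator is nonzero, so the sum selects the cell of
    \<open>x\<close>, if any. In this form the map is visibly measurable jointly in \<open>t\<close>
    and \<open>x\<close>.\<close>
  define \<Psi> where "\<Psi> t x = (fst x + (\<Sum>i\<in>UNIV. indicator (cell i) x * (\<psi> i (\<rho> i (fst x) - t $ i) - fst x)), snd x)"
    for t :: "real^'m" and x :: "real \<times> 'u"
  have \<Psi>_in: "\<Psi> t x = (\<psi> i (\<rho> i (fst x) - t $ i), snd x)" if x: "x \<in> cell i" for t x i
  proof -
    have "indicator (cell j) x * (\<psi> j (\<rho> j (fst x) - t $ j) - fst x) = (if j = i then \<psi> i (\<rho> i (fst x) - t $ i) - fst x else 0)" for j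
    proof (cases "j = i")
      case False
      then have "x \<notin> cell j" using disj[OF x, of j] by blast
      then show ?thesis using False by simp
    qed (use x in simp)
    then show ?thesis by (simp add: \<Psi>_def)
  qed
  have \<Psi>_out: "\<Psi> t x = x" if "x \<notin> K" for t x
  proof -
    have "indicator (cell i) x = (0::real)" for i using that by (auto simp: K_def)
    then show ?thesis by (simp add: \<Psi>_def)
  qed
  have \<Psi>_cell: "\<Psi> t x \<in> cell i" if "x \<in> cell i" for t x i
    using that \<psi>\<rho>(1)[OF cell_ab[OF that]] unfolding \<Psi>_in[OF that] by (auto simp: cell_def)
  have \<Psi>_K: "\<Psi> t x \<in> K" if "x \<in> K" for t x using that \<Psi>_cell unfolding K_def by blast
  have \<Psi>_add: "\<Psi> s (\<Psi> t x) = \<Psi> (s + t) x" for s t x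
  proof (cases "x \<in> K")
    case True
    then obtain i where x: "x \<in> cell i" by (auto simp: K_def)
    have "\<Psi> s (\<Psi> t x) = (\<psi> i (\<rho> i (fst (\<Psi> t x)) - s $ i), snd (\<Psi> t x))"
      by (rule \<Psi>_in[OF \<Psi>_cell[OF x]])
    then show ?thesis
      unfolding \<Psi>_in[OF x] by (simp add: \<psi>\<rho>(2)[OF cell_ab[OF x]] algebra_simps)
  qed (simp add: \<Psi>_out)
  have \<Psi>_0: "\<Psi> 0 x = x" for x
  proof (cases "x \<in> K")
    case True
    then obtain i where x: "x \<in> cell i" by (auto simp: K_def)
    then have "fst x \<in> {a i<..<b i}" by (auto simp: cell_def)
    then show ?thesis unfolding \<Psi>_in[OF x] by (simp add: \<rho>\<psi>(1))
  qed (simp add: \<Psi>_out)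
  have Khalf: "K \<subseteq> half_space" using K by (simp add: bounded_half_sets_def)
  have half: "\<Psi> t x \<in> half_space" if "x \<in> half_space" for t x
    using that \<Psi>_K[of x t] \<Psi>_out[of x t] Khalf by (cases "x \<in> K") auto
  have bij: "bij_betw (\<Psi> t) half_space half_space" for t
    by (rule bij_betw_byWitness[where f' = "\<Psi> (- t)"]) (auto simp: \<Psi>_add \<Psi>_0 half)
  have \<Psi>_meas: "(\<lambda>(t, x). \<Psi> t x) \<in> borel \<Otimes>\<^sub>M (borel \<Otimes>\<^sub>M borel) \<rightarrow>\<^sub>M borel \<Otimes>\<^sub>M borel"
    unfolding \<Psi>_def case_prod_unfold by measurable
  have \<Psi>_meas1[measurable]: "\<Psi> t \<in> borel \<Otimes>\<^sub>M borel \<rightarrow>\<^sub>M borel \<Otimes>\<^sub>M borel" for t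
    unfolding \<Psi>_def by measurable
  have pre: "{x \<in> half_space. \<Psi> t x \<in> A} \<in> bounded_half_sets" if A: "A \<in> bounded_half_sets" for t A
  proof -
    have [measurable]: "A \<in> sets (borel \<Otimes>\<^sub>M borel)" using A by (simp add: bounded_half_sets_def)
    have "{x \<in> space (borel \<Otimes>\<^sub>M borel). x \<in> half_space \<and> \<Psi> t x \<in> A} \<in> sets (borel \<Otimes>\<^sub>M borel)" by measurable
    moreover have "{x \<in> space (borel \<Otimes>\<^sub>M borel). x \<in> half_space \<and> \<Psi> t x \<in> A} = {x \<in> half_space. \<Psi> t x \<in> A}"
      by (auto simp: space_pair_measure)
    moreover have "bounded {x \<in> half_space. \<Psi> t x \<in> A}"
    proof (rule bounded_subset[of "A \<union> K"])
      show "bounded (A \<union> K)" using A K by (simp add: bounded_half_sets_def)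
      show "{x \<in> half_space. \<Psi> t x \<in> A} \<subseteq> A \<union> K"
      proof
        fix x assume "x \<in> {x \<in> half_space. \<Psi> t x \<in> A}"
        then show "x \<in> A \<union> K" using \<Psi>_out[of x t] by (cases "x \<in> K") auto
      qed
    qed
    ultimately show ?thesis by (auto simp: bounded_half_sets_def)
  qed
  \<comment> \<open>For a fixed mark only the time moves, so integrating the one-dimensional bound
    over \<open>\<mu>\<close> bounds the intensity.\<close>
  have \<Lambda>_cell: "emeasure (intensity \<mu>) {x \<in> cell i. \<Psi> t x \<in> A} \<le> ennreal (exp (L i * \<bar>t $ i\<bar>)) * emeasure (intensity \<mu>) (A \<inter> cell i)"
    if A: "A \<in> bounded_half_sets" for t i A
  proof -
    interpret half_line: sigma_finite_measure half_line
      unfolding half_line_def by (rule sigma_finite_measure_restrict_space) (auto intro: lborel.sigma_finite_measure_axioms)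
    interpret I: pair_sigma_finite half_line \<mu> ..
    have hl: "emeasure half_line S = emeasure lborel S" if "S \<in> sets borel" "S \<subseteq> {0..}" for S
      using that unfolding half_line_def by (subst emeasure_restrict_space) auto
    have [measurable]: "A \<in> sets (borel \<Otimes>\<^sub>M borel)" using A by (simp add: bounded_half_sets_def)
    have Au: "{\<tau>. (\<tau>, u) \<in> A} \<in> sets borel" for u
      using measurable_sets[OF measurable_Pair2'[of u borel borel], of A] by (simp add: vimage_def)
    have Am: "A \<inter> cell i \<in> sets (half_line \<Otimes>\<^sub>M \<mu>)"
      using bounded_half_sets_intensity[of "A \<inter> cell i"] bounded_half_sets_Int_Diff[OF A cell_bhs] by (simp add: intensity_def)
    have "{x \<in> cell i. \<Psi> t x \<in> A} = {x \<in> half_space. \<Psi> t x \<in> A} \<inter> cell i"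
      using cell_bhs[of i] by (auto simp: bounded_half_sets_def)
    then have Bm: "{x \<in> cell i. \<Psi> t x \<in> A} \<in> sets (half_line \<Otimes>\<^sub>M \<mu>)"
      using bounded_half_sets_intensity[of "{x \<in> half_space. \<Psi> t x \<in> A} \<inter> cell i"] bounded_half_sets_Int_Diff[OF pre[OF A] cell_bhs]
      by (simp add: intensity_def)
    have "emeasure (intensity \<mu>) {x \<in> cell i. \<Psi> t x \<in> A} = (\<integral>\<^sup>+u. emeasure half_line ((\<lambda>\<tau>. (\<tau>, u)) -` {x \<in> cell i. \<Psi> t x \<in> A}) \<partial>\<mu>)"
      unfolding intensity_def by (rule I.emeasure_pair_measure_alt2[OF Bm])
    also have "\<dots> \<le> (\<integral>\<^sup>+u. ennreal (exp (L i * \<bar>t $ i\<bar>)) * emeasure half_line ((\<lambda>\<tau>. (\<tau>, u)) -` (A \<inter> cell i)) \<partial>\<mu>)"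
    proof (rule nn_integral_mono)
      fix u
      show "emeasure half_line ((\<lambda>\<tau>. (\<tau>, u)) -` {x \<in> cell i. \<Psi> t x \<in> A}) \<le> ennreal (exp (L i * \<bar>t $ i\<bar>)) * emeasure half_line ((\<lambda>\<tau>. (\<tau>, u)) -` (A \<inter> cell i))"
      proof (cases "u \<in> \<Gamma> i \<and> a i < b i")
        case True
        have s1: "(\<lambda>\<tau>. (\<tau>, u)) -` {x \<in> cell i. \<Psi> t x \<in> A} = {\<tau> \<in> {a i<..<b i}. \<psi> i (\<rho> i \<tau> - t $ i) \<in> {\<tau>. (\<tau>, u) \<in> A}}"
          using True \<Psi>_in[of "(_, u)" i t] by (auto simp: cell_def)
        have s2: "(\<lambda>\<tau>. (\<tau>, u)) -` (A \<inter> cell i) = {\<tau>. (\<tau>, u) \<in> A} \<inter> {a i<..<b i}"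
          using True by (auto simp: cell_def)
        have p: "{a i<..<b i} \<subseteq> {0..}" using a0[of i] True by auto
        note [measurable] = Au[of u]
        have m1: "{\<tau> \<in> {a i<..<b i}. \<psi> i (\<rho> i \<tau> - t $ i) \<in> {\<tau>. (\<tau>, u) \<in> A}} \<in> sets borel" by measurable
        have m2: "{\<tau>. (\<tau>, u) \<in> A} \<inter> {a i<..<b i} \<in> sets borel" by (intro sets.Int Au) simp
        have p1: "{\<tau> \<in> {a i<..<b i}. \<psi> i (\<rho> i \<tau> - t $ i) \<in> {\<tau>. (\<tau>, u) \<in> A}} \<subseteq> {0..}" and p2: "{\<tau>. (\<tau>, u) \<in> A} \<inter> {a i<..<b i} \<subseteq> {0..}"
          using p by blast+
        show ?thesis
          unfolding s1 s2 hl[OF m1 p1] hl[OF m2 p2] by (rule emle[OF Au])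
      next
        case False
        then have s1: "(\<lambda>\<tau>. (\<tau>, u)) -` {x \<in> cell i. \<Psi> t x \<in> A} = {}" by (auto simp: cell_def)
        show ?thesis unfolding s1 by simp
      qed
    qed
    also have "\<dots> = ennreal (exp (L i * \<bar>t $ i\<bar>)) * (\<integral>\<^sup>+u. emeasure half_line ((\<lambda>\<tau>. (\<tau>, u)) -` (A \<inter> cell i)) \<partial>\<mu>)"
      by (rule nn_integral_cmult) (rule I.measurable_emeasure_Pair2[OF Am])
    also have "(\<integral>\<^sup>+u. emeasure half_line ((\<lambda>\<tau>. (\<tau>, u)) -` (A \<inter> cell i)) \<partial>\<mu>) = emeasure (intensity \<mu>) (A \<inter> cell i)"
      unfolding intensity_def by (rule I.emeasure_pair_measure_alt2[OF Am, symmetric])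
    finally show ?thesis .
  qed
  \<comment> \<open>Every \<open>L i\<close> is nonnegative, so the exponential of the sum dominates
    the factor of each cell.\<close>
  define c where "c t = exp (\<Sum>i\<in>UNIV. L i * \<bar>t $ i\<bar>)" for t :: "real^'m"
  have c_ge: "exp (L i * \<bar>t $ i\<bar>) \<le> c t" for i t
    unfolding c_def using L0 by (subst exp_le_cancel_iff, intro member_le_sum) auto
  have \<Lambda>_le: "\<Lambda> {x \<in> half_space. \<Psi> t x \<in> A} \<le> c t * \<Lambda> A" if A: "A \<in> bounded_half_sets" "A \<subseteq> K" for t A
  proof -
    have cellA: "{x \<in> cell i. \<Psi> t x \<in> A} \<in> bounded_half_sets" for i
    proof -
      have "{x \<in> cell i. \<Psi> t x \<in> A} = {x \<in> half_space. \<Psi> t x \<in> A} \<inter> cell i"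
        using cell_bhs[of i] by (auto simp: bounded_half_sets_def)
      then show ?thesis using bounded_half_sets_Int_Diff[OF pre[OF A(1)] cell_bhs] by simp
    qed
    have Acell: "A \<inter> cell i \<in> bounded_half_sets" for i using bounded_half_sets_Int_Diff[OF A(1) cell_bhs] by simp
    have eq: "{x \<in> half_space. \<Psi> t x \<in> A} = (\<Union>i\<in>UNIV. {x \<in> cell i. \<Psi> t x \<in> A})"
    proof (intro set_eqI iffI)
      fix x assume x: "x \<in> {x \<in> half_space. \<Psi> t x \<in> A}"
      then have "x \<in> K" using \<Psi>_out[of x t] A(2) by (cases "x \<in> K") auto
      then show "x \<in> (\<Union>i\<in>UNIV. {x \<in> cell i. \<Psi> t x \<in> A})" using x by (auto simp: K_def)
    next
      fix x assume "x \<in> (\<Union>i\<in>UNIV. {x \<in> cell i. \<Psi> t x \<in> A})"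
      then show "x \<in> {x \<in> half_space. \<Psi> t x \<in> A}" using Khalf by (auto simp: K_def)
    qed
    have "ennreal (\<Lambda> {x \<in> half_space. \<Psi> t x \<in> A}) = emeasure (intensity \<mu>) {x \<in> half_space. \<Psi> t x \<in> A}"
      by (rule emeasure_intensity[OF pre[OF A(1)], symmetric])
    also have "\<dots> \<le> (\<Sum>i\<in>UNIV. emeasure (intensity \<mu>) {x \<in> cell i. \<Psi> t x \<in> A})"
      unfolding eq by (rule emeasure_subadditive_finite) (use bounded_half_sets_intensity[OF cellA] in auto)
    also have "\<dots> \<le> (\<Sum>i\<in>UNIV. ennreal (c t) * emeasure (intensity \<mu>) (A \<inter> cell i))"
      by (intro sum_mono order_trans[OF \<Lambda>_cell[OF A(1)]] mult_right_mono ennreal_leI c_ge) simp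
    also have "\<dots> = ennreal (c t) * (\<Sum>i\<in>UNIV. emeasure (intensity \<mu>) (A \<inter> cell i))" by (simp add: sum_distrib_left)
    also have "(\<Sum>i\<in>UNIV. emeasure (intensity \<mu>) (A \<inter> cell i)) = emeasure (intensity \<mu>) (\<Union>i\<in>UNIV. A \<inter> cell i)"
    proof (rule sum_emeasure)
      show "disjoint_family_on (\<lambda>i. A \<inter> cell i) UNIV" using disj by (auto simp: disjoint_family_on_def)
    qed (use bounded_half_sets_intensity[OF Acell] in auto)
    also have "(\<Union>i\<in>UNIV. A \<inter> cell i) = A" using A(2) by (auto simp: K_def)
    also have "ennreal (c t) * emeasure (intensity \<mu>) A = ennreal (c t * \<Lambda> A)"
      unfolding emeasure_intensity[OF A(1)] by (rule ennreal_mult[symmetric]) (auto simp: c_def \<Lambda>_def)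
    finally show ?thesis by (subst (asm) ennreal_le_iff) (auto simp: c_def \<Lambda>_def)
  qed
  define T where "T t \<omega> = \<Psi> t ` \<omega>" for t \<omega>
  define Om where "Om n = {\<omega> \<in> configurations. card (\<omega> \<inter> K) = n}" for n :: nat
  \<comment> \<open>Each of the \<open>n\<close> points in the cells costs at most
    \<open>c t\<close>, and \<open>norm t \<le> real R\<close> bounds every coordinate by
    \<open>R\<close>.\<close>
  define C where "C n R = exp (\<Sum>i\<in>UNIV. L i * real R) ^ n" for n R :: nat
  have T_meas: "(\<lambda>(t, \<omega>). T t \<omega>) \<in> borel \<Otimes>\<^sub>M M \<rightarrow>\<^sub>M M"
    unfolding T_def
    by (rule measurable_image_configuration[OF \<Psi>_meas half _ K \<Psi>_out]) (use bij in \<open>auto simp: bij_betw_def\<close>)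
  have T_meas1: "(\<lambda>\<omega>. \<Psi> t ` \<omega>) \<in> M \<rightarrow>\<^sub>M M" for t
    using measurable_compose[OF measurable_Pair1'[of t borel M] T_meas] by (simp add: T_def)
  have act: "quasi_invariant_action M T Om C"
  proof (unfold_locales)
    show "(\<lambda>(t, \<omega>). T t \<omega>) \<in> borel \<Otimes>\<^sub>M M \<rightarrow>\<^sub>M M" by (rule T_meas)
    show "T s (T t \<omega>) = T (s + t) \<omega>" for s t \<omega> by (simp add: T_def image_image \<Psi>_add)
    show "T 0 \<omega> = \<omega>" for \<omega> by (simp add: T_def \<Psi>_0)
    show "Om n \<in> sets M" for n
      using sets_atom[of "{K}" "\<lambda>_. n"] K by (simp add: atom_def Om_def)
    show "\<exists>n. \<omega> \<in> Om n" if "\<omega> \<in> space M" for \<omega> using that by (simp add: Om_def space_M)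
    fix A n and t :: "real^'m" and R :: nat
    assume A: "A \<in> sets M" and t: "norm t \<le> real R"
    have "{\<omega> \<in> Om n. T t \<omega> \<in> A} = {\<omega> \<in> configurations. card (\<omega> \<inter> K) = n \<and> \<Psi> t ` \<omega> \<in> A}"
      by (auto simp: Om_def T_def)
    also have "emeasure M \<dots> \<le> ennreal (c t ^ n) * emeasure M (A \<inter> {\<omega> \<in> configurations. card (\<omega> \<inter> K) = n})"
      by (rule emeasure_M_quasi[OF bij pre K \<Psi>_out \<Psi>_K _ \<Lambda>_le T_meas1 A]) (simp_all add: c_def)
    also have "\<dots> \<le> ennreal (C n R) * emeasure M (A \<inter> Om n)"
    proof -
      have "\<bar>t $ i\<bar> \<le> real R" for i using component_le_norm_cart[of t i] t by linarith
      then have "c t \<le> exp (\<Sum>i\<in>UNIV. L i * real R)"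
        unfolding c_def by (subst exp_le_cancel_iff) (intro sum_mono mult_left_mono L0)
      then have "c t ^ n \<le> C n R" unfolding C_def by (rule power_mono) (simp add: c_def)
      then show ?thesis unfolding Om_def by (intro mult_right_mono ennreal_leI) auto
    qed
    finally show "emeasure M {\<omega> \<in> Om n. T t \<omega> \<in> A} \<le> ennreal (C n R) * emeasure M (A \<inter> Om n)" .
  qed
  show thesis
  proof (rule that[OF act])
    fix i e and \<omega> :: "(real \<times> 'u) set" assume \<omega>: "\<omega> \<in> configurations"
    have "(case x of (\<tau>, u) \<Rightarrow> (if u \<in> \<Gamma> i then time_stretch (\<lambda>t. - (e * h i t)) \<tau> else \<tau>, u)) = \<Psi> (axis i e) x" if x: "x \<in> \<omega>" for x
    proof -
      obtain \<tau> u where xt: "x = (\<tau>, u)" by (cases x)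
      have \<tau>: "\<tau> \<ge> 0" using x \<omega> xt by (auto simp: configurations_def)
      show ?thesis
      proof (cases "x \<in> cell i")
        case True
        then have "\<tau> \<in> {a i<..<b i}" "u \<in> \<Gamma> i" by (auto simp: cell_def xt)
        then show ?thesis unfolding \<Psi>_in[OF True] by (simp add: xt \<rho>\<psi>(2) axis_def)
      next
        case False
        \<comment> \<open>A point in another cell \<open>j\<close> follows coordinate
          \<open>j\<close> of \<open>axis i e\<close>, which is \<open>0\<close>.\<close>
        have "\<Psi> (axis i e) x = x"
        proof (cases "x \<in> K")
          case True
          then obtain j where j: "x \<in> cell j" by (auto simp: K_def)
          then have "i \<noteq> j" using False by auto
          moreover have "fst x \<in> {a j<..<b j}" using j by (auto simp: cell_def)
          ultimately show ?thesis unfolding \<Psi>_in[OF j] by (simp add: axis_def \<rho>\<psi>(1))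
        qed (rule \<Psi>_out)
        moreover have "time_stretch (\<lambda>t. - (e * h i t)) \<tau> = \<tau>" if "u \<in> \<Gamma> i"
        proof (rule time_stretch_fixed[OF h \<tau>])
          show "J (h i) \<tau> = 0" using False that \<tau> by (intro zero) (auto simp: cell_def xt)
        qed
        ultimately show ?thesis by (simp add: xt)
      qed
    qed
    then show "config_stretch (\<lambda>t. e * h i t) (\<Gamma> i) \<omega> = T (axis i e) \<omega>"
      unfolding config_stretch_def T_def by (intro image_cong) auto
  qed
qed

end

text \<open>A pointwise bound takes the place of Hoelder's inequality: above a threshold
  \<open>c\<close>, \<open>\<bar>x\<bar>\<close> is at most
  \<open>c powr (1 - p) * \<bar>x\<bar> powr p\<close>, and below it at most
  \<open>c\<close>.\<close>

lemma (in prob_space) Lp_limit_imp_L1_limit: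
  fixes X :: "'b \<Rightarrow> 'a \<Rightarrow> real"
  assumes [measurable]: "\<And>e. X e \<in> borel_measurable M" and p: "p \<ge> 1"
    and lim: "((\<lambda>e. \<integral>\<^sup>+\<omega>. ennreal (\<bar>X e \<omega>\<bar> powr p) \<partial>M) \<longlongrightarrow> 0) F"
  shows "((\<lambda>e. \<integral>\<^sup>+\<omega>. ennreal \<bar>X e \<omega>\<bar> \<partial>M) \<longlongrightarrow> 0) F"
proof (rule order_tendstoI)
  fix y :: ennreal assume "0 < y"
  then obtain z where z: "0 < z" "z < y" using dense by blast
  then obtain z' where z': "z = ennreal z'" "z' > 0" by (cases z) auto
  \<comment> \<open>Once the integral of the \<open>p\<close>-th power is below
    \<open>c powr p\<close>, each of the two terms contributes at most \<open>c\<close>, together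
    \<open>z'\<close>.\<close>
  define c where "c = z' / 2"
  have c: "c > 0" using z' by (simp add: c_def)
  have pt: "\<bar>x\<bar> \<le> c + c powr (1 - p) * \<bar>x\<bar> powr p" for x :: real
  proof (cases "\<bar>x\<bar> \<le> c")
    case False
    then have "\<bar>x\<bar> = \<bar>x\<bar> powr (1 - p) * \<bar>x\<bar> powr p" using c by (simp add: powr_add[symmetric])
    also have "\<dots> \<le> c powr (1 - p) * \<bar>x\<bar> powr p"
      using False c p by (intro mult_right_mono powr_mono2') auto
    finally show ?thesis using c by simp
  qed (simp add: add_increasing2)
  have "\<forall>\<^sub>F e in F. (\<integral>\<^sup>+\<omega>. ennreal (\<bar>X e \<omega>\<bar> powr p) \<partial>M) < ennreal (c powr p)"
    by (rule order_tendstoD(2)[OF lim]) (use c in simp)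
  then show "\<forall>\<^sub>F e in F. (\<integral>\<^sup>+\<omega>. ennreal \<bar>X e \<omega>\<bar> \<partial>M) < y"
  proof eventually_elim
    case (elim e)
    have "(\<integral>\<^sup>+\<omega>. ennreal \<bar>X e \<omega>\<bar> \<partial>M) \<le> (\<integral>\<^sup>+\<omega>. ennreal c + ennreal (c powr (1 - p)) * ennreal (\<bar>X e \<omega>\<bar> powr p) \<partial>M)"
      using pt c by (intro nn_integral_mono) (simp add: ennreal_mult[symmetric] ennreal_plus[symmetric] ennreal_leI del: ennreal_plus)
    also have "\<dots> = ennreal c + ennreal (c powr (1 - p)) * (\<integral>\<^sup>+\<omega>. ennreal (\<bar>X e \<omega>\<bar> powr p) \<partial>M)"
      by (subst nn_integral_add) (auto simp: nn_integral_cmult emeasure_space_1)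
    also have "\<dots> \<le> ennreal c + ennreal (c powr (1 - p)) * ennreal (c powr p)"
      using elim by (intro add_left_mono mult_left_mono) auto
    also have "\<dots> = ennreal z'"
      using c by (simp add: ennreal_mult[symmetric] powr_add[symmetric] ennreal_plus[symmetric] del: ennreal_plus) (simp add: c_def)
    finally show ?case using z z' by simp
  qed
qed simp

lemma (in prob_space) Lp_imp_L1_finite:
  assumes "integrable M (\<lambda>x. \<bar>f x\<bar> powr p)" "p \<ge> 1"
  shows "(\<integral>\<^sup>+x. ennreal \<bar>f x\<bar> \<partial>M) < \<infinity>"
proof -
  have pt: "\<bar>x\<bar> \<le> 1 + \<bar>x\<bar> powr p" for x :: real
  proof (cases "\<bar>x\<bar> \<le> 1")
    case False
    then have "\<bar>x\<bar> powr 1 \<le> \<bar>x\<bar> powr p" using assms(2) by (intro powr_mono) auto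
    then show ?thesis using False by simp
  qed (simp add: add_increasing2)
  have "(\<integral>\<^sup>+x. ennreal \<bar>f x\<bar> \<partial>M) \<le> (\<integral>\<^sup>+x. 1 + ennreal (\<bar>f x\<bar> powr p) \<partial>M)"
    using pt by (intro nn_integral_mono) (simp add: ennreal_leI flip: ennreal_plus ennreal_1)
  also have "\<dots> = 1 + (\<integral>\<^sup>+x. ennreal (\<bar>f x\<bar> powr p) \<partial>M)"
    using assms(1) by (subst nn_integral_add) (auto simp: emeasure_space_1)
  also have "\<dots> < \<infinity>" using assms(1) by (simp add: nn_integral_eq_integral)
  finally show ?thesis .
qed

theorem theorem2p1:
  fixes \<mu> :: "'u::metric_space measure"
    and P :: "(real \<times> 'u) set measure"
    and a b :: "'m::finite \<Rightarrow> real"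
    and h :: "'m \<Rightarrow> real \<Rightarrow> real"
    and \<Gamma> :: "'m \<Rightarrow> 'u set"
    and f :: "(real \<times> 'u) set \<Rightarrow> real ^ 'm"
    and D :: "'m \<Rightarrow> 'm \<Rightarrow> (real \<times> 'u) set \<Rightarrow> real"
    and S :: "(real \<times> 'u) set \<Rightarrow> real ^ 'm ^ 'm"
    and N :: "(real \<times> 'u) set set"
  assumes "locally_compact_space (euclidean :: 'u topology)"
    and "sets \<mu> = sets borel"
    and "sigma_finite_measure \<mu>"
    and "\<And>B. B \<in> bounded_borel \<Longrightarrow> emeasure \<mu> B < \<infinity>"
    and "poisson_law \<mu> P"
    and "differential_grid a b h \<Gamma>"
    and "f \<in> borel_measurable P"
    and "\<And>j. has_grid_derivatives P h \<Gamma> (\<lambda>\<omega>. f \<omega> $ j) (\<lambda>i. D i j)"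
    and "\<And>\<omega>. S \<omega> = (\<chi> i j. D i j \<omega>)"
    and "N = {\<omega> \<in> space P. invertible (S \<omega>)}"
  shows "absolutely_continuous lborel (distr (restrict_space P N) borel f)"
proof -
  interpret PC: poisson_configurations \<mu> P by (rule poisson_configurations.intro) (fact assms)+
  obtain T Om C where act: "quasi_invariant_action PC.M T Om C"
    and T: "\<And>i e \<omega>. \<omega> \<in> configurations \<Longrightarrow> config_stretch (\<lambda>t. e * h i t) (\<Gamma> i) \<omega> = T (axis i e :: real^'m) \<omega>"
    by (rule PC.grid_action[OF assms(6)], rule that)
  interpret Q: quasi_invariant_action PC.M T Om C by (rule act)
  have dq: "diff_quotient (h i) (\<Gamma> i) g e \<omega> = (g (T (axis i e) \<omega>) - g \<omega>) / e" if "\<omega> \<in> configurations" for i g e \<omega>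
    using T[OF that] by (simp add: diff_quotient_def)
  note [measurable] = assms(7)
  have D_meas[measurable]: "D i j \<in> borel_measurable P" for i j
    using assms(8)[of j] by (auto simp: has_grid_derivatives_def has_as_derivative_def has_Lp_derivative_def in_Lp_def)
  \<comment> \<open>The action is measurable for the counts, so \<open>f\<close> and
    \<open>D\<close> are replaced by versions measurable with respect to \<open>M\<close>.\<close>
  have "\<exists>\<phi>\<in>borel_measurable PC.M. AE \<omega> in PC.M. f \<omega> $ j = \<phi> \<omega>" for j
    by (rule PC.ex_M_version) measurable
  then obtain \<phi> where \<phi>[measurable]: "\<And>j. \<phi> j \<in> borel_measurable PC.M" and \<phi>_eq: "\<And>j. AE \<omega> in PC.M. f \<omega> $ j = \<phi> j \<omega>"
    by metis
  have "\<exists>\<delta>\<in>borel_measurable PC.M. AE \<omega> in PC.M. D i j \<omega> = \<delta> \<omega>" for i j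
    by (rule PC.ex_M_version) measurable
  then obtain \<delta> where \<delta>[measurable]: "\<And>i j. \<delta> i j \<in> borel_measurable PC.M" and \<delta>_eq: "\<And>i j. AE \<omega> in PC.M. D i j \<omega> = \<delta> i j \<omega>"
    by metis
  have ess: "AE \<omega> in PC.M. ess_deriv (\<lambda>e. \<phi> j (T (axis i e) \<omega>)) (\<delta> i j \<omega>)" for i j
  proof -
    consider "has_as_derivative P (h i) (\<Gamma> i) (\<lambda>\<omega>. f \<omega> $ j) (D i j)"
      | p where "p \<ge> 1" "has_Lp_derivative p P (h i) (\<Gamma> i) (\<lambda>\<omega>. f \<omega> $ j) (D i j)"
      using assms(8)[of j] by (auto simp: has_grid_derivatives_def)
    then show ?thesis
    proof cases
      case 1
      then have "AE \<omega> in PC.M. ((\<lambda>e. diff_quotient (h i) (\<Gamma> i) (\<lambda>\<omega>. f \<omega> $ j) e \<omega>) \<longlongrightarrow> D i j \<omega>) (at 0)"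
        by (simp add: has_as_derivative_def PC.AE_P_iff_AE_M)
      then have "AE \<omega> in PC.M. ((\<lambda>e. (f (T (axis i e) \<omega>) $ j - f \<omega> $ j) / e) \<longlongrightarrow> D i j \<omega>) (at 0)"
        using AE_space by eventually_elim (simp add: dq PC.space_M)
      then show ?thesis by (rule Q.AE_ess_deriv_of_AE_limit[OF \<phi> \<delta> \<phi>_eq \<delta>_eq])
    next
      case 2
      let ?X = "\<lambda>e \<omega>. (\<phi> j (T (axis i e) \<omega>) - \<phi> j \<omega>) / e - \<delta> i j \<omega>"
      have lim: "((\<lambda>e. \<integral>\<^sup>+\<omega>. ennreal (\<bar>diff_quotient (h i) (\<Gamma> i) (\<lambda>\<omega>. f \<omega> $ j) e \<omega> - D i j \<omega>\<bar> powr p) \<partial>P) \<longlongrightarrow> 0) (at 0)"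
        and int: "integrable P (\<lambda>\<omega>. \<bar>f \<omega> $ j\<bar> powr p)" "integrable P (\<lambda>\<omega>. \<bar>D i j \<omega>\<bar> powr p)"
        using 2(2) by (auto simp: has_Lp_derivative_def in_Lp_def)
      have "(\<integral>\<^sup>+\<omega>. ennreal (\<bar>diff_quotient (h i) (\<Gamma> i) (\<lambda>\<omega>. f \<omega> $ j) e \<omega> - D i j \<omega>\<bar> powr p) \<partial>P)
        = (\<integral>\<^sup>+\<omega>. ennreal (\<bar>?X e \<omega>\<bar> powr p) \<partial>PC.M)" for e
      proof (rule PC.nn_integral_P_eq_M)
        \<comment> \<open>The version has to agree with \<open>f\<close> after the stretching as
          well; \<open>AE_T\<close> provides this for each fixed \<open>e\<close>.\<close>
        show "AE \<omega> in PC.M. ennreal (\<bar>diff_quotient (h i) (\<Gamma> i) (\<lambda>\<omega>. f \<omega> $ j) e \<omega> - D i j \<omega>\<bar> powr p) = ennreal (\<bar>?X e \<omega>\<bar> powr p)"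
          using \<phi>_eq[of j] Q.AE_T[OF \<phi>_eq[of j], of "axis i e"] \<delta>_eq[of i j] AE_space
          by eventually_elim (simp add: dq PC.space_M)
      qed measurable
      with lim have "((\<lambda>e. \<integral>\<^sup>+\<omega>. ennreal (\<bar>?X e \<omega>\<bar> powr p) \<partial>PC.M) \<longlongrightarrow> 0) (at 0)" by simp
      then have L1: "((\<lambda>e. \<integral>\<^sup>+\<omega>. ennreal \<bar>?X e \<omega>\<bar> \<partial>PC.M) \<longlongrightarrow> 0) (at 0)"
        by (rule PC.M.Lp_limit_imp_L1_limit[rotated 2]) (use 2(1) in measurable)
      have "(\<integral>\<^sup>+\<omega>. ennreal \<bar>f \<omega> $ j\<bar> \<partial>P) = (\<integral>\<^sup>+\<omega>. ennreal \<bar>\<phi> j \<omega>\<bar> \<partial>PC.M)"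
        by (rule PC.nn_integral_P_eq_M) (use \<phi>_eq[of j] in eventually_elim, simp, measurable)
      then have fin\<phi>: "(\<integral>\<^sup>+\<omega>. ennreal \<bar>\<phi> j \<omega>\<bar> \<partial>PC.M) < \<infinity>"
        using PC.P.Lp_imp_L1_finite[OF int(1) 2(1)] by simp
      have "(\<integral>\<^sup>+\<omega>. ennreal \<bar>D i j \<omega>\<bar> \<partial>P) = (\<integral>\<^sup>+\<omega>. ennreal \<bar>\<delta> i j \<omega>\<bar> \<partial>PC.M)"
        by (rule PC.nn_integral_P_eq_M) (use \<delta>_eq[of i j] in eventually_elim, simp, measurable)
      then have fin\<delta>: "(\<integral>\<^sup>+\<omega>. ennreal \<bar>\<delta> i j \<omega>\<bar> \<partial>PC.M) < \<infinity>"
        using PC.P.Lp_imp_L1_finite[OF int(2) 2(1)] by simp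
      show ?thesis by (rule Q.AE_ess_deriv_of_mean_limit[OF \<phi> \<delta> fin\<phi> fin\<delta> L1])
    qed
  qed
  \<comment> \<open>Invertibility is the nonvanishing of the determinant, a polynomial in measurable
    entries.\<close>
  have N[measurable]: "N \<in> sets P"
  proof -
    have [measurable]: "(\<lambda>\<omega>. det ((\<chi> i j. D i j \<omega>) :: real^'m^'m)) \<in> borel_measurable P"
      unfolding det_def by simp
    show ?thesis unfolding assms(10) assms(9) invertible_det_nz by measurable
  qed
  show ?thesis
    unfolding absolutely_continuous_def
  proof
    fix E :: "(real^'m) set" assume E: "E \<in> null_sets lborel"
    then have [measurable]: "E \<in> sets borel" by auto
    have all: "AE \<omega> in PC.M. (\<forall>j. f \<omega> $ j = \<phi> j \<omega>) \<and> (\<forall>i j. D i j \<omega> = \<delta> i j \<omega>)"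
      using \<phi>_eq \<delta>_eq by (simp add: AE_all_countable)
    have "AE \<omega> in PC.M. \<not> (invertible ((\<chi> i l. \<delta> i l \<omega>) :: real^'m^'m) \<and> ((\<chi> l. \<phi> l \<omega>) :: real^'m) \<in> E)"
      by (rule Q.AE_not_invertible_and_null_action[OF \<phi> \<delta> ess E])
    with all have "AE \<omega> in PC.M. \<not> (invertible (S \<omega>) \<and> f \<omega> \<in> E)"
    proof eventually_elim
      case (elim \<omega>)
      then have "(\<chi> i l. \<delta> i l \<omega>) = S \<omega>" "(\<chi> l. \<phi> l \<omega>) = f \<omega>"
        by (simp_all add: assms(9) vec_eq_iff)
      then show ?case using elim by simp
    qed
    then have "AE \<omega> in P. \<not> (invertible (S \<omega>) \<and> f \<omega> \<in> E)" by (simp add: PC.AE_P_iff_AE_M)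
    then have AE: "AE \<omega> in P. \<omega> \<notin> {\<omega> \<in> space P. \<omega> \<in> N \<and> f \<omega> \<in> E}"
      by eventually_elim (auto simp: assms(10))
    have "{\<omega> \<in> space P. \<omega> \<in> N \<and> f \<omega> \<in> E} \<in> sets P" by measurable
    with AE have null: "emeasure P {\<omega> \<in> space P. \<omega> \<in> N \<and> f \<omega> \<in> E} = 0"
      by (subst (asm) AE_iff_measurable[OF _ refl]) (auto intro!: arg_cong[where f = "emeasure P"] elim: back_subst[of "\<lambda>x. x = 0"])
    have fm: "f \<in> borel_measurable (restrict_space P N)" by (rule measurable_restrict_space1) measurable
    have "emeasure (distr (restrict_space P N) borel f) E = emeasure (restrict_space P N) (f -` E \<inter> space (restrict_space P N))"
      by (rule emeasure_distr[OF fm]) measurable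
    also have "\<dots> = emeasure P (f -` E \<inter> space (restrict_space P N))"
      by (rule emeasure_restrict_space) (auto simp: space_restrict_space)
    also have "f -` E \<inter> space (restrict_space P N) = {\<omega> \<in> space P. \<omega> \<in> N \<and> f \<omega> \<in> E}"
      using sets.sets_into_space[OF N] by (auto simp: space_restrict_space)
    finally show "E \<in> null_sets (distr (restrict_space P N) borel f)"
      using null by (intro null_setsI) auto
  qed
qed

end
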